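(* Let $p,\mu,\kappa:(0,\infty)\to\mathbb{R}$ be smooth functions with $\mu>0$, $\kappa>0$, $p'<0$ and $p''>0$ on $(0,\infty)$. Assume that the end states $(V^\pm,U^\pm)$ (with $V^\pm>0$, $U^\pm\in\mathbb{R}$) and the speed $s\in\mathbb{R}$ define a compressive $1$-shock (backward shock) for the $p$-system $v_t-u_x=0$, $u_t+p(v)_x=0$. Then there exists a unique (up to translations) traveling profile $(V,U)$, i.e. smooth functions $V:\mathbb{R}\to(0,\infty)$, $U:\mathbb{R}\to\mathbb{R}$ solving $$-sV'-U'=0,\qquad -sU'+p(V)'=\Big(\frac{\mu(V)}{V}U'\Big)'-\Big(\kappa(V)V''+\tfrac12\kappa'(V)(V')^2\Big)'$$ with $\lim_{y\to\pm\infty}V(y)=V^\pm$ and $\lim_{y\to\pm\infty}U(y)=U^\pm$. Moreover, this traveling wave is oscillating whenever $$0<\eta(V^-)<\frac{2V^-\sqrt{f'(V^-)}}{|s|},$$ where $\eta(v)=\mu(v)/\sqrt{\kappa(v)}$ and $f'(v)=p'(v)+s^2$.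
   Context: The system under study is $v_t-u_x=0$, $u_t+p(v)_x=\big(\frac{\mu(v)}{v}u_x\big)_x-\big(\kappa(v)v_{xx}+\frac12\kappa'(v)v_x^2\big)_x$; traveling profiles are solutions $(v,u)(x,t)=(V,U)(x-st)$, with $y=x-st$. The triple $(V^\pm,U^\pm,s)$ defines a compressive $1$-shock (backward shock) if the Rankine–Hugoniot conditions $s(V^+-V^-)=U^--U^+$ and $s(U^+-U^-)=p(V^+)-p(V^-)$ hold and, with characteristic speeds $\lambda_1(v)=-\sqrt{-p'(v)}$, $\lambda_2(v)=\sqrt{-p'(v)}$, the Lax conditions $\lambda_1(V^+)<s<\lambda_1(V^-)$, $s<\lambda_2(V^+)$ hold. In particular $s<0$ and $V^->V^+$. With $f(V)=p(V)+s^2V-C$, $C=s^2V^\pm+p(V^\pm)$, the profile $V$ corresponds to a heteroclinic orbit from $(V^-,0)$ to $(V^+,0)$ of the planar system $V'=Q$, $Q'=-\frac1{\kappa(V)}\big[f(V)+s\frac{\mu(V)}{V}Q+\frac12\kappa'(V)Q^2\big]$. "Oscillating" means that the equilibrium $(V^-,0)$ is a focus of this system, around which the orbit spirals as $y\to-\infty$, so that $V$ is non-monotone. *)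

theory Defs
  imports "HOL-Analysis.Analysis"
begin

text \<open>
  The coefficient functions live on \<open>(0,\<infinity>)\<close>; they are total functions \<open>real \<Rightarrow> real\<close>
  whose values on \<open>{..0}\<close> are irrelevant, since every state is required to be positive.
\<close>

text \<open>Intended for open \<open>S\<close>, where iterated derivatives at points of \<open>S\<close> only depend on \<open>f\<close> on \<open>S\<close>.\<close>

definition smooth_on :: "real set \<Rightarrow> (real \<Rightarrow> real) \<Rightarrow> bool" where
  "smooth_on S f \<longleftrightarrow> (\<forall>n. \<forall>x\<in>S. (deriv ^^ n) f differentiable (at x))"

definition char_speed1 :: "(real \<Rightarrow> real) \<Rightarrow> real \<Rightarrow> real" where
  "char_speed1 p v = - sqrt (- deriv p v)"

definition char_speed2 :: "(real \<Rightarrow> real) \<Rightarrow> real \<Rightarrow> real" where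
  "char_speed2 p v = sqrt (- deriv p v)"

text \<open>\<open>(Vm, Um)\<close> is the left state (limit at \<open>-\<infinity>\<close>), \<open>(Vp, Up)\<close> the right state.\<close>

definition compressive_1_shock ::
    "(real \<Rightarrow> real) \<Rightarrow> real \<Rightarrow> real \<Rightarrow> real \<Rightarrow> real \<Rightarrow> real \<Rightarrow> bool" where
  "compressive_1_shock p Vm Um Vp Up s \<longleftrightarrow>
     s * (Vp - Vm) = Um - Up \<and>
     s * (Up - Um) = p Vp - p Vm \<and>
     char_speed1 p Vp < s \<and> s < char_speed1 p Vm \<and> s < char_speed2 p Vp"

definition traveling_profile ::
    "(real \<Rightarrow> real) \<Rightarrow> (real \<Rightarrow> real) \<Rightarrow> (real \<Rightarrow> real) \<Rightarrow>
     real \<Rightarrow> real \<Rightarrow> real \<Rightarrow> real \<Rightarrow> real \<Rightarrow> (real \<Rightarrow> real) \<Rightarrow> (real \<Rightarrow> real) \<Rightarrow> bool" where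
  "traveling_profile p \<mu> \<kappa> Vm Um Vp Up s V U \<longleftrightarrow>
     smooth_on UNIV V \<and> smooth_on UNIV U \<and> (\<forall>y. V y > 0) \<and>
     (\<forall>y. - s * deriv V y - deriv U y = 0) \<and>
     (\<forall>y. - s * deriv U y + deriv (\<lambda>z. p (V z)) y =
          deriv (\<lambda>z. \<mu> (V z) / V z * deriv U z) y
          - deriv (\<lambda>z. \<kappa> (V z) * deriv (deriv V) z
                       + 1/2 * deriv \<kappa> (V z) * (deriv V z)\<^sup>2) y) \<and>
     (V \<longlongrightarrow> Vm) at_bot \<and> (V \<longlongrightarrow> Vp) at_top \<and>
     (U \<longlongrightarrow> Um) at_bot \<and> (U \<longlongrightarrow> Up) at_top"

text \<open>
  The constant is \<open>C = s\<^sup>2 Vm + p Vm\<close>; by the Rankine--Hugoniot conditions it is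
  the same for \<open>Vp\<close>.
\<close>

definition reduced_flux :: "(real \<Rightarrow> real) \<Rightarrow> real \<Rightarrow> real \<Rightarrow> real \<Rightarrow> real" where
  "reduced_flux p s Vm v = p v + s\<^sup>2 * v - (s\<^sup>2 * Vm + p Vm)"

definition profile_field ::
    "(real \<Rightarrow> real) \<Rightarrow> (real \<Rightarrow> real) \<Rightarrow> (real \<Rightarrow> real) \<Rightarrow> real \<Rightarrow> real \<Rightarrow>
     real^2 \<Rightarrow> real^2" where
  "profile_field p \<mu> \<kappa> s Vm x = (let v = x $ 1; q = x $ 2 in
     vector [q,
       - (1 / \<kappa> v) *
         (reduced_flux p s Vm v + s * (\<mu> v / v) * q + 1/2 * deriv \<kappa> v * q\<^sup>2)])"

definition complex_eigenvalues :: "real^2^2 \<Rightarrow> complex set" where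
  "complex_eigenvalues A =
     {l. \<exists>w :: complex^2. w \<noteq> 0 \<and> (\<chi> i j. complex_of_real (A $ i $ j)) *v w = l *s w}"

definition focus :: "(real^2 \<Rightarrow> real^2) \<Rightarrow> real^2 \<Rightarrow> bool" where
  "focus F z \<longleftrightarrow> F z = 0 \<and> F differentiable (at z) \<and>
     (\<exists>a b. a \<noteq> 0 \<and> b \<noteq> 0 \<and>
        complex_eigenvalues (jacobian F (at z)) = {Complex a b, Complex a (- b)})"

text \<open>
  \<open>\<theta>\<close> is a continuous choice of polar angle about \<open>z\<close>; since it is continuous,
  \<open>at_infinity\<close> amounts to \<open>\<theta> \<rightarrow> +\<infinity>\<close> or \<open>\<theta> \<rightarrow> -\<infinity>\<close>,
  i.e. infinitely many net turns in one fixed direction.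
\<close>

definition spirals_at_bot :: "(real \<Rightarrow> real^2) \<Rightarrow> real^2 \<Rightarrow> bool" where
  "spirals_at_bot \<gamma> z \<longleftrightarrow> (\<gamma> \<longlongrightarrow> z) at_bot \<and>
     (\<exists>y0 \<theta>. continuous_on {..y0} \<theta> \<and>
        (\<forall>y\<le>y0. \<gamma> y \<noteq> z \<and>
           \<gamma> y - z = norm (\<gamma> y - z) *\<^sub>R vector [cos (\<theta> y), sin (\<theta> y)]) \<and>
        filterlim \<theta> at_infinity at_bot)"

definition oscillating ::
    "(real \<Rightarrow> real) \<Rightarrow> (real \<Rightarrow> real) \<Rightarrow> (real \<Rightarrow> real) \<Rightarrow> real \<Rightarrow> real \<Rightarrow>
     (real \<Rightarrow> real) \<Rightarrow> bool" where
  "oscillating p \<mu> \<kappa> s Vm V \<longleftrightarrow>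
     focus (profile_field p \<mu> \<kappa> s Vm) (vector [Vm, 0]) \<and>
     spirals_at_bot (\<lambda>y. vector [V y, deriv V y]) (vector [Vm, 0]) \<and>
     \<not> mono V \<and> \<not> antimono V"

definition eta :: "(real \<Rightarrow> real) \<Rightarrow> (real \<Rightarrow> real) \<Rightarrow> real \<Rightarrow> real" where
  "eta \<mu> \<kappa> v = \<mu> v / sqrt (\<kappa> v)"

end

(* Integrating the momentum equation once turns a profile into an orbit of the planar system with
   velocity V' and momentum P = sqrt(kappa(V)) V', for which P^2/2 + F(V) with F' = f is
   nondecreasing because s < 0.

   Existence: the coefficients are cut off so that the field is globally Lipschitz.  Starting at a
   fixed V between V+ and V- with momentum -q, the set of q for which P becomes positive first and
   the set of q for which V drops below V+ first are open and disjoint, so some q does neither and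
   its orbit tends to the saddle (V+, 0).  The energy then traps the backward orbit in the potential
   well of F around V-, and its dissipation forces convergence to (V-, 0).

   Uniqueness: every profile approaches V+ monotonically from above, and P^2/2, as a function of V
   there, solves a scalar equation whose right-hand side decreases in the unknown; hence P is the
   same function of V for all profiles.

   Oscillation: below the threshold for eta the linearisation at (V-, 0) has non-real eigenvalues,
   and the angular velocity about (V-, 0) is eventually bounded away from zero. *)

theory Submission
  imports Defs
begin

subsection \<open>Ordinary differential equations with a Lipschitz right-hand side\<close>

text \<open>Why this momentum: with \<open>P = sqrt (\<kappa> V) * V'\<close> the capillary term
  \<kappa> V'' + \<kappa>' (V')^2 / 2 equals sqrt \<kappa> times P', so the quadratic term of the
  planar field disappears and V' = r P, P' = b P - r f with r = 1 / sqrt \<kappa>, b = - s \<mu> /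
  (v \<kappa>). The energy then has derivative b P^2, and b > 0 because s < 0.

  The coefficients make sense only for v > 0 and are not bounded. The clamp onto [V+, w] and the
  truncation of P at M are chosen so that the energy never lets the constructed orbit feel them:
  F(w) \<ge> F(V+), and M^2 / 2 exceeds the depth of the well.

  For uniqueness, the equation for P as a function of V is singular at V+, where P and f both
  vanish; a sign in the equation for P^2 / 2 replaces a Lipschitz condition. A given profile comes
  with no decay of V' and with an unknown constant of integration c. The monotone energy supplies
  both: P tends to 0 at both ends, so P' has a limit at +infinity, which must be 0, and this forces
  c = 0.\<close>

lemma antiderivative_UNIV:
  fixes g :: "real \<Rightarrow> real"
  assumes "continuous_on UNIV g"
  obtains G where "\<And>x. (G has_real_derivative g x) (at x)"
proof -
  have "\<exists>G. \<forall>x::real. -\<infinity> < x \<longrightarrow> x < \<infinity> \<longrightarrow> (G has_vector_derivative g x) (at x)"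
    using assms by (intro einterval_antiderivative) (auto simp: continuous_on_eq_continuous_at)
  then show ?thesis using that by (auto simp: has_real_derivative_iff_has_vector_derivative)
qed

text \<open>Integrating an exponential of rate \<open>K\<close> gains the factor 1/K; this factor
  makes the fixed point map of \<open>global_solution\<close> a contraction.\<close>

lemma has_vector_derivative_exp_bound_right:
  fixes G :: "real \<Rightarrow> 'a::real_normed_vector"
  assumes K: "K > 0" and G0: "G 0 = 0"
    and G: "\<And>t. t \<ge> 0 \<Longrightarrow> (G has_vector_derivative g t) (at t)"
    and g: "\<And>t. t \<ge> 0 \<Longrightarrow> norm (g t) \<le> C * exp (K * t)"
    and t: "t \<ge> 0"
  shows "norm (G t) \<le> C / K * exp (K * t)"
proof (cases "t = 0")
  case True
  have "0 \<le> C" using g[of 0] norm_ge_zero[of "g 0"] by (simp del: norm_ge_zero)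
  then show ?thesis using True G0 K by simp
next
  case False
  have 0: "0 \<le> C" using g[of 0] norm_ge_zero[of "g 0"] by (simp del: norm_ge_zero)
  have "norm (G t - G 0) \<le> C / K * exp (K * t) - C / K * exp (K * 0)"
  proof (rule differentiable_bound_general[where f' = g])
    show "0 < t" using t False by simp
    show "continuous_on {0..t} G"
      using G by (auto intro!: continuous_at_imp_continuous_on
          has_vector_derivative_continuous)
    show "continuous_on {0..t} (\<lambda>t. C / K * exp (K * t))" by (intro continuous_intros)
    show "((\<lambda>t. C / K * exp (K * t)) has_vector_derivative C * exp (K * x)) (at x)" for x
      using K by (auto intro!: derivative_eq_intros simp: has_real_derivative_iff_has_vector_derivative[symmetric])
  qed (use G g in auto)
  then show ?thesis using G0 K 0 by (simp add: field_simps)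
qed

lemma has_vector_derivative_exp_bound:
  fixes G :: "real \<Rightarrow> 'a::real_normed_vector"
  assumes K: "K > 0" and G0: "G 0 = 0"
    and G: "\<And>t. (G has_vector_derivative g t) (at t)"
    and g: "\<And>t. norm (g t) \<le> C * exp (K * \<bar>t\<bar>)"
  shows "norm (G t) \<le> C / K * exp (K * \<bar>t\<bar>)"
proof (cases "t \<ge> 0")
  case True
  show ?thesis
    using has_vector_derivative_exp_bound_right[of K G g C t] assms True
    by (metis abs_of_nonneg)
next
  case False
  have "((\<lambda>t. G (- t)) has_vector_derivative - g (- t)) (at t)" for t
  proof -
    have "(uminus has_vector_derivative - 1) (at t)" by (auto intro!: derivative_eq_intros)
    from vector_diff_chain_at[OF this G[of "- t"]] show ?thesis by (simp add: o_def)
  qed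
  then have "norm (G (- (- t))) \<le> C / K * exp (K * (- t))"
    using g False K G0
    by (intro has_vector_derivative_exp_bound_right[where g = "\<lambda>t. - g (- t)"])
      (auto simp: abs_if split: if_splits, (smt (verit))+)
  then show ?thesis using False by simp
qed

text \<open>Banach's fixed point theorem for the rescaled unknown \<open>exp (- K \<bar>t\<bar>) (x t - x0)\<close>,
  \<open>K = 2 L\<close>, gives the solution on the whole line at once.\<close>

proposition global_solution:
  fixes F :: "'a::euclidean_space \<Rightarrow> 'a"
  assumes L: "L-lipschitz_on UNIV F"
  obtains x where "x 0 = x0" "\<And>t. (x has_vector_derivative F (x t)) (at t)"
proof -
  define M where "M = L + 1"
  \<comment> \<open>Integration divides by \<open>K\<close>, so a field with Lipschitz constant
    \<open>M\<close> gives the contraction factor M / K = 1/2. The 1 in \<open>M\<close> keeps it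
    positive when \<open>L\<close> is 0.\<close>
  define K where "K = 2 * M"
  have "L \<ge> 0" using L by (rule lipschitz_on_nonneg)
  then have M: "M > 0" and K: "K > 0" by (auto simp: M_def K_def)
  have lip: "norm (F x - F y) \<le> M * norm (x - y)" for x y
    using lipschitz_onD[OF L, of x y] norm_ge_zero[of "x - y"]
    unfolding M_def dist_norm distrib_right by (smt (verit) UNIV_I mult_1)
  have contF: "continuous_on UNIV F" using L by (rule lipschitz_on_continuous_on)
  define g where "g u t = F (x0 + exp (K * \<bar>t\<bar>) *\<^sub>R apply_bcontfun u t)"
    for u :: "real \<Rightarrow>\<^sub>C 'a" and t
  have "\<exists>G. G 0 = 0 \<and> (\<forall>t. (G has_vector_derivative g u t) (at t))" for u
  proof -
    have "continuous_on UNIV (g u)"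
      unfolding g_def
      by (rule continuous_on_compose2[OF contF]) (auto intro!: continuous_intros)
    then have "\<exists>G. \<forall>x::real. -\<infinity> < x \<longrightarrow> x < \<infinity> \<longrightarrow> (G has_vector_derivative g u x) (at x)"
      by (intro einterval_antiderivative) (auto simp: continuous_on_eq_continuous_at)
    then obtain G where G: "\<And>x. (G has_vector_derivative g u x) (at x)" by auto
    have "((\<lambda>t. G t - G 0) has_vector_derivative g u t) (at t)" for t
      using G[of t] by (auto intro!: derivative_eq_intros)
    then show ?thesis by (intro exI[of _ "\<lambda>t. G t - G 0"]) auto
  qed
  then obtain G where G0: "\<And>u. G u 0 = 0"
    and G: "\<And>u t. (G u has_vector_derivative g u t) (at t)" by metis
  \<comment> \<open>\<open>G u\<close> integrates the field along the curve encoded by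
    \<open>u\<close>; the weight turns this displacement back into a bounded function.\<close>
  define T where "T u t = exp (- K * \<bar>t\<bar>) *\<^sub>R G u t" for u t
  have "T u \<in> bcontfun" for u
  proof (rule bcontfun_normI)
    have "continuous_on UNIV (G u)"
      using G by (intro continuous_at_imp_continuous_on)
        (auto intro: has_vector_derivative_continuous)
    then show "continuous_on UNIV (T u)" unfolding T_def by (intro continuous_intros)
    fix t
    have "norm (g u t) \<le> (norm (F x0) + M * norm u) * exp (K * \<bar>t\<bar>)" for t
    proof -
      have "norm (g u t) \<le> norm (F x0) + norm (g u t - F x0)" by (metis norm_triangle_sub)
      also have "norm (g u t - F x0) \<le> M * norm (exp (K * \<bar>t\<bar>) *\<^sub>R apply_bcontfun u t)"
        unfolding g_def using lip[of "x0 + exp (K * \<bar>t\<bar>) *\<^sub>R apply_bcontfun u t" x0] by simp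
      also have "\<dots> \<le> M * (norm u * exp (K * \<bar>t\<bar>))"
        using M norm_bounded[of u t] by (simp add: mult.commute)
      also have "norm (F x0) \<le> norm (F x0) * exp (K * \<bar>t\<bar>)"
        using K by (simp add: mult_le_cancel_left1)
      finally show ?thesis by (simp add: algebra_simps)
    qed
    then have "norm (G u t) \<le> (norm (F x0) + M * norm u) / K * exp (K * \<bar>t\<bar>)"
      by (intro has_vector_derivative_exp_bound[OF K G0 G])
    then show "norm (T u t) \<le> (norm (F x0) + M * norm u) / K"
      using K unfolding T_def by (simp add: exp_minus divide_simps mult.commute)
  qed
  then have ap: "apply_bcontfun (Bcontfun (T u)) = T u" for u
    by (simp add: Bcontfun_inverse)
  have "dist (Bcontfun (T u)) (Bcontfun (T v)) \<le> 1/2 * dist u v" for u v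
  proof (rule dist_bound)
    fix t
    have "norm (g u t - g v t) \<le> M * dist u v * exp (K * \<bar>t\<bar>)" for t
    proof -
      have "norm (g u t - g v t)
          \<le> M * norm (exp (K * \<bar>t\<bar>) *\<^sub>R (apply_bcontfun u t - apply_bcontfun v t))"
        unfolding g_def
        using lip[of "x0 + exp (K * \<bar>t\<bar>) *\<^sub>R apply_bcontfun u t"
            "x0 + exp (K * \<bar>t\<bar>) *\<^sub>R apply_bcontfun v t"]
        by (simp add: scaleR_diff_right)
      also have "\<dots> \<le> M * (dist u v * exp (K * \<bar>t\<bar>))"
        using M dist_bounded[of u t v] by (simp add: dist_norm mult.commute)
      finally show ?thesis by (simp add: algebra_simps)
    qed
    then have "norm (G u t - G v t) \<le> (M * dist u v) / K * exp (K * \<bar>t\<bar>)"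
      using G0 G by (intro has_vector_derivative_exp_bound[OF K, of "\<lambda>t. G u t - G v t"])
        (auto intro: derivative_intros)
    then have "exp (- K * \<bar>t\<bar>) * norm (G u t - G v t) \<le> 1/2 * dist u v"
      using M by (simp add: K_def exp_minus divide_simps mult.commute)
    then show "dist (apply_bcontfun (Bcontfun (T u)) t) (apply_bcontfun (Bcontfun (T v)) t) \<le> 1/2 * dist u v"
      unfolding ap by (simp add: T_def dist_norm flip: scaleR_diff_right)
  qed
  then have "\<exists>!u. Bcontfun (T u) = u"
    by (intro banach_fix_type[of "1/2"]) auto
  then obtain u where "Bcontfun (T u) = u" by auto
  then have u: "apply_bcontfun u t = exp (- K * \<bar>t\<bar>) *\<^sub>R G u t" for t
    using ap[of u] by (simp add: T_def)
  have "x0 + exp (K * \<bar>t\<bar>) *\<^sub>R apply_bcontfun u t = x0 + G u t" for t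
    by (simp add: u exp_minus)
  then have "((\<lambda>t. x0 + G u t) has_vector_derivative F (x0 + G u t)) (at t)" for t
    using G[of u t] by (auto simp: g_def intro!: derivative_eq_intros)
  then show ?thesis using that[of "\<lambda>t. x0 + G u t"] G0 by simp
qed

lemma planar_global_solution:
  fixes X Y :: "real \<Rightarrow> real \<Rightarrow> real"
  assumes X: "\<And>v p v' p'. \<bar>X v p - X v' p'\<bar> \<le> L * (\<bar>v - v'\<bar> + \<bar>p - p'\<bar>)"
    and Y: "\<And>v p v' p'. \<bar>Y v p - Y v' p'\<bar> \<le> L * (\<bar>v - v'\<bar> + \<bar>p - p'\<bar>)"
  obtains v p where "v 0 = v0" "p 0 = p0"
    "\<And>t. (v has_real_derivative X (v t) (p t)) (at t)"
    "\<And>t. (p has_real_derivative Y (v t) (p t)) (at t)"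
proof -
  define F where "F z = (X (fst z) (snd z), Y (fst z) (snd z))" for z :: "real \<times> real"
  have L: "L \<ge> 0" using X[of 1 0 0 0] by auto
  \<comment> \<open>Each of the two components changes by at most 2 L times the distance.\<close>
  have "dist (F y) (F z) \<le> (4 * L) * dist y z" for y z
  proof -
    have "\<bar>fst y - fst z\<bar> \<le> dist y z" "\<bar>snd y - snd z\<bar> \<le> dist y z"
      using dist_fst_le[of y z] dist_snd_le[of y z] by (auto simp: dist_real_def)
    then have s: "L * (\<bar>fst y - fst z\<bar> + \<bar>snd y - snd z\<bar>) \<le> L * (2 * dist y z)"
      using L by (intro mult_left_mono) auto
    have "dist (F y) (F z) = norm (X (fst y) (snd y) - X (fst z) (snd z), Y (fst y) (snd y) - Y (fst z) (snd z))"
      by (simp add: F_def dist_norm)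
    also have "\<dots> \<le> norm (X (fst y) (snd y) - X (fst z) (snd z)) + norm (Y (fst y) (snd y) - Y (fst z) (snd z))"
      by (rule norm_Pair_le)
    also have "\<dots> \<le> L * (2 * dist y z) + L * (2 * dist y z)"
      using X[of "fst y" "snd y" "fst z" "snd z"] Y[of "fst y" "snd y" "fst z" "snd z"] s
      by auto
    finally show ?thesis by simp
  qed
  then have "(4 * L)-lipschitz_on UNIV F" using L by (intro lipschitz_onI) auto
  from global_solution[OF this] obtain x where x0: "x 0 = (v0, p0)"
    and x: "\<And>t. (x has_vector_derivative F (x t)) (at t)" by blast
  show ?thesis
  proof (rule that[of "\<lambda>t. fst (x t)" "\<lambda>t. snd (x t)"])
    fix t
    show "((\<lambda>t. fst (x t)) has_real_derivative X (fst (x t)) (snd (x t))) (at t)"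
      using has_derivative_fst[OF x[of t, unfolded has_vector_derivative_def]]
      by (simp add: F_def has_field_derivative_def mult_commute_abs)
    show "((\<lambda>t. snd (x t)) has_real_derivative Y (fst (x t)) (snd (x t))) (at t)"
      using has_derivative_snd[OF x[of t, unfolded has_vector_derivative_def]]
      by (simp add: F_def has_field_derivative_def mult_commute_abs)
  qed (simp_all add: x0)
qed

text \<open>The squared distance D satisfies D' \<le> 4 L D because (a + b)^2 \<le> 2 (a^2 + b^2),
  so exp (- 4 L t) D does not increase. The right-hand sides enter only as functions of time: a
  Lipschitz bound is required along the two curves, which admits fields that are only locally
  Lipschitz.\<close>

lemma gronwall_planar_right:
  fixes v p v' p' :: "real \<Rightarrow> real"
  assumes dv: "\<And>s. s \<ge> 0 \<Longrightarrow> (v has_real_derivative X s) (at s)"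
    and dp: "\<And>s. s \<ge> 0 \<Longrightarrow> (p has_real_derivative Y s) (at s)"
    and dv': "\<And>s. s \<ge> 0 \<Longrightarrow> (v' has_real_derivative X' s) (at s)"
    and dp': "\<And>s. s \<ge> 0 \<Longrightarrow> (p' has_real_derivative Y' s) (at s)"
    and X: "\<And>s. s \<ge> 0 \<Longrightarrow> \<bar>X s - X' s\<bar> \<le> L * (\<bar>v s - v' s\<bar> + \<bar>p s - p' s\<bar>)"
    and Y: "\<And>s. s \<ge> 0 \<Longrightarrow> \<bar>Y s - Y' s\<bar> \<le> L * (\<bar>v s - v' s\<bar> + \<bar>p s - p' s\<bar>)"
    and L: "L \<ge> 0" and t: "t \<ge> 0"
  shows "(v t - v' t)\<^sup>2 + (p t - p' t)\<^sup>2
    \<le> exp (4 * L * t) * ((v 0 - v' 0)\<^sup>2 + (p 0 - p' 0)\<^sup>2)"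
proof -
  define D where "D s = (v s - v' s)\<^sup>2 + (p s - p' s)\<^sup>2" for s
  define D' where "D' s = 2 * (v s - v' s) * (X s - X' s) + 2 * (p s - p' s) * (Y s - Y' s)" for s
  have le: "D' s \<le> 4 * L * D s" if "s \<ge> 0" for s
  proof -
    let ?a = "\<bar>v s - v' s\<bar>" and ?b = "\<bar>p s - p' s\<bar>"
    have "D' s \<le> 2 * ?a * \<bar>X s - X' s\<bar> + 2 * ?b * \<bar>Y s - Y' s\<bar>"
    proof -
      have "2 * x * y \<le> 2 * \<bar>x\<bar> * \<bar>y\<bar>" for x y :: real
        using abs_ge_self[of "2 * x * y"] by (simp add: abs_mult)
      then show ?thesis unfolding D'_def by (intro add_mono)
    qed
    also have "\<dots> \<le> 2 * ?a * (L * (?a + ?b)) + 2 * ?b * (L * (?a + ?b))"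
      using X[OF that] Y[OF that] by (intro add_mono mult_left_mono) auto
    also have "\<dots> = L * (2 * (?a + ?b)\<^sup>2)" by (simp add: power2_eq_square algebra_simps)
    also have "\<dots> \<le> L * (4 * (?a\<^sup>2 + ?b\<^sup>2))"
    proof (rule mult_left_mono[OF _ L])
      have "2 * (a + b)\<^sup>2 \<le> 4 * (a\<^sup>2 + b\<^sup>2)" for a b :: real
        using zero_le_power2[of "a - b"] by (simp add: power2_eq_square algebra_simps)
      then show "2 * (?a + ?b)\<^sup>2 \<le> 4 * (?a\<^sup>2 + ?b\<^sup>2)" .
    qed
    finally show ?thesis by (simp add: D_def algebra_simps)
  qed
  have dD: "(D has_real_derivative D' s) (at s)" if "s \<ge> 0" for s
    unfolding D_def D'_def
    using dv[OF that] dp[OF that] dv'[OF that] dp'[OF that]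
    by (auto intro!: derivative_eq_intros simp: algebra_simps)
  have "exp (- (4 * L * t)) * D t \<le> exp (- (4 * L * 0)) * D 0"
  proof (rule DERIV_nonpos_imp_nonincreasing[OF t])
    fix s assume "0 \<le> s" "s \<le> t"
    then show "\<exists>y. ((\<lambda>s. exp (- (4 * L * s)) * D s) has_real_derivative y) (at s) \<and> y \<le> 0"
      using dD[of s] le[of s]
      by (intro exI[of _ "exp (- (4 * L * s)) * (D' s - 4 * L * D s)"])
        (auto intro!: derivative_eq_intros simp: algebra_simps mult_le_0_iff simp flip: right_diff_distrib)
  qed
  then show ?thesis by (simp add: D_def exp_minus divide_simps mult.commute)
qed

text \<open>Gronwall runs forward from \<open>t0\<close>; for earlier times it is applied to the
  curves run backwards from \<open>t0\<close>, whose right-hand sides change sign.\<close>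

lemma planar_unique:
  fixes v p v' p' :: "real \<Rightarrow> real"
  assumes dv: "\<And>s. (v has_real_derivative X s) (at s)"
    and dp: "\<And>s. (p has_real_derivative Y s) (at s)"
    and dv': "\<And>s. (v' has_real_derivative X' s) (at s)"
    and dp': "\<And>s. (p' has_real_derivative Y' s) (at s)"
    and X: "\<And>s. \<bar>X s - X' s\<bar> \<le> L * (\<bar>v s - v' s\<bar> + \<bar>p s - p' s\<bar>)"
    and Y: "\<And>s. \<bar>Y s - Y' s\<bar> \<le> L * (\<bar>v s - v' s\<bar> + \<bar>p s - p' s\<bar>)"
    and L: "L \<ge> 0" and 0: "v t0 = v' t0" "p t0 = p' t0"
  shows "v t = v' t \<and> p t = p' t"
proof -
  have right: "v t = v' t \<and> p t = p' t" if "t \<ge> t0" for t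
  proof -
    have "((\<lambda>s. v (t0 + s)) has_real_derivative X (t0 + s)) (at s)"
      "((\<lambda>s. p (t0 + s)) has_real_derivative Y (t0 + s)) (at s)"
      "((\<lambda>s. v' (t0 + s)) has_real_derivative X' (t0 + s)) (at s)"
      "((\<lambda>s. p' (t0 + s)) has_real_derivative Y' (t0 + s)) (at s)" for s
      using dv[of "t0 + s"] dp[of "t0 + s"] dv'[of "t0 + s"] dp'[of "t0 + s"]
        DERIV_shift[of _ _ s t0] by (simp_all add: add.commute)
    from gronwall_planar_right[OF this X Y L, of "t - t0"] that
    show ?thesis using 0 by (simp add: sum_power2_le_zero_iff)
  qed
  have left: "v t = v' t \<and> p t = p' t" if "t \<le> t0" for t
  proof -
    have "((\<lambda>s. h (t0 - s)) has_real_derivative - k (t0 - s)) (at s)"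
      if "\<And>x. (h has_real_derivative k x) (at x)" for h k :: "real \<Rightarrow> real" and s
    proof -
      have "((\<lambda>s. t0 - s) has_real_derivative - 1) (at s)" by (auto intro!: derivative_eq_intros simp: algebra_simps)
      from DERIV_chain2[OF that this] show ?thesis by simp
    qed
    note this[OF dv] this[OF dp] this[OF dv'] this[OF dp']
    from gronwall_planar_right[OF this, of L "t0 - t"] that L X Y
    have "(v t - v' t)\<^sup>2 + (p t - p' t)\<^sup>2 \<le> 0" using 0 by (simp add: abs_minus_commute)
    then show ?thesis by (simp add: sum_power2_le_zero_iff)
  qed
  show ?thesis using left right by (cases "t \<ge> t0") auto
qed

subsection \<open>Repeated differentiability\<close>

text \<open>Counting derivatives makes induction on the order possible: a solution of an equation is
  bootstrapped from order n to n + 1, which smoothness of all orders at once does not allow.\<close>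

definition times_differentiable_on :: "nat \<Rightarrow> real set \<Rightarrow> (real \<Rightarrow> real) \<Rightarrow> bool" where
  "times_differentiable_on n S f \<longleftrightarrow> (\<forall>k<n. \<forall>x\<in>S. (deriv ^^ k) f differentiable (at x))"

lemma smooth_on_iff: "smooth_on S f \<longleftrightarrow> (\<forall>n. times_differentiable_on n S f)"
  unfolding smooth_on_def times_differentiable_on_def by auto

lemma times_differentiable_on_0 [simp]: "times_differentiable_on 0 S f"
  by (simp add: times_differentiable_on_def)

lemma times_differentiable_on_Suc:
  "times_differentiable_on (Suc n) S f \<longleftrightarrow>
     (\<forall>x\<in>S. f differentiable (at x)) \<and> times_differentiable_on n S (deriv f)"
  unfolding times_differentiable_on_def All_less_Suc2
  by (simp add: funpow_Suc_right del: funpow.simps(2))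

lemma times_differentiable_on_SucD:
  "times_differentiable_on (Suc n) S f \<Longrightarrow> times_differentiable_on n S f"
  by (simp add: times_differentiable_on_def)

lemma times_differentiable_on_eq:
  assumes "times_differentiable_on n S f" "open S" "\<And>x. x \<in> S \<Longrightarrow> f x = g x"
  shows "times_differentiable_on n S g"
  using assms(1,3)
proof (induction n arbitrary: f g)
  case (Suc n)
  have "g differentiable (at x)" if "x \<in> S" for x
    using Suc.prems that has_derivative_transform_within_open[OF _ \<open>open S\<close> that]
    unfolding times_differentiable_on_Suc differentiable_def by blast
  moreover have "deriv f x = deriv g x" if "x \<in> S" for x
    using \<open>open S\<close> that Suc.prems(2)
    by (intro deriv_cong_ev) (auto simp: eventually_nhds)
  ultimately show ?case
    using Suc.prems(1) Suc.IH[of "deriv f" "deriv g"] by (auto simp: times_differentiable_on_Suc)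
qed simp

text \<open>The derivative may be given by a formula; on an open set it agrees with
  \<open>deriv\<close> near every point, hence so do all higher derivatives.\<close>

lemma times_differentiable_on_SucI:
  assumes "open S" "\<And>x. x \<in> S \<Longrightarrow> (f has_real_derivative f' x) (at x)"
    and "times_differentiable_on n S f'"
  shows "times_differentiable_on (Suc n) S f"
proof -
  have "deriv f x = f' x" if "x \<in> S" for x
    using assms(2)[OF that] by (rule DERIV_imp_deriv)
  then show ?thesis
    using times_differentiable_on_eq[OF assms(3,1), of "deriv f"] assms(2)
    unfolding times_differentiable_on_Suc
    by (metis DERIV_deriv_iff_real_differentiable)
qed

lemma times_differentiable_on_DERIV:
  "times_differentiable_on (Suc n) S f \<Longrightarrow> x \<in> S \<Longrightarrow> (f has_real_derivative deriv f x) (at x)"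
  by (simp add: times_differentiable_on_Suc DERIV_deriv_iff_real_differentiable)

lemma times_differentiable_on_deriv:
  "times_differentiable_on (Suc n) S f \<Longrightarrow> times_differentiable_on n S (deriv f)"
  by (simp add: times_differentiable_on_Suc)

lemma times_differentiable_on_const: "open S \<Longrightarrow> times_differentiable_on n S (\<lambda>_. c)"
proof (induction n arbitrary: c)
  case (Suc n)
  show ?case
    by (rule times_differentiable_on_SucI[OF Suc.prems, where f' = "\<lambda>_. 0"]) (auto intro: Suc)
qed simp

lemma times_differentiable_on_add:
  "\<lbrakk>open S; times_differentiable_on n S f; times_differentiable_on n S g\<rbrakk>
    \<Longrightarrow> times_differentiable_on n S (\<lambda>x. f x + g x)"
proof (induction n arbitrary: f g)
  case (Suc n)
  show ?case
  proof (rule times_differentiable_on_SucI[OF \<open>open S\<close>])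
    show "((\<lambda>x. f x + g x) has_real_derivative deriv f x + deriv g x) (at x)" if "x \<in> S" for x
      using that Suc.prems by (auto intro!: derivative_intros times_differentiable_on_DERIV)
    show "times_differentiable_on n S (\<lambda>x. deriv f x + deriv g x)"
      using Suc.prems by (intro Suc.IH times_differentiable_on_deriv)
  qed
qed simp

lemma times_differentiable_on_mult:
  "\<lbrakk>open S; times_differentiable_on n S f; times_differentiable_on n S g\<rbrakk>
    \<Longrightarrow> times_differentiable_on n S (\<lambda>x. f x * g x)"
proof (induction n arbitrary: f g)
  case (Suc n)
  show ?case
  proof (rule times_differentiable_on_SucI[OF \<open>open S\<close>])
    show "((\<lambda>x. f x * g x) has_real_derivative f x * deriv g x + deriv f x * g x) (at x)"
      if "x \<in> S" for x
      using that Suc.prems by (intro DERIV_mult' times_differentiable_on_DERIV)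
    show "times_differentiable_on n S (\<lambda>x. f x * deriv g x + deriv f x * g x)"
      using Suc.prems
      by (intro times_differentiable_on_add Suc.IH times_differentiable_on_deriv)
        (auto intro: times_differentiable_on_SucD)
  qed
qed simp

lemma times_differentiable_on_compose:
  "\<lbrakk>open S; times_differentiable_on n T f; times_differentiable_on n S g; g ` S \<subseteq> T\<rbrakk>
    \<Longrightarrow> times_differentiable_on n S (\<lambda>x. f (g x))"
proof (induction n arbitrary: f)
  case (Suc n)
  show ?case
  proof (rule times_differentiable_on_SucI[OF \<open>open S\<close>])
    show "((\<lambda>x. f (g x)) has_real_derivative deriv f (g x) * deriv g x) (at x)" if "x \<in> S" for x
    proof (rule DERIV_chain2[of f])
      show "(f has_real_derivative deriv f (g x)) (at (g x))"
        using Suc.prems(4) that by (intro times_differentiable_on_DERIV[OF Suc.prems(2)]) auto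
      show "(g has_real_derivative deriv g x) (at x)"
        by (rule times_differentiable_on_DERIV[OF Suc.prems(3) that])
    qed
    show "times_differentiable_on n S (\<lambda>x. deriv f (g x) * deriv g x)"
    proof (rule times_differentiable_on_mult[OF \<open>open S\<close>])
      show "times_differentiable_on n S (\<lambda>x. deriv f (g x))"
        by (rule Suc.IH[OF Suc.prems(1) times_differentiable_on_deriv[OF Suc.prems(2)]
              times_differentiable_on_SucD[OF Suc.prems(3)] Suc.prems(4)])
      show "times_differentiable_on n S (deriv g)"
        by (rule times_differentiable_on_deriv[OF Suc.prems(3)])
    qed
  qed
qed simp

lemma times_differentiable_on_inverse:
  "\<lbrakk>open S; times_differentiable_on n S f; \<And>x. x \<in> S \<Longrightarrow> f x \<noteq> 0\<rbrakk>
    \<Longrightarrow> times_differentiable_on n S (\<lambda>x. inverse (f x))"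
proof (induction n)
  case (Suc n)
  show ?case
  proof (rule times_differentiable_on_SucI[OF \<open>open S\<close>])
    show "((\<lambda>x. inverse (f x)) has_real_derivative
        (- 1) * (deriv f x * (inverse (f x) * inverse (f x)))) (at x)" if "x \<in> S" for x
      using DERIV_inverse'[OF times_differentiable_on_DERIV[OF Suc.prems(2) that]] Suc.prems(3)[OF that]
      by (simp add: mult_ac)
    show "times_differentiable_on n S (\<lambda>x. (- 1) * (deriv f x * (inverse (f x) * inverse (f x))))"
      using Suc.prems
      by (intro times_differentiable_on_mult times_differentiable_on_const Suc.IH
          times_differentiable_on_deriv)
        (auto intro: times_differentiable_on_SucD)
  qed
qed simp

lemma smooth_on_DERIV:
  assumes "smooth_on S f" "x \<in> S"
  shows "((deriv ^^ n) f has_real_derivative (deriv ^^ Suc n) f x) (at x)"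
  using assms by (simp add: smooth_on_def DERIV_deriv_iff_real_differentiable)

subsection \<open>Asymptotics of real functions\<close>

text \<open>On an interval of fixed length the increment of a convergent function is small, so the
  mean value theorem finds a point with small \<open>x'\<close>; the Lipschitz bound carries this to
  the endpoint.\<close>

lemma barbalat_at_bot:
  fixes x x' :: "real \<Rightarrow> real"
  assumes dx: "\<And>t. (x has_real_derivative x' t) (at t)"
    and lip: "\<And>s t. \<bar>x' s - x' t\<bar> \<le> K * \<bar>s - t\<bar>"
    and lim: "(x \<longlongrightarrow> l) at_bot"
  shows "(x' \<longlongrightarrow> 0) at_bot"
proof (rule tendstoI)
  fix e :: real assume e: "e > 0"
  have K: "K \<ge> 0" using lip[of 1 0] by auto
  \<comment> \<open>Makes the Lipschitz error \<open>K * d\<close> at most e/2. The mean value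
    contributes less than 2e/5, and the two together stay below e.\<close>
  define d where "d = e / (2 * (K + 1))"
  have d: "d > 0" "K * d \<le> e / 2" using K e by (auto simp: d_def field_simps)
  have "eventually (\<lambda>t. dist (x t) l < e * d / 5) at_bot"
    using lim e d(1) by (intro tendstoD) auto
  then obtain N where N: "\<And>t. t \<le> N \<Longrightarrow> \<bar>x t - l\<bar> < e * d / 5"
    by (auto simp: eventually_at_bot_linorder dist_real_def)
  have "\<bar>x' t\<bar> < e" if "t \<le> N" for t
  proof -
    obtain z where z: "t - d < z" "z < t" "x t - x (t - d) = d * x' z"
      using MVT2[of "t - d" t x x'] d(1) dx by auto
    have "\<bar>d * x' z\<bar> < 2 * (e * d / 5)"
      using N[of t] N[of "t - d"] that d(1) z(3) by linarith
    then have "\<bar>x' z\<bar> < 2 * e / 5" using d(1) by (simp add: abs_mult field_simps)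
    moreover have "\<bar>x' t - x' z\<bar> \<le> K * d"
      using lip[of t z] z K by (smt (verit) mult_left_mono)
    ultimately show ?thesis using d(2) e by linarith
  qed
  then show "eventually (\<lambda>t. dist (x' t) 0 < e) at_bot"
    by (auto simp: eventually_at_bot_linorder)
qed

text \<open>The mean value theorem on [t, t + 1]. Without regularity of \<open>x'\<close>, smallness
  is obtained at the selected times \<open>\<xi> t\<close> only.\<close>

lemma convergent_derivative_small:
  fixes x x' :: "real \<Rightarrow> real"
  assumes dx: "\<And>t. (x has_real_derivative x' t) (at t)"
    and lim: "(x \<longlongrightarrow> l) at_top"
  obtains \<xi> :: "real \<Rightarrow> real"
  where "filterlim \<xi> at_top at_top" "((\<lambda>t. x' (\<xi> t)) \<longlongrightarrow> 0) at_top"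
proof -
  have "\<exists>z. t < z \<and> x (t + 1) - x t = x' z" for t
    using MVT2[of t "t + 1" x x'] dx by auto
  then obtain \<xi> :: "real \<Rightarrow> real" where \<xi>: "\<And>t. t < \<xi> t" "\<And>t. x (t + 1) - x t = x' (\<xi> t)" by metis
  have "filterlim \<xi> at_top at_top"
    by (rule filterlim_at_top_mono[OF filterlim_ident]) (auto intro: always_eventually less_imp_le \<xi>(1))
  moreover have "((\<lambda>t. x (t + 1)) \<longlongrightarrow> l) at_top"
    by (rule filterlim_compose[OF lim])
      (auto intro!: filterlim_tendsto_add_at_top filterlim_ident simp: add.commute[of _ 1])
  then have "((\<lambda>t. x (t + 1) - x t) \<longlongrightarrow> l - l) at_top"
    using lim by (intro tendsto_diff)
  ultimately show ?thesis using that \<xi>(2) by auto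
qed

lemma derivative_limit_eq_0:
  fixes x x' :: "real \<Rightarrow> real"
  assumes "\<And>t. (x has_real_derivative x' t) (at t)"
    and "(x \<longlongrightarrow> l) at_top" and "(x' \<longlongrightarrow> c) at_top"
  shows "c = 0"
proof -
  obtain \<xi> :: "real \<Rightarrow> real" where \<xi>: "filterlim \<xi> at_top at_top" "((\<lambda>t. x' (\<xi> t)) \<longlongrightarrow> 0) at_top"
    using convergent_derivative_small[OF assms(1,2)] .
  have "((\<lambda>t. x' (\<xi> t)) \<longlongrightarrow> c) at_top"
    using assms(3) \<xi>(1) by (rule filterlim_compose)
  then show ?thesis using \<xi>(2) tendsto_unique[of at_top] by force
qed

text \<open>Every value of \<open>E\<close> is eventually passed along \<open>\<xi>\<close>, so
  \<open>l\<close> is an upper bound; some \<open>E (\<xi> s)\<close> is close to \<open>l\<close>,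
  and all later values are squeezed in between.\<close>

lemma mono_tendsto_along:
  fixes E :: "real \<Rightarrow> real"
  assumes E: "mono E" and \<xi>: "filterlim \<xi> at_top at_top"
    and lim: "((\<lambda>t. E (\<xi> t)) \<longlongrightarrow> l) (at_top :: real filter)"
  shows "(E \<longlongrightarrow> l) at_top"
proof -
  have le: "E t \<le> l" for t
  proof (rule tendsto_lowerbound[OF lim])
    show "eventually (\<lambda>s. E t \<le> E (\<xi> s)) at_top"
      using \<xi> E unfolding filterlim_at_top
      by (metis (mono_tags, lifting) eventually_mono monoD)
  qed simp
  show ?thesis
  proof (rule order_tendstoI)
    fix a assume "a < l"
    then obtain s where "a < E (\<xi> s)"
      using order_tendstoD(1)[OF lim] eventually_happens[of _ "at_top::real filter"] by force
    then show "eventually (\<lambda>t. a < E t) at_top"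
      using monoD[OF E, of "\<xi> s"]
      by (intro eventually_mono[OF eventually_ge_at_top[of "\<xi> s"]]) (auto intro: less_le_trans)
  next
    fix a assume "l < a"
    then show "eventually (\<lambda>t. E t < a) at_top"
      using le by (auto intro!: always_eventually intro: le_less_trans)
  qed
qed

text \<open>The mean value theorem produces times tending to infinity at which \<open>v'\<close>, hence \<open>\<Phi>\<close>,
  is small; monotonicity of the energy extends this to all large times.\<close>

lemma kinetic_energy_tendsto_0:
  fixes v v' \<Phi> :: "real \<Rightarrow> real"
  assumes dv: "\<And>t. (v has_real_derivative v' t) (at t)"
    and lim: "(v \<longlongrightarrow> l) at_top"
    and F: "isCont F l"
    and E: "mono (\<lambda>t. \<Phi> t + F (v t)) \<or> antimono (\<lambda>t. \<Phi> t + F (v t))"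
    and small: "\<And>e. e > 0 \<Longrightarrow> \<exists>d>0. eventually (\<lambda>t. \<bar>v' t\<bar> < d \<longrightarrow> \<bar>\<Phi> t\<bar> < e) at_top"
  shows "(\<Phi> \<longlongrightarrow> 0) at_top"
proof -
  obtain \<xi> :: "real \<Rightarrow> real" where \<xi>: "filterlim \<xi> at_top at_top" "((\<lambda>t. v' (\<xi> t)) \<longlongrightarrow> 0) at_top"
    using convergent_derivative_small[OF dv lim] .
  have \<Phi>: "((\<lambda>t. \<Phi> (\<xi> t)) \<longlongrightarrow> 0) at_top"
  proof (rule tendstoI)
    fix e :: real assume "e > 0"
    from small[OF this] obtain d where d: "d > 0"
      "eventually (\<lambda>t. \<bar>v' t\<bar> < d \<longrightarrow> \<bar>\<Phi> t\<bar> < e) at_top" by blast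
    have "eventually (\<lambda>t. \<bar>v' (\<xi> t)\<bar> < d \<longrightarrow> \<bar>\<Phi> (\<xi> t)\<bar> < e) at_top"
      using d(2) \<xi>(1) by (rule eventually_compose_filterlim)
    moreover have "eventually (\<lambda>t. \<bar>v' (\<xi> t)\<bar> < d) at_top"
      using tendstoD[OF \<xi>(2) d(1)] by simp
    ultimately show "eventually (\<lambda>t. dist (\<Phi> (\<xi> t)) 0 < e) at_top"
      by eventually_elim auto
  qed
  have Fv: "((\<lambda>t. F (v t)) \<longlongrightarrow> F l) at_top"
    using F lim by (rule isCont_tendsto_compose)
  have "((\<lambda>t. F (v (\<xi> t))) \<longlongrightarrow> F l) at_top"
    using Fv \<xi>(1) by (rule filterlim_compose)
  from tendsto_add[OF \<Phi> this]
  have lE: "((\<lambda>t. \<Phi> (\<xi> t) + F (v (\<xi> t))) \<longlongrightarrow> F l) at_top" by simp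
  have "((\<lambda>t. \<Phi> t + F (v t)) \<longlongrightarrow> F l) at_top"
    using E
  proof
    assume "mono (\<lambda>t. \<Phi> t + F (v t))"
    from mono_tendsto_along[OF this \<xi>(1) lE] show ?thesis .
  next
    assume "antimono (\<lambda>t. \<Phi> t + F (v t))"
    then have "mono (\<lambda>t. - (\<Phi> t + F (v t)))" unfolding monotone_def by (metis neg_le_iff_le)
    from mono_tendsto_along[OF this \<xi>(1) tendsto_minus[OF lE]]
    show ?thesis by (rule tendsto_minus_cancel)
  qed
  from tendsto_diff[OF this Fv] show ?thesis by simp
qed

subsection \<open>Orbits tending to a saddle\<close>

text \<open>On the tail V is strictly decreasing, so P becomes a function \<open>q\<close> of V
  through the inverse of V, and its slope is the quotient P' / V' = (b P - r f) / (r P).\<close>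

lemma decreasing_orbit_graph:
  fixes V P r f b :: "real \<Rightarrow> real"
  assumes r: "\<And>v. a < v \<Longrightarrow> v \<le> V T \<Longrightarrow> r v > 0"
    and dV: "\<And>t. t \<ge> T \<Longrightarrow> (V has_real_derivative r (V t) * P t) (at t)"
    and dP: "\<And>t. t \<ge> T \<Longrightarrow> (P has_real_derivative b (V t) * P t - r (V t) * f (V t)) (at t)"
    and Va: "\<And>t. t \<ge> T \<Longrightarrow> V t > a" and Pneg: "\<And>t. t \<ge> T \<Longrightarrow> P t < 0"
    and Vlim: "(V \<longlongrightarrow> a) at_top" and Plim: "(P \<longlongrightarrow> 0) at_top"
  obtains q where "\<And>t. t \<ge> T \<Longrightarrow> q (V t) = P t"
    and "\<And>v. a < v \<Longrightarrow> v < V T \<Longrightarrow> q v < 0"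
    and "\<And>v. a < v \<Longrightarrow> v < V T \<Longrightarrow>
      (q has_real_derivative (b v / r v * q v - f v) / q v) (at v)"
    and "(q \<longlongrightarrow> 0) (at_right a)"
proof -
  \<comment> \<open>Positivity of \<open>r\<close> is assumed only up to \<open>V T\<close>, so this
    bound has to precede monotonicity. At the last time \<open>s\<close> with
    \<open>V s \<le> V T\<close> the derivative of V is still negative, hence V stays below for a
    while longer.\<close>
  have le: "V t \<le> V T" if "t \<ge> T" for t
  proof -
    show ?thesis
    proof (rule ccontr)
      assume n: "\<not> V t \<le> V T"
      have contV: "continuous_on {T..t} V"
        using dV by (auto intro!: continuous_at_imp_continuous_on DERIV_isCont)
      have "compact {s\<in>{T..t}. V s \<le> V T}"
        using continuous_closed_preimage[OF contV _ closed_atMost[of "V T"]]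
        by (auto simp: compact_eq_bounded_closed vimage_def Int_def intro: bounded_subset[of "{T..t}"])
      moreover have "T \<in> {s\<in>{T..t}. V s \<le> V T}" using that by simp
      ultimately obtain s where s: "T \<le> s" "s \<le> t" "V s \<le> V T"
        "\<And>s'. T \<le> s' \<Longrightarrow> s' \<le> t \<Longrightarrow> V s' \<le> V T \<Longrightarrow> s' \<le> s"
        using compact_attains_sup[of "{s\<in>{T..t}. V s \<le> V T}"] by auto
      have "s < t" using n s by (cases "s = t") auto
      have "r (V s) * P s < 0" using s Pneg[of s] r[of "V s"] Va[of s] by (simp add: mult_pos_neg)
      then obtain d where d: "d > 0" "\<And>h. 0 < h \<Longrightarrow> h < d \<Longrightarrow> V (s + h) < V s"
        using DERIV_neg_dec_right[OF dV[OF s(1)]] by blast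
      define h where "h = min (d / 2) (t - s)"
      have "0 < h" "h < d" "s + h \<le> t" using d(1) \<open>s < t\<close> by (auto simp: h_def)
      then show False using d(2)[of h] s(4)[of "s + h"] s by force
    qed
  qed
  have dec: "V t < V s" if "T \<le> s" "s < t" for s t
  proof (rule DERIV_neg_imp_decreasing[OF that(2)])
    fix x assume "s \<le> x" "x \<le> t"
    then show "\<exists>y. (V has_real_derivative y) (at x) \<and> y < 0"
      using that dV[of x] Pneg[of x] r[of "V x"] Va[of x] le[of x]
      by (intro exI[of _ "r (V x) * P x"]) (auto simp: mult_pos_neg)
  qed
  then have inj: "s = t" if "T \<le> s" "T \<le> t" "V s = V t" for s t
    using that by (metis less_irrefl linorder_less_linear)
  have surj: "\<exists>s>T. V s = v" if "a < v" and vT: "v < V T" for v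
  proof -
    have "eventually (\<lambda>t. V t < v) at_top" using Vlim that by (simp add: order_tendstoD)
    then obtain N where N: "N \<ge> T" "V N < v"
      using eventually_happens[OF eventually_conj[OF _ eventually_ge_at_top[of T]]] by force
    obtain s where "T \<le> s" "s \<le> N" "V s = v"
    proof -
      have "continuous_on {T..N} V"
        using dV by (auto intro!: continuous_at_imp_continuous_on DERIV_isCont)
      then show thesis using IVT2'[of V N v T] N that vT by auto
    qed
    moreover have "s \<noteq> T" using vT \<open>V s = v\<close> by auto
    ultimately show ?thesis by (intro exI[of _ s]) auto
  qed
  define g where "g v = (SOME s. T \<le> s \<and> V s = v)" for v
  have gV: "g (V t) = t" if "t \<ge> T" for t
    unfolding g_def using that inj by (intro some_equality) auto
  define q where "q v = P (g v)" for v
  have deriv: "(q has_real_derivative (b (V s) / r (V s) * q (V s) - f (V s)) / q (V s)) (at (V s))"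
    if s: "s > T" for s
  proof -
    have *: "r (V s) > 0" "P s < 0" using s r[of "V s"] Va[of s] le[of s] Pneg[of s] by auto
    have "isCont g (V s)"
    proof (rule isCont_inverse_function2[of "(s + T) / 2" s "s + 1" g V])
      show "(s + T) / 2 < s" "s < s + 1" using s by auto
      fix z assume "(s + T) / 2 \<le> z"
      then have "z \<ge> T" using s by (auto simp: field_simps)
      then show "g (V z) = z" "isCont V z" using gV DERIV_isCont[OF dV[of z]] by auto
    qed
    then have "(g has_real_derivative inverse (r (V s) * P s)) (at (V s))"
      using * s Va[of s] dec[of T s] gV[of s] dV[of s] surj gV
      by (intro DERIV_inverse_function[where f = V and g = g and x = "V s" and a = a and b = "V T"])
        (auto, metis less_imp_le)
    then have "((\<lambda>v. P (g v)) has_real_derivative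
        (b (V s) * P s - r (V s) * f (V s)) * inverse (r (V s) * P s)) (at (V s))"
      using dP[of s] s gV[of s] by (intro DERIV_chain2[of P]) auto
    then show ?thesis
      using * s gV[of s] unfolding q_def[abs_def] by (simp add: field_simps)
  qed
  show ?thesis
  proof (rule that[of q])
    show qV: "q (V t) = P t" if "t \<ge> T" for t using gV that by (simp add: q_def)
    fix v assume "a < v" "v < V T"
    then obtain s where s: "s > T" "V s = v" using surj by blast
    then show "q v < 0" using qV[of s] Pneg[of s] by auto
    show "(q has_real_derivative (b v / r v * q v - f v) / q v) (at v)"
      using deriv[OF s(1)] s by simp
  next
    show "(q \<longlongrightarrow> 0) (at_right a)"
    proof (rule tendstoI)
      fix e :: real assume "e > 0"
      then have "eventually (\<lambda>t. \<bar>P t\<bar> < e) at_top" using tendstoD[OF Plim] by simp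
      then obtain N where N: "N > T" "\<And>t. t \<ge> N \<Longrightarrow> \<bar>P t\<bar> < e"
        unfolding eventually_at_top_linorder by (metis dual_order.trans gt_ex linorder_le_cases max.strict_boundedE max_def nless_le)
      have "\<bar>q v\<bar> < e" if v: "a < v" "v < V N" for v
      proof -
        have "v < V T" using v dec[of T N] N by auto
        then obtain s where s: "s > T" "V s = v" using surj v by blast
        have "\<not> s < N" using dec[of s N] s v by auto
        then show ?thesis using N(2)[of s] gV[of s] s by (auto simp: q_def)
      qed
      then show "eventually (\<lambda>v. dist (q v) 0 < e) (at_right a)"
        using Va[of N] N by (auto simp: eventually_at_right_field)
    qed
  qed
qed

text \<open>As a function of \<open>v\<close>, half the squared momentum solves \<open>W' = b v / r v * q v - f v\<close>
  with \<open>q = - sqrt (2 W)\<close>; the right-hand side decreases in \<open>W\<close>, so two solutions vanishing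
  at \<open>a\<close> coincide.\<close>

lemma stable_branch_unique:
  fixes V P V' P' r f b :: "real \<Rightarrow> real"
  assumes r: "\<And>v. a < v \<Longrightarrow> v \<le> V T \<Longrightarrow> r v > 0" "\<And>v. a < v \<Longrightarrow> v \<le> V' T' \<Longrightarrow> r v > 0"
    and b: "\<And>v. a < v \<Longrightarrow> v \<le> V T \<Longrightarrow> b v \<ge> 0"
    and V: "\<And>t. t \<ge> T \<Longrightarrow> (V has_real_derivative r (V t) * P t) (at t)"
      "\<And>t. t \<ge> T \<Longrightarrow> (P has_real_derivative b (V t) * P t - r (V t) * f (V t)) (at t)"
      "\<And>t. t \<ge> T \<Longrightarrow> V t > a" "\<And>t. t \<ge> T \<Longrightarrow> P t < 0"
      "(V \<longlongrightarrow> a) at_top" "(P \<longlongrightarrow> 0) at_top"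
    and V': "\<And>t. t \<ge> T' \<Longrightarrow> (V' has_real_derivative r (V' t) * P' t) (at t)"
      "\<And>t. t \<ge> T' \<Longrightarrow> (P' has_real_derivative b (V' t) * P' t - r (V' t) * f (V' t)) (at t)"
      "\<And>t. t \<ge> T' \<Longrightarrow> V' t > a" "\<And>t. t \<ge> T' \<Longrightarrow> P' t < 0"
      "(V' \<longlongrightarrow> a) at_top" "(P' \<longlongrightarrow> 0) at_top"
    and meet: "t \<ge> T" "t' \<ge> T'" "V t = V' t'" "V t < V T" "V' t' < V' T'"
  shows "P t = P' t'"
proof -
  obtain q where q: "\<And>t. t \<ge> T \<Longrightarrow> q (V t) = P t" "\<And>v. a < v \<Longrightarrow> v < V T \<Longrightarrow> q v < 0"
    "\<And>v. a < v \<Longrightarrow> v < V T \<Longrightarrow> (q has_real_derivative (b v / r v * q v - f v) / q v) (at v)"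
    "(q \<longlongrightarrow> 0) (at_right a)"
    using decreasing_orbit_graph[of a V T r P b f, OF r(1) V] by blast
  obtain q' where q': "\<And>t. t \<ge> T' \<Longrightarrow> q' (V' t) = P' t" "\<And>v. a < v \<Longrightarrow> v < V' T' \<Longrightarrow> q' v < 0"
    "\<And>v. a < v \<Longrightarrow> v < V' T' \<Longrightarrow> (q' has_real_derivative (b v / r v * q' v - f v) / q' v) (at v)"
    "(q' \<longlongrightarrow> 0) (at_right a)"
    using decreasing_orbit_graph[of a V' T' r P' b f, OF r(2) V'] by blast
  \<comment> \<open>Squaring the difference handles both orderings of the branches at once. In its
    derivative \<open>f\<close> cancels, leaving 4 (q - q')^2 (b / r) (q + q'), which is not
    positive because both branches are negative.\<close>
  define D where "D v = ((q v)\<^sup>2 - (q' v)\<^sup>2)\<^sup>2" for v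
  define v0 where "v0 = V t"
  have v0: "a < v0" "v0 < V T" "v0 < V' T'" using meet V(3)[of t] by (auto simp: v0_def)
  have dec: "D v0 \<le> D v" if v: "a < v" "v \<le> v0" for v
  proof (rule DERIV_nonpos_imp_nonincreasing[OF v(2)])
    fix x assume x: "v \<le> x" "x \<le> v0"
    then have ax: "a < x" "x < V T" "x < V' T'" using v v0 by auto
    have neg: "q x < 0" "q' x < 0" using q(2) q'(2) ax by auto
    have "(D has_real_derivative 2 * ((q x)\<^sup>2 - (q' x)\<^sup>2) *
        (2 * q x * ((b x / r x * q x - f x) / q x) - 2 * q' x * ((b x / r x * q' x - f x) / q' x))) (at x)"
      (is "(D has_real_derivative 2 * (_ - _) * (2 * q x * ?d - 2 * q' x * ?d')) _")
    proof -
      define d d' where "d = ?d" and "d' = ?d'"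
      have "(q has_real_derivative d) (at x)" "(q' has_real_derivative d') (at x)"
        using q(3)[OF ax(1,2)] q'(3)[OF ax(1,3)] by (simp_all add: d_def d'_def)
      then show ?thesis unfolding D_def d_def[symmetric] d'_def[symmetric]
        by (auto intro!: derivative_eq_intros simp: algebra_simps)
    qed
    also have "2 * ((q x)\<^sup>2 - (q' x)\<^sup>2) *
        (2 * q x * ((b x / r x * q x - f x) / q x) - 2 * q' x * ((b x / r x * q' x - f x) / q' x))
      = 4 * (q x - q' x)\<^sup>2 * (b x / r x) * (q x + q' x)"
    proof -
      define k where "k = b x / r x"
      have *: "2 * q x * ((k * q x - f x) / q x) = 2 * (k * q x - f x)"
        "2 * q' x * ((k * q' x - f x) / q' x) = 2 * (k * q' x - f x)"
        using neg by auto
      show ?thesis unfolding k_def[symmetric] *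
        by (simp add: power2_eq_square algebra_simps)
    qed
    finally have "(D has_real_derivative 4 * (q x - q' x)\<^sup>2 * (b x / r x) * (q x + q' x)) (at x)" .
    moreover have "4 * (q x - q' x)\<^sup>2 * (b x / r x) * (q x + q' x) \<le> 0"
      using neg b[of x] r(1)[of x] ax by (intro mult_nonneg_nonpos mult_nonneg_nonneg) auto
    ultimately show "\<exists>y. (D has_real_derivative y) (at x) \<and> y \<le> 0" by blast
  qed
  \<comment> \<open>\<open>D\<close> is nonnegative, vanishes in the limit at \<open>a\<close> and
    does not increase to the right, so it is 0.\<close>
  have "(D \<longlongrightarrow> (0\<^sup>2 - 0\<^sup>2)\<^sup>2) (at_right a)"
    unfolding D_def using q(4) q'(4) by (intro tendsto_intros)
  then have "D v0 \<le> (0\<^sup>2 - 0\<^sup>2)\<^sup>2"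
  proof (rule tendsto_lowerbound)
    show "eventually (\<lambda>v. D v0 \<le> D v) (at_right a)"
      using dec v0(1) by (auto simp: eventually_at_right_field intro!: exI[of _ v0])
  qed simp
  then have "(q v0)\<^sup>2 = (q' v0)\<^sup>2" by (simp add: D_def)
  then have "q v0 = q' v0"
    using q(2)[OF v0(1,2)] q'(2)[OF v0(1,3)] by (auto simp: power2_eq_iff)
  then show ?thesis using q(1)[OF meet(1)] q'(1)[OF meet(2)] meet(3) by (simp add: v0_def)
qed

text \<open>Integrating factor: with G' = \<beta>, the product exp (- G) P has derivative exp (- G)
  g \<ge> 0. It serves for the momentum left of \<open>Vm\<close>, where the force - r f is
  positive.\<close>

lemma affine_growth_nonneg:
  fixes P g \<beta> :: "real \<Rightarrow> real"
  assumes dP: "\<And>t. t \<ge> t1 \<Longrightarrow> (P has_real_derivative \<beta> t * P t + g t) (at t)"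
    and g: "\<And>t. t \<ge> t1 \<Longrightarrow> g t \<ge> 0" and \<beta>: "continuous_on UNIV \<beta>"
    and "P t1 \<ge> 0" "t \<ge> t1"
  shows "P t \<ge> 0"
proof -
  obtain G where G: "\<And>x. (G has_real_derivative \<beta> x) (at x)"
    using antiderivative_UNIV[OF \<beta>] by blast
  have "exp (- G t1) * P t1 \<le> exp (- G t) * P t"
  proof (rule DERIV_nonneg_imp_nondecreasing[OF \<open>t \<ge> t1\<close>])
    fix x assume "t1 \<le> x" "x \<le> t"
    then show "\<exists>y. ((\<lambda>x. exp (- G x) * P x) has_real_derivative y) (at x) \<and> 0 \<le> y"
      using dP[of x] G[of x] g[of x]
      by (intro exI[of _ "exp (- G x) * g x"])
        (auto intro!: derivative_eq_intros simp: algebra_simps)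
  qed
  then show ?thesis using \<open>P t1 \<ge> 0\<close>
    by (smt (verit) exp_gt_zero mult_nonneg_nonneg zero_le_mult_iff)
qed

subsection \<open>Shooting for a heteroclinic orbit\<close>

lemma continuous_first_zero:
  fixes g :: "real \<Rightarrow> real"
  assumes cont: "\<And>t. isCont g t" and "g 0 < 0" "t \<ge> 0" "g t \<ge> 0"
  obtains T where "0 < T" "T \<le> t" "g T = 0" "\<And>s. 0 \<le> s \<Longrightarrow> s < T \<Longrightarrow> g s < 0"
proof -
  have cg: "continuous_on X g" for X using cont by (simp add: continuous_at_imp_continuous_on)
  have "{s\<in>{0..t}. g s \<ge> 0} = {0..t} \<inter> g -` {0..}" by auto
  also have "compact \<dots>"
    using continuous_closed_preimage[OF cg, of "{0..t}" "{0..}"]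
    by (auto simp: compact_eq_bounded_closed intro: bounded_subset[of "{0..t}"])
  finally have "compact {s\<in>{0..t}. g s \<ge> 0}" .
  moreover have "t \<in> {s\<in>{0..t}. g s \<ge> 0}" using assms by auto
  ultimately obtain T where T: "T \<in> {s\<in>{0..t}. g s \<ge> 0}"
    "\<And>s. s \<in> {s\<in>{0..t}. g s \<ge> 0} \<Longrightarrow> T \<le> s"
    using compact_attains_inf[of "{s\<in>{0..t}. g s \<ge> 0}"] by blast
  have neg: "g s < 0" if "0 \<le> s" "s < T" for s using T(2)[of s] T(1) that by force
  obtain z where z: "0 \<le> z" "z \<le> T" "g z = 0"
    using IVT'[of g 0 0 T] cg assms T by auto
  then have "z = T" using neg[of z] by force
  moreover have "T \<noteq> 0" using z \<open>z = T\<close> assms by auto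
  ultimately show ?thesis using that[of T] T(1) neg z by auto
qed

lemma abs_mult_diff_le:
  fixes x y x' y' :: real
  assumes "\<bar>x - x'\<bar> \<le> dx" "\<bar>y - y'\<bar> \<le> dy" "\<bar>y\<bar> \<le> N" "\<bar>x'\<bar> \<le> K"
  shows "\<bar>x * y - x' * y'\<bar> \<le> dx * N + K * dy"
proof -
  have "x * y - x' * y' = (x - x') * y + x' * (y - y')" by (simp add: algebra_simps)
  then have "\<bar>x * y - x' * y'\<bar> \<le> \<bar>x - x'\<bar> * \<bar>y\<bar> + \<bar>x'\<bar> * \<bar>y - y'\<bar>"
    by (metis abs_mult abs_triangle_ineq)
  also have "\<dots> \<le> dx * N + K * dy" using assms by (intro add_mono mult_mono) auto
  finally show ?thesis .
qed

text \<open>The planar system with coefficients frozen outside \<open>[a, w]\<close> and the momentum truncated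
  at \<open>\<plusminus>M\<close>: it is globally Lipschitz and still has a monotone energy.\<close>

locale cutoff_system =
  fixes r f b F \<Phi> :: "real \<Rightarrow> real" and a m w M B L :: real
  assumes am: "a < m" and mw: "m < w" and M: "M > 0" and L: "L \<ge> 0"
    and r_pos: "\<And>v. r v > 0" and b_pos: "\<And>v. b v > 0"
    and bounds: "\<And>v. \<bar>r v\<bar> \<le> B" "\<And>v. \<bar>f v\<bar> \<le> B" "\<And>v. \<bar>b v\<bar> \<le> B"
    and lips: "\<And>v v'. \<bar>r v - r v'\<bar> \<le> L * \<bar>v - v'\<bar>" "\<And>v v'. \<bar>f v - f v'\<bar> \<le> L * \<bar>v - v'\<bar>"
      "\<And>v v'. \<bar>b v - b v'\<bar> \<le> L * \<bar>v - v'\<bar>"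
    and dF: "\<And>v. (F has_real_derivative f v) (at v)"
    and f_zero: "f a = 0" "f m = 0"
    and f_neg: "\<And>v. a < v \<Longrightarrow> v < m \<Longrightarrow> f v < 0" and f_pos: "\<And>v. m < v \<Longrightarrow> f v > 0"
    and Fw: "F w \<ge> F a" and FM: "F a - F m < M\<^sup>2 / 2"
    and d\<Phi>: "\<And>p. (\<Phi> has_real_derivative max (- M) (min M p)) (at p)" and \<Phi>0: "\<Phi> 0 = 0"
begin

definition h :: "real \<Rightarrow> real" where "h p = max (- M) (min M p)"

lemma h_simps: "\<bar>p\<bar> \<le> M \<Longrightarrow> h p = p" "\<bar>h p\<bar> \<le> M" "\<bar>h p - h p'\<bar> \<le> \<bar>p - p'\<bar>" "h 0 = 0"
  "\<bar>h p\<bar> < M \<Longrightarrow> h p = p" "p < 0 \<Longrightarrow> h p < 0" "p \<le> 0 \<Longrightarrow> h p \<le> 0"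
  using M by (auto simp: h_def)

lemma d\<Phi>': "(\<Phi> has_real_derivative h p) (at p)"
  using d\<Phi> by (simp add: h_def)

lemma \<Phi>_inner:
  assumes "\<bar>p\<bar> \<le> M"
  shows "\<Phi> p = p\<^sup>2 / 2"
proof -
  have "((\<lambda>p. \<Phi> p - p\<^sup>2 / 2) has_real_derivative 0) (at x within {-M..M})" if "x \<in> {-M..M}" for x
  proof -
    have "((\<lambda>p. \<Phi> p - p\<^sup>2 / 2) has_real_derivative h x - x) (at x)"
      using d\<Phi>'[of x] by (auto intro!: derivative_eq_intros)
    then show ?thesis using that h_simps(1)[of x] by (auto intro: has_field_derivative_at_within)
  qed
  then obtain c where "\<And>x. x \<in> {-M..M} \<Longrightarrow> \<Phi> x - x\<^sup>2 / 2 = c"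
    using has_field_derivative_zero_constant[of "{-M..M}" "\<lambda>p. \<Phi> p - p\<^sup>2 / 2"] by auto
  from this[of 0] this[of p] show ?thesis using assms \<Phi>0 M by (auto simp: abs_le_iff)
qed

lemma \<Phi>_mono:
  assumes "0 \<le> p" "p \<le> q"
  shows "\<Phi> p \<le> \<Phi> q"
proof (rule DERIV_nonneg_imp_nondecreasing[OF assms(2)])
  show "\<exists>y. (\<Phi> has_real_derivative y) (at x) \<and> 0 \<le> y" if "p \<le> x" for x
    using that assms M d\<Phi>'[of x] by (intro exI[of _ "h x"]) (auto simp: h_def)
qed

lemma \<Phi>_antimono:
  assumes "p \<le> q" "q \<le> 0"
  shows "\<Phi> q \<le> \<Phi> p"
proof (rule DERIV_nonpos_imp_nonincreasing[OF assms(1)])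
  show "\<exists>y. (\<Phi> has_real_derivative y) (at x) \<and> y \<le> 0" if "x \<le> q" for x
    using that assms d\<Phi>'[of x] h_simps(7)[of x] by (intro exI[of _ "h x"]) auto
qed

lemma \<Phi>_nonneg: "\<Phi> p \<ge> 0"
  using \<Phi>_mono[of 0 p] \<Phi>_antimono[of p 0] \<Phi>0 by (cases "p \<ge> 0") auto

text \<open>Turns an energy bound into a momentum bound. With \<open>e = M\<close> it shows that an
  orbit of low energy never meets the truncation.\<close>

lemma \<Phi>_small:
  assumes "0 < e" "e \<le> M" "\<Phi> p < e\<^sup>2 / 2"
  shows "\<bar>p\<bar> < e"
proof (rule ccontr)
  assume "\<not> \<bar>p\<bar> < e"
  then have "\<Phi> p \<ge> \<Phi> e \<or> \<Phi> p \<ge> \<Phi> (- e)"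
    using \<Phi>_mono[of e p] \<Phi>_antimono[of p "-e"] assms by (cases "p \<ge> 0") auto
  then show False using \<Phi>_inner[of e] \<Phi>_inner[of "-e"] assms by auto
qed

section \<open>Shape of the potential and Lipschitz bounds for the cutoff field\<close>

lemma F_less:
  assumes "a < v" "v < m"
  shows "F v < F a" "F m < F v"
proof -
  have "\<exists>x. a < x \<and> x < v \<and> F v - F a = (v - a) * f x" using MVT2[of a v F f] dF assms by auto
  then obtain x where "a < x" "x < v" "F v - F a = (v - a) * f x" by blast
  then show "F v < F a" using f_neg[of x] assms mult_pos_neg[of "v - a" "f x"] by auto
  have "\<exists>x. v < x \<and> x < m \<and> F m - F v = (m - v) * f x" using MVT2[of v m F f] dF assms by auto
  then obtain x where "v < x" "x < m" "F m - F v = (m - v) * f x" by blast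
  then show "F m < F v" using f_neg[of x] assms mult_pos_neg[of "m - v" "f x"] by auto
qed

lemma F_min:
  assumes "a \<le> v"
  shows "F m \<le> F v"
proof (cases "v \<le> m")
  case False
  then have "m \<le> v" by simp
  then show ?thesis
  proof (rule DERIV_nonneg_imp_nondecreasing)
    show "\<exists>y. (F has_real_derivative y) (at x) \<and> 0 \<le> y" if "m \<le> x" for x
      using that dF[of x] f_pos[of x] f_zero
      by (intro exI[of _ "f x"]) (auto simp: order.order_iff_strict)
  qed
next
  case True
  obtain v1 where v1: "a < v1" "v1 < m" using am dense by blast
  show ?thesis using F_less[of v] F_less[OF v1] True assms
    by (cases "v = a"; cases "v = m") auto
qed

definition X :: "real \<Rightarrow> real \<Rightarrow> real" where "X v p = r v * h p"
definition Y :: "real \<Rightarrow> real \<Rightarrow> real" where "Y v p = b v * h p - r v * f v"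
text \<open>One Lipschitz constant for both components: \<open>L * M\<close> and \<open>B\<close>
  come from a coefficient times \<open>h\<close>, which is bounded by \<open>M\<close> and
  1-Lipschitz; \<open>2 * B * L\<close> comes from the product of \<open>r\<close> and
  \<open>f\<close>.\<close>

definition L' :: real where "L' = L * M + B + 2 * B * L"

lemma B_nonneg: "B \<ge> 0" using bounds(1)[of 0] by linarith

lemma L'_nonneg: "L' \<ge> 0" using L M B_nonneg by (simp add: L'_def)

lemma X_lip: "\<bar>X v p - X v' p'\<bar> \<le> L' * (\<bar>v - v'\<bar> + \<bar>p - p'\<bar>)"
proof -
  have "\<bar>X v p - X v' p'\<bar> \<le> L * \<bar>v - v'\<bar> * M + B * \<bar>p - p'\<bar>"
    unfolding X_def using lips bounds h_simps by (intro abs_mult_diff_le)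
  also have "\<dots> = (L * M) * \<bar>v - v'\<bar> + B * \<bar>p - p'\<bar>" by simp
  also have "\<dots> \<le> L' * \<bar>v - v'\<bar> + L' * \<bar>p - p'\<bar>"
    using L M B_nonneg by (intro add_mono mult_right_mono) (auto simp: L'_def)
  finally show ?thesis by (simp add: algebra_simps)
qed

lemma Y_lip: "\<bar>Y v p - Y v' p'\<bar> \<le> L' * (\<bar>v - v'\<bar> + \<bar>p - p'\<bar>)"
proof -
  have "\<bar>b v * h p - b v' * h p'\<bar> \<le> L * \<bar>v - v'\<bar> * M + B * \<bar>p - p'\<bar>"
    using lips bounds h_simps by (intro abs_mult_diff_le)
  moreover have "\<bar>r v * f v - r v' * f v'\<bar> \<le> L * \<bar>v - v'\<bar> * B + B * (L * \<bar>v - v'\<bar>)"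
    using lips bounds by (intro abs_mult_diff_le)
  ultimately have "\<bar>Y v p - Y v' p'\<bar> \<le> (L * M + 2 * B * L) * \<bar>v - v'\<bar> + B * \<bar>p - p'\<bar>"
    unfolding Y_def by (simp add: algebra_simps)
  also have "\<dots> \<le> L' * \<bar>v - v'\<bar> + L' * \<bar>p - p'\<bar>"
    using L M B_nonneg by (intro add_mono mult_right_mono) (auto simp: L'_def)
  finally show ?thesis by (simp add: algebra_simps)
qed

definition sol :: "(real \<Rightarrow> real) \<Rightarrow> (real \<Rightarrow> real) \<Rightarrow> bool" where
  "sol V P \<longleftrightarrow> (\<forall>t. (V has_real_derivative X (V t) (P t)) (at t)) \<and>
     (\<forall>t. (P has_real_derivative Y (V t) (P t)) (at t))"

lemma solD:
  assumes "sol V P"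
  shows "(V has_real_derivative X (V t) (P t)) (at t)" "(P has_real_derivative Y (V t) (P t)) (at t)"
    "isCont V t" "isCont P t"
  using assms DERIV_isCont unfolding sol_def by blast+

lemma sol_exists: "\<exists>V P. sol V P \<and> V 0 = v0 \<and> P 0 = p0"
  using planar_global_solution[of X L' Y v0 p0, OF X_lip Y_lip] unfolding sol_def by metis

lemma sol_unique:
  assumes "sol V P" "sol V' P'" "V t0 = V' t0" "P t0 = P' t0"
  shows "V t = V' t \<and> P t = P' t"
  using solD(1)[OF assms(1)] solD(2)[OF assms(1)] solD(1)[OF assms(2)] solD(2)[OF assms(2)]
    X_lip Y_lip L'_nonneg assms(3,4)
  by (rule planar_unique)

text \<open>Quantitative dependence on the initial momentum alone, the position being common. It
  yields the openness of the two shooting sets.\<close>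

lemma sol_dependence:
  assumes "sol V P" "sol V' P'" "V 0 = V' 0" "t \<ge> 0"
  shows "\<bar>V t - V' t\<bar> \<le> exp (2 * L' * t) * \<bar>P 0 - P' 0\<bar>"
    and "\<bar>P t - P' t\<bar> \<le> exp (2 * L' * t) * \<bar>P 0 - P' 0\<bar>"
proof -
  have "(V t - V' t)\<^sup>2 + (P t - P' t)\<^sup>2 \<le> exp (4 * L' * t) * ((V 0 - V' 0)\<^sup>2 + (P 0 - P' 0)\<^sup>2)"
    using solD(1)[OF assms(1)] solD(2)[OF assms(1)] solD(1)[OF assms(2)] solD(2)[OF assms(2)]
      X_lip Y_lip L'_nonneg assms(4)
    by (rule gronwall_planar_right)
  also have "\<dots> = (exp (2 * L' * t) * \<bar>P 0 - P' 0\<bar>)\<^sup>2"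
    using assms(3) exp_double[of "2 * L' * t"] by (simp add: power_mult_distrib mult.assoc)
  finally have *: "(V t - V' t)\<^sup>2 + (P t - P' t)\<^sup>2 \<le> (exp (2 * L' * t) * \<bar>P 0 - P' 0\<bar>)\<^sup>2" .
  have c: "0 \<le> exp (2 * L' * t) * \<bar>P 0 - P' 0\<bar>" by simp
  have "\<bar>V t - V' t\<bar>\<^sup>2 \<le> (exp (2 * L' * t) * \<bar>P 0 - P' 0\<bar>)\<^sup>2"
    "\<bar>P t - P' t\<bar>\<^sup>2 \<le> (exp (2 * L' * t) * \<bar>P 0 - P' 0\<bar>)\<^sup>2"
    using * zero_le_power2[of "V t - V' t"] zero_le_power2[of "P t - P' t"]
    unfolding power2_abs by linarith+
  then show "\<bar>V t - V' t\<bar> \<le> exp (2 * L' * t) * \<bar>P 0 - P' 0\<bar>"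
    "\<bar>P t - P' t\<bar> \<le> exp (2 * L' * t) * \<bar>P 0 - P' 0\<bar>"
    using power2_le_imp_le[OF _ c] by blast+
qed

definition E :: "(real \<Rightarrow> real) \<Rightarrow> (real \<Rightarrow> real) \<Rightarrow> real \<Rightarrow> real" where
  "E V P t = \<Phi> (P t) + F (V t)"

text \<open>Since \<open>\<Phi>\<close> is an antiderivative of the truncation \<open>h\<close>, the
  terms r f h cancel exactly, also where the truncation acts.\<close>

lemma dE:
  assumes "sol V P"
  shows "(E V P has_real_derivative b (V t) * (h (P t))\<^sup>2) (at t)"
proof -
  have "((\<lambda>t. \<Phi> (P t) + F (V t)) has_real_derivative
      h (P t) * Y (V t) (P t) + f (V t) * X (V t) (P t)) (at t)"
    using solD(1,2)[OF assms, of t]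
    by (intro DERIV_add DERIV_chain2[OF d\<Phi>'] DERIV_chain2[OF dF])
  then show ?thesis
    by (simp add: E_def[abs_def] X_def Y_def algebra_simps power2_eq_square)
qed

lemma E_mono:
  assumes "sol V P" "s \<le> t"
  shows "E V P s \<le> E V P t"
proof (rule DERIV_nonneg_imp_nondecreasing[OF assms(2)])
  show "\<exists>y. (E V P has_real_derivative y) (at x) \<and> 0 \<le> y" for x
    using dE[OF assms(1), of x] b_pos[of "V x"]
    by (intro exI[of _ "b (V x) * (h (P x))\<^sup>2"]) auto
qed

lemma sol_const: "sol (\<lambda>_. a) (\<lambda>_. 0)"
  by (simp add: sol_def X_def Y_def h_simps f_zero)

lemma continuity_nbhd:
  fixes g :: "real \<Rightarrow> real"
  assumes "isCont g x" "g x > c"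
  shows "\<exists>d>0. \<forall>y. \<bar>y - x\<bar> < d \<longrightarrow> g y > c"
proof -
  obtain d where d: "d > 0" "\<And>y. y \<noteq> x \<Longrightarrow> \<bar>y - x\<bar> < d \<Longrightarrow> c < g y"
    using assms order_tendstoD(1)[of g "g x" "at x" c]
    unfolding isCont_def eventually_at dist_real_def by auto
  then have "c < g y" if "\<bar>y - x\<bar> < d" for y using that assms(2) by (cases "y = x") auto
  then show ?thesis using d(1) by blast
qed

text \<open>On the axis P = 0 between \<open>a\<close> and \<open>m\<close> the force - r f is
  positive, so an orbit touching the axis there enters P > 0 at once; tangential contact is
  impossible.\<close>

lemma escape:
  assumes s: "sol V P" and "a < V T" "V T < m" "P T = 0"
  shows "\<exists>d>0. \<forall>t. T < t \<and> t < T + d \<longrightarrow> P t > 0 \<and> V t > a"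
proof -
  have "Y (V T) (P T) > 0"
    using assms f_neg[of "V T"] r_pos[of "V T"] by (simp add: Y_def h_simps mult_pos_neg)
  then obtain d1 where d1: "d1 > 0" "\<And>h. 0 < h \<Longrightarrow> h < d1 \<Longrightarrow> P T < P (T + h)"
    using DERIV_pos_inc_right[OF solD(2)[OF s, of T]] by blast
  obtain d2 where d2: "d2 > 0" "\<And>y. \<bar>y - T\<bar> < d2 \<Longrightarrow> V y > a"
    using continuity_nbhd[OF solD(3)[OF s] \<open>a < V T\<close>] by blast
  show ?thesis
    using d1 d2(1) d1(2)[of "t - T" for t] d2(2) assms
    by (intro exI[of _ "min d1 d2"]) auto
qed

lemma V_antitone:
  assumes s: "sol V P" and "s \<le> t" and "\<And>x. s \<le> x \<Longrightarrow> x < t \<Longrightarrow> P x \<le> 0"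
  shows "V t \<le> V s"
proof (rule DERIV_nonpos_imp_decreasing_open[OF \<open>s \<le> t\<close>])
  show "\<exists>y. (V has_real_derivative y) (at x) \<and> y \<le> 0" if "s < x" "x < t" for x
    using solD(1)[OF s, of x] assms(3)[of x] that r_pos[of "V x"] h_simps(7)[of "P x"]
    by (intro exI[of _ "X (V x) (P x)"]) (auto simp: X_def mult_nonneg_nonpos)
  show "continuous_on {s..t} V" using solD(3)[OF s] by (simp add: continuous_at_imp_continuous_on)
qed

lemma shooting:
  assumes v0: "a < v0" "v0 < m"
  obtains V P where "sol V P" "V 0 = v0" "\<And>t. t \<ge> 0 \<Longrightarrow> V t > a" "\<And>t. t \<ge> 0 \<Longrightarrow> P t < 0"
proof -
  obtain \<phi> \<psi> where sol: "\<And>q. sol (\<phi> q) (\<psi> q)" and init: "\<And>q. \<phi> q 0 = v0" "\<And>q. \<psi> q 0 = - q"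
    using sol_exists[of v0 "- q" for q] by metis
  \<comment> \<open>Both sets ask for strict inequalities on a compact time interval, so that
    closeness of solutions on it preserves membership.\<close>
  define A where "A = {q. \<exists>t\<ge>0. \<psi> q t > 0 \<and> (\<forall>s\<in>{0..t}. \<phi> q s > a)}"
  define B where "B = {q. \<exists>t\<ge>0. \<phi> q t < a \<and> (\<forall>s\<in>{0..t}. \<psi> q s < 0)}"
  have cont: "continuous_on S (\<phi> q)" "continuous_on S (\<psi> q)" for S q
    using solD(3,4)[OF sol] by (auto intro!: continuous_at_imp_continuous_on)
  have near: "\<exists>d>0. \<forall>q'. \<bar>q' - q\<bar> < d \<longrightarrow> (\<forall>s\<in>{0..t}. \<bar>\<phi> q' s - \<phi> q s\<bar> < e \<and> \<bar>\<psi> q' s - \<psi> q s\<bar> < e)"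
    if "e > 0" "t \<ge> 0" for q t e
  proof (intro exI[of _ "e / exp (2 * L' * t)"] conjI allI impI ballI)
    show "0 < e / exp (2 * L' * t)" using that by simp
    fix q' s assume q': "\<bar>q' - q\<bar> < e / exp (2 * L' * t)" and s: "s \<in> {0..t}"
    have "exp (2 * L' * s) * \<bar>\<psi> q' 0 - \<psi> q 0\<bar> \<le> exp (2 * L' * t) * \<bar>q' - q\<bar>"
      using s L'_nonneg by (intro mult_mono) (auto simp: init mult_left_mono)
    also have "\<dots> < e" using q' by (simp add: field_simps)
    finally have *: "exp (2 * L' * s) * \<bar>\<psi> q' 0 - \<psi> q 0\<bar> < e" .
    show "\<bar>\<phi> q' s - \<phi> q s\<bar> < e" "\<bar>\<psi> q' s - \<psi> q s\<bar> < e"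
      using sol_dependence[OF sol[of q'] sol[of q], of s] s * by (auto simp: init)
  qed
  have "open A"
  proof (unfold open_dist, intro ballI)
    fix q assume "q \<in> A"
    then obtain t where t: "t \<ge> 0" "\<psi> q t > 0" "\<And>s. s \<in> {0..t} \<Longrightarrow> \<phi> q s > a" by (auto simp: A_def)
    obtain s0 where s0: "s0 \<in> {0..t}" "\<And>s. s \<in> {0..t} \<Longrightarrow> \<phi> q s0 \<le> \<phi> q s"
      using continuous_attains_inf[of "{0..t}" "\<phi> q"] cont t(1) by auto
    define e where "e = min (\<psi> q t) (\<phi> q s0 - a)"
    have "e > 0" using t s0 by (simp add: e_def)
    from near[OF this t(1), of q] obtain d where d: "d > 0"
      "\<And>q' s. \<bar>q' - q\<bar> < d \<Longrightarrow> s \<in> {0..t} \<Longrightarrow> \<bar>\<phi> q' s - \<phi> q s\<bar> < e \<and> \<bar>\<psi> q' s - \<psi> q s\<bar> < e"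
      by blast
    have "q' \<in> A" if "\<bar>q' - q\<bar> < d" for q'
    proof -
      have "\<psi> q' t > 0" using d(2)[OF that, of t] t by (auto simp: e_def)
      moreover have "\<phi> q' s > a" if s: "s \<in> {0..t}" for s
        using d(2)[OF \<open>\<bar>q' - q\<bar> < d\<close> s] s0(2)[OF s] by (auto simp: e_def)
      ultimately show ?thesis using t(1) by (auto simp: A_def)
    qed
    then show "\<exists>e>0. \<forall>y. dist y q < e \<longrightarrow> y \<in> A" using d(1) by (auto simp: dist_real_def)
  qed
  have "open B"
  proof (unfold open_dist, intro ballI)
    fix q assume "q \<in> B"
    then obtain t where t: "t \<ge> 0" "\<phi> q t < a" "\<And>s. s \<in> {0..t} \<Longrightarrow> \<psi> q s < 0" by (auto simp: B_def)
    obtain s0 where s0: "s0 \<in> {0..t}" "\<And>s. s \<in> {0..t} \<Longrightarrow> \<psi> q s \<le> \<psi> q s0"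
      using continuous_attains_sup[of "{0..t}" "\<psi> q"] cont t(1) by auto
    define e where "e = min (- \<psi> q s0) (a - \<phi> q t)"
    have "e > 0" using t s0 by (simp add: e_def)
    from near[OF this t(1), of q] obtain d where d: "d > 0"
      "\<And>q' s. \<bar>q' - q\<bar> < d \<Longrightarrow> s \<in> {0..t} \<Longrightarrow> \<bar>\<phi> q' s - \<phi> q s\<bar> < e \<and> \<bar>\<psi> q' s - \<psi> q s\<bar> < e"
      by blast
    have "q' \<in> B" if "\<bar>q' - q\<bar> < d" for q'
    proof -
      have "\<phi> q' t < a" using d(2)[OF that, of t] t by (auto simp: e_def)
      moreover have "\<psi> q' s < 0" if s: "s \<in> {0..t}" for s
        using d(2)[OF \<open>\<bar>q' - q\<bar> < d\<close> s] s0(2)[OF s] by (auto simp: e_def)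
      ultimately show ?thesis using t(1) by (auto simp: B_def)
    qed
    then show "\<exists>e>0. \<forall>y. dist y q < e \<longrightarrow> y \<in> B" using d(1) by (auto simp: dist_real_def)
  qed
  have disj: "A \<inter> B = {}"
  proof (rule ccontr)
    assume "A \<inter> B \<noteq> {}"
    then obtain q t t' where t: "t \<ge> 0" "\<psi> q t > 0" "\<And>s. s \<in> {0..t} \<Longrightarrow> \<phi> q s > a"
      and t': "t' \<ge> 0" "\<phi> q t' < a" "\<And>s. s \<in> {0..t'} \<Longrightarrow> \<psi> q s < 0"
      unfolding A_def B_def by blast
    show False
    proof (cases "t \<le> t'")
      case True
      then show False using t(1,2) t'(3)[of t] by auto
    next
      case False
      then show False using t'(1,2) t(3)[of t'] by auto
    qed
  qed
  have zero: "0 \<in> A"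
  proof -
    from escape[OF sol[of 0], of 0] init v0
    obtain d where d: "d > 0" "\<And>t. 0 < t \<Longrightarrow> t < d \<Longrightarrow> \<psi> 0 t > 0 \<and> \<phi> 0 t > a" by auto
    have "\<phi> 0 s > a" if "s \<in> {0..d/2}" for s
      using d(1) d(2)[of s] that v0 by (cases "s = 0") (auto simp: init)
    then show ?thesis using d(1) d(2)[of "d/2"] by (auto simp: A_def intro!: exI[of _ "d/2"])
  qed
  \<comment> \<open>With initial momentum \<open>- M\<close> the energy starts above M^2 / 2 + F m >
    F a. When P first returns to 0 with a < V \<le> v0, the energy would be F V < F a, although it
    cannot decrease.\<close>
  have "M \<notin> A"
  proof
    assume "M \<in> A"
    then obtain t where t: "t \<ge> 0" "\<psi> M t > 0" "\<And>s. s \<in> {0..t} \<Longrightarrow> \<phi> M s > a"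
      by (auto simp: A_def)
    obtain T where T: "0 < T" "T \<le> t" "\<psi> M T = 0" "\<And>s. 0 \<le> s \<Longrightarrow> s < T \<Longrightarrow> \<psi> M s < 0"
      using continuous_first_zero[of "\<psi> M" t] solD(4)[OF sol] t M by (auto simp: init)
    have "\<phi> M T \<le> v0" using V_antitone[OF sol, of 0 T M] T by (force simp: init less_imp_le)
    then have "F (\<phi> M T) < F a" using F_less(1)[of "\<phi> M T"] t(3)[of T] T v0 by auto
    moreover have "E (\<phi> M) (\<psi> M) 0 \<le> E (\<phi> M) (\<psi> M) T" using E_mono[OF sol] T by auto
    ultimately show False
      using F_less(2)[OF v0] FM T(3) \<Phi>0 \<Phi>_inner[of "- M"] M by (auto simp: E_def init)
  qed
  have "\<exists>q\<in>{0..M}. q \<notin> A \<and> q \<notin> B"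
  proof (rule ccontr)
    assume "\<not> (\<exists>q\<in>{0..M}. q \<notin> A \<and> q \<notin> B)"
    then have sub: "{0..M} \<subseteq> A \<union> B" by auto
    have "A \<inter> {0..M} = {} \<or> B \<inter> {0..M} = {}"
      using disj by (intro connectedD[OF connected_Icc \<open>open A\<close> \<open>open B\<close> _ sub]) auto
    moreover have "0 \<in> A \<inter> {0..M}" using zero M by simp
    moreover have "M \<in> {0..M}" using M by simp
    then have "M \<in> B \<inter> {0..M}" using \<open>M \<notin> A\<close> sub by blast
    ultimately show False by blast
  qed
  then obtain q where q: "0 \<le> q" "q \<notin> A" "q \<notin> B" by auto
  then have "q > 0" using zero by (cases "q = 0") auto
  have stay: "\<phi> q t > a \<and> \<psi> q t < 0" if t: "t \<ge> 0" for t
  proof (rule ccontr)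
    assume n: "\<not> (\<phi> q t > a \<and> \<psi> q t < 0)"
    \<comment> \<open>Negative exactly while V > a and P < 0, so its first zero is the first exit
      from this quadrant.\<close>
    define g where "g t = max (a - \<phi> q t) (\<psi> q t)" for t
    have contg: "isCont g t" for t
      unfolding g_def using solD(3,4)[OF sol] by (intro continuous_intros)
    obtain T where T: "0 < T" "g T = 0" "\<And>s. 0 \<le> s \<Longrightarrow> s < T \<Longrightarrow> g s < 0"
    proof -
      have "g 0 < 0" "g t \<ge> 0" using n v0 \<open>q > 0\<close> by (auto simp: g_def init)
      from continuous_first_zero[OF contg this(1) t this(2)] that show thesis by blast
    qed
    have le: "\<phi> q T \<le> v0"
      using V_antitone[OF sol, of 0 T q] T by (force simp: init g_def)
    have before: "\<phi> q s > a" "\<psi> q s < 0" if "0 \<le> s" "s < T" for s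
      using T(3)[OF that] by (auto simp: g_def)
    \<comment> \<open>The corner is an equilibrium, reached in finite time only by the constant
      solution. Leaving through P = 0 puts \<open>q\<close> into \<open>A\<close> by
      \<open>escape\<close>; leaving through V = a puts it into \<open>B\<close>, because there V' <
      0.\<close>
    consider "\<phi> q T = a" "\<psi> q T = 0" | "\<phi> q T > a" "\<psi> q T = 0" | "\<phi> q T = a" "\<psi> q T < 0"
      using T(2) unfolding g_def by (smt (verit))
    then show False
    proof cases
      case 1
      then show False using sol_unique[OF sol[of q] sol_const, of T 0] v0 by (auto simp: init)
    next
      case 2
      then obtain d where d: "d > 0" "\<And>t. T < t \<Longrightarrow> t < T + d \<Longrightarrow> \<psi> q t > 0 \<and> \<phi> q t > a"
        using escape[OF sol[of q], of T] le v0 by auto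
      have "\<phi> q s > a" if "s \<in> {0..T + d/2}" for s
        using before(1)[of s] 2(1) d(1) d(2)[of s] that by (cases s T rule: linorder_cases) auto
      then have "q \<in> A" using d(1) d(2)[of "T + d/2"] T(1) by (auto simp: A_def intro!: exI[of _ "T + d/2"])
      then show False using q by simp
    next
      case 3
      have "X (\<phi> q T) (\<psi> q T) < 0" using 3 r_pos h_simps(6) by (simp add: X_def mult_pos_neg)
      then obtain d1 where d1: "d1 > 0" "\<And>h. 0 < h \<Longrightarrow> h < d1 \<Longrightarrow> \<phi> q (T + h) < \<phi> q T"
        using DERIV_neg_dec_right[OF solD(1)[OF sol[of q], of T]] by blast
      obtain d2 where d2: "d2 > 0" "\<And>y. \<bar>y - T\<bar> < d2 \<Longrightarrow> - \<psi> q y > 0"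
        using continuity_nbhd[where g = "\<lambda>t. - \<psi> q t" and x = T and c = 0] solD(4)[OF sol[of q], of T] 3 by auto
      define d where "d = min d1 d2 / 2"
      have d: "d > 0" "d < d1" "d < d2" using d1 d2 by (auto simp: d_def)
      have "\<psi> q s < 0" if "s \<in> {0..T + d}" for s
        using before(2)[of s] d2(2)[of s] that d by (cases "s < T") auto
      then have "q \<in> B" using d d1(2)[of d] 3 T(1) by (auto simp: B_def intro!: exI[of _ "T + d"])
      then show False using q by simp
    qed
  qed
  show ?thesis using that[OF sol[of q] init(1)] stay by auto
qed

text \<open>Forward in time the orbit is monotone; backward in time the energy traps it in the
  potential well around \<open>m\<close>, and Barbalat's lemma, applied to the energy and then to the
  momentum, replaces the invariance principle.\<close>

proposition heteroclinic_orbit: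
  obtains V P where "\<And>t. (V has_real_derivative r (V t) * P t) (at t)"
    "\<And>t. (P has_real_derivative b (V t) * P t - r (V t) * f (V t)) (at t)"
    "\<And>t. a < V t" "\<And>t. V t < w"
    "(V \<longlongrightarrow> m) at_bot" "(V \<longlongrightarrow> a) at_top"
proof -
  obtain v0 where v0: "a < v0" "v0 < m" using am dense by blast
  obtain V P where s: "sol V P" and V0: "V 0 = v0"
    and Va: "\<And>t. t \<ge> 0 \<Longrightarrow> V t > a" and Pneg: "\<And>t. t \<ge> 0 \<Longrightarrow> P t < 0"
    using shooting[OF v0] by blast
  have cont: "continuous_on S r" "continuous_on S f" "continuous_on S b" for S
    using lips by (auto intro!: lipschitz_on_continuous_on[of L] lipschitz_onI simp: dist_real_def L)
  have contF: "continuous_on S F" for S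
    using dF by (auto intro!: continuous_at_imp_continuous_on DERIV_isCont)
  have at: "isCont r v" "isCont f v" "isCont b v" for v
    using cont[of UNIV] by (auto simp: continuous_on_eq_continuous_at)
  have contV: "continuous_on S V" for S using solD(3)[OF s] by (simp add: continuous_at_imp_continuous_on)
  have dec: "V t \<le> V u" if "0 \<le> u" "u \<le> t" for u t
    using V_antitone[OF s that(2)] Pneg that by (force simp: less_imp_le)
  define l where "l = Inf (V ` {0..})"
  have bdd: "bdd_below (V ` {0..})" using Va by (auto intro!: bdd_belowI[of _ a] less_imp_le)
  have Vl: "(V \<longlongrightarrow> l) at_top"
  proof (rule decreasing_tendsto)
    show "eventually (\<lambda>t. l \<le> V t) at_top"
      using eventually_ge_at_top[of 0] unfolding l_def
      by eventually_elim (auto intro!: cInf_lower bdd)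
    fix x assume "l < x"
    then obtain u where "u \<ge> 0" "V u < x"
      using cInf_lessD[of "V ` {0..}" x] unfolding l_def by auto
    then show "eventually (\<lambda>t. V t < x) at_top"
      by (intro eventually_mono[OF eventually_ge_at_top[of u]]) (rule le_less_trans[OF dec])
  qed
  have la: "a \<le> l" unfolding l_def by (rule cInf_greatest) (auto intro: less_imp_le Va)
  have lv0: "l \<le> v0" unfolding l_def V0[symmetric] by (rule cInf_lower) (auto intro: bdd)
  \<comment> \<open>The minimum of \<open>r\<close> over the range of V lets a bound on V' = r h(P)
    be read as a bound on P.\<close>
  obtain v1 where v1: "v1 \<in> {a..w}" "\<And>v. v \<in> {a..w} \<Longrightarrow> r v1 \<le> r v"
    using continuous_attains_inf[of "{a..w}" r] cont am mw by auto
  have "((\<lambda>t. \<Phi> (P t)) \<longlongrightarrow> 0) at_top"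
  proof (rule kinetic_energy_tendsto_0[OF solD(1)[OF s] Vl DERIV_isCont[OF dF]])
    show "mono (\<lambda>t. \<Phi> (P t) + F (V t)) \<or> antimono (\<lambda>t. \<Phi> (P t) + F (V t))"
      using E_mono[OF s] by (auto simp: mono_def E_def)
    fix e :: real assume e: "e > 0"
    define d where "d = min M (sqrt (2 * e))"
    have d: "d > 0" "d \<le> M" using e M by (auto simp: d_def)
    have "d\<^sup>2 \<le> (sqrt (2 * e))\<^sup>2" using d by (intro power_mono) (auto simp: d_def)
    then have d2: "d\<^sup>2 \<le> 2 * e" using e by simp
    have "\<bar>\<Phi> (P t)\<bar> < e" if t: "t \<ge> 0" and small: "\<bar>X (V t) (P t)\<bar> < r v1 * d" for t
    proof -
      have "V t \<in> {a..w}" using Va[OF t] dec[of 0 t] t V0 v0 mw by auto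
      then have "r v1 * \<bar>h (P t)\<bar> \<le> r (V t) * \<bar>h (P t)\<bar>" using v1 by (intro mult_right_mono) auto
      also have "\<dots> < r v1 * d" using small r_pos[of "V t"] by (simp add: X_def abs_mult)
      finally have hd: "\<bar>h (P t)\<bar> < d" using r_pos[of v1] by simp
      then have P: "h (P t) = P t" using d by (intro h_simps(5)) auto
      have "\<bar>P t\<bar>\<^sup>2 < d\<^sup>2" using hd P by (intro power_strict_mono) auto
      then show ?thesis using \<Phi>_inner[of "P t"] \<Phi>_nonneg[of "P t"] hd P d d2
        unfolding power2_abs by simp
    qed
    then show "\<exists>d>0. eventually (\<lambda>t. \<bar>X (V t) (P t)\<bar> < d \<longrightarrow> \<bar>\<Phi> (P t)\<bar> < e) at_top"
      using d r_pos[of v1] by (intro exI[of _ "r v1 * d"]) (auto simp: eventually_at_top_linorder)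
  qed
  note \<Phi>lim = this
  have Plim: "(P \<longlongrightarrow> 0) at_top"
  proof (rule tendstoI)
    fix e :: real assume "e > 0"
    define d where "d = min M e"
    have d: "d > 0" "d \<le> M" "d \<le> e" using M \<open>e > 0\<close> by (auto simp: d_def)
    have "eventually (\<lambda>t. \<Phi> (P t) < d\<^sup>2 / 2) at_top"
      using order_tendstoD(2)[OF \<Phi>lim, of "d\<^sup>2 / 2"] d by simp
    then show "eventually (\<lambda>t. dist (P t) 0 < e) at_top"
    proof eventually_elim
      case (elim t)
      then show ?case using \<Phi>_small[of d "P t"] d by simp
    qed
  qed
  have isCh: "isCont h 0"
    unfolding h_def[abs_def] by (intro continuous_intros)
  \<comment> \<open>As P converges, a limit of P' must be 0; here it is - r l times f l. So
    \<open>l\<close> is a zero of \<open>f\<close>, and in [a, v0] only \<open>a\<close> is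
    one.\<close>
  have "((\<lambda>t. Y (V t) (P t)) \<longlongrightarrow> b l * h 0 - r l * f l) at_top"
    unfolding Y_def using Vl Plim at isCh
    by (intro tendsto_intros isCont_tendsto_compose[of _ r] isCont_tendsto_compose[of _ f]
        isCont_tendsto_compose[of _ b] isCont_tendsto_compose[of _ h])
  from derivative_limit_eq_0[OF solD(2)[OF s] Plim this]
  have "f l = 0" using r_pos[of l] h_simps(4) by simp
  then have l: "l = a" using la lv0 v0 f_neg[of l] by force
  have "((\<lambda>t. \<Phi> (P t) + F (V t)) \<longlongrightarrow> 0 + F a) at_top"
    using \<Phi>lim isCont_tendsto_compose[OF DERIV_isCont[OF dF] Vl] l by (intro tendsto_add) auto
  then have Elim: "(E V P \<longlongrightarrow> F a) at_top" by (simp add: E_def[abs_def])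
  have Ele: "E V P t \<le> F a" for t
    by (rule tendsto_lowerbound[OF Elim])
      (auto intro!: exI[of _ t] E_mono[OF s] simp: eventually_at_top_linorder)
  \<comment> \<open>The level \<open>F a\<close> is attained only in the limit: for nonnegative
    times P < 0, so the growth rate of the energy is strictly positive.\<close>
  have Eless: "E V P t < F a" for t
  proof -
    define u where "u = max t 0"
    have "E V P t \<le> E V P u" using E_mono[OF s] by (simp add: u_def)
    also have "E V P u < E V P (u + 1)"
    proof (rule DERIV_pos_imp_increasing[where f = "E V P"])
      fix x assume "u \<le> x"
      then have "P x < 0" using Pneg by (simp add: u_def)
      then show "\<exists>y. (E V P has_real_derivative y) (at x) \<and> 0 < y"
        using dE[OF s, of x] b_pos[of "V x"] h_simps(6)[of "P x"]
        by (intro exI[of _ "b (V x) * (h (P x))\<^sup>2"]) auto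
    qed simp
    finally show ?thesis using Ele[of "u + 1"] by simp
  qed
  \<comment> \<open>As \<open>\<Phi>\<close> is nonnegative, the potential along the orbit stays
    strictly below \<open>F a\<close>. Both \<open>a\<close> and \<open>w\<close> have potential at
    least \<open>F a\<close>, so they act as barriers for all times.\<close>
  then have ne: "F (V t) < F a" for t using \<Phi>_nonneg[of "P t"] by (simp add: E_def) (smt (verit) Eless E_def)
  have Vgt: "a < V t" for t
  proof (rule ccontr)
    assume n: "\<not> a < V t"
    then have "t < 0" using Va[of t] by force
    then obtain x where "V x = a" using IVT'[of V t a 0] n contV V0 v0 by force
    then show False using ne[of x] by simp
  qed
  have Vlt: "V t < w" for t
  proof (rule ccontr)
    assume n: "\<not> V t < w"
    then have "\<exists>x. V x = w"
    proof (cases "t \<ge> 0")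
      case True
      then show ?thesis using dec[of 0 t] V0 v0 mw n by auto
    next
      case False
      then show ?thesis using IVT2'[of V 0 w t] n contV V0 v0 mw by force
    qed
    then obtain x where "V x = w" by blast
    then show False using ne[of x] Fw by simp
  qed
  \<comment> \<open>The kinetic part is less than F a - F m < M^2 / 2, so the truncation is inactive
    along the whole orbit.\<close>
  have PM: "\<bar>P t\<bar> < M" for t
  proof -
    have "\<Phi> (P t) < M\<^sup>2 / 2" using Eless[of t] F_min[of "V t"] Vgt[of t] FM by (simp add: E_def)
    then show ?thesis using \<Phi>_small[of M "P t"] M by simp
  qed
  then have hP: "h (P t) = P t" for t by (simp add: h_simps(1) less_imp_le)
  define K where "K = B * M + (B * M + B * B)"
  have K: "\<bar>X (V t) (P t)\<bar> \<le> K" "\<bar>Y (V t) (P t)\<bar> \<le> K" for t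
  proof -
    have p: "\<bar>r (V t)\<bar> * \<bar>h (P t)\<bar> \<le> B * M" "\<bar>b (V t)\<bar> * \<bar>h (P t)\<bar> \<le> B * M" "\<bar>r (V t)\<bar> * \<bar>f (V t)\<bar> \<le> B * B"
      using bounds h_simps(2) B_nonneg by (auto intro!: mult_mono)
    have q: "0 \<le> B * M" "0 \<le> B * B" using B_nonneg M by auto
    show "\<bar>X (V t) (P t)\<bar> \<le> K" using p q unfolding X_def K_def abs_mult by linarith
    show "\<bar>Y (V t) (P t)\<bar> \<le> K" using p q abs_triangle_ineq4[of "b (V t) * h (P t)" "r (V t) * f (V t)"]
      unfolding Y_def K_def abs_mult by linarith
  qed
  have lip: "\<bar>V t - V u\<bar> \<le> K * \<bar>t - u\<bar>" "\<bar>P t - P u\<bar> \<le> K * \<bar>t - u\<bar>" for t u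
    using field_differentiable_bound[of UNIV V "\<lambda>t. X (V t) (P t)" K t u]
      field_differentiable_bound[of UNIV P "\<lambda>t. Y (V t) (P t)" K t u] solD(1,2)[OF s] K
    by auto
  \<comment> \<open>The energy decreases to a finite limit as t tends to -infinity; Barbalat then
    forces its rate b P^2, and with it P, to 0.\<close>
  define e where "e = Inf (range (E V P))"
  have Ebdd: "bdd_below (range (E V P))"
  proof (rule bdd_belowI2)
    fix t show "F m \<le> E V P t" using \<Phi>_nonneg[of "P t"] F_min[of "V t"] Vgt[of t] by (simp add: E_def)
  qed
  have "(E V P \<longlongrightarrow> e) at_bot"
  proof (rule decreasing_tendsto)
    show "eventually (\<lambda>t. e \<le> E V P t) at_bot"
      unfolding e_def by (intro always_eventually allI cInf_lower Ebdd) auto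
    fix x assume "e < x"
    then obtain u where "E V P u < x" using cInf_lessD[of "range (E V P)" x] unfolding e_def by auto
    then show "eventually (\<lambda>t. E V P t < x) at_bot"
      using E_mono[OF s] by (auto simp: eventually_at_bot_linorder intro: le_less_trans)
  qed
  moreover have "\<bar>b (V t) * (h (P t))\<^sup>2 - b (V u) * (h (P u))\<^sup>2\<bar>
      \<le> (L * K * (M * M) + B * (K * M + M * K)) * \<bar>t - u\<bar>" for t u
  proof -
    have 1: "\<bar>b (V t) - b (V u)\<bar> \<le> L * (K * \<bar>t - u\<bar>)"
      using lips(3)[of "V t" "V u"] mult_left_mono[OF lip(1)[of t u] L] by linarith
    have 2: "\<bar>h (P t) * h (P t) - h (P u) * h (P u)\<bar> \<le> K * \<bar>t - u\<bar> * M + M * (K * \<bar>t - u\<bar>)"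
      unfolding hP using PM lip(2) by (intro abs_mult_diff_le) (auto simp: less_imp_le)
    have 3: "\<bar>h (P t) * h (P t)\<bar> \<le> M * M"
      unfolding abs_mult using h_simps(2) M by (intro mult_mono) auto
    show ?thesis using abs_mult_diff_le[OF 1 2 3 bounds(3)[of "V u"]]
      by (simp add: power2_eq_square algebra_simps)
  qed
  ultimately have "((\<lambda>t. b (V t) * (h (P t))\<^sup>2) \<longlongrightarrow> 0) at_bot"
    using dE[OF s] by (intro barbalat_at_bot[where x = "E V P"])
  then have Elim0: "((\<lambda>t. b (V t) * (P t)\<^sup>2) \<longlongrightarrow> 0) at_bot" by (simp add: hP)
  obtain v2 where v2: "v2 \<in> {a..w}" "\<And>v. v \<in> {a..w} \<Longrightarrow> b v2 \<le> b v"
    using continuous_attains_inf[of "{a..w}" b] cont am mw by auto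
  have Pbot: "(P \<longlongrightarrow> 0) at_bot"
  proof -
    have "((\<lambda>t. (P t)\<^sup>2) \<longlongrightarrow> 0) at_bot"
    proof (rule tendsto_0_le[OF Elim0, where K = "1 / b v2"])
      have "norm ((P t)\<^sup>2) \<le> norm (b (V t) * (P t)\<^sup>2) * (1 / b v2)" for t
        using v2(2)[of "V t"] Vgt[of t] Vlt[of t] b_pos[of v2] b_pos[of "V t"]
        by (simp add: abs_mult field_simps mult_right_mono)
      then show "eventually (\<lambda>t. norm ((P t)\<^sup>2) \<le> norm (b (V t) * (P t)\<^sup>2) * (1 / b v2)) at_bot"
        by simp
    qed
    then have "((\<lambda>t. sqrt ((P t)\<^sup>2)) \<longlongrightarrow> sqrt 0) at_bot" by (rule tendsto_real_sqrt)
    then show ?thesis by (simp add: tendsto_rabs_zero_iff)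
  qed
  \<comment> \<open>Second use of Barbalat: P tends to 0, hence so does P', which leaves r f to
    vanish in the limit.\<close>
  have "((\<lambda>t. Y (V t) (P t)) \<longlongrightarrow> 0) at_bot"
  proof (rule barbalat_at_bot[OF solD(2)[OF s] _ Pbot])
    fix t u
    have "\<bar>Y (V t) (P t) - Y (V u) (P u)\<bar> \<le> L' * (K * \<bar>t - u\<bar> + K * \<bar>t - u\<bar>)"
      using Y_lip[of "V t" "P t" "V u" "P u"] lip[of t u] L'_nonneg
      by (smt (verit) mult_left_mono)
    then show "\<bar>Y (V t) (P t) - Y (V u) (P u)\<bar> \<le> (L' * (2 * K)) * \<bar>t - u\<bar>" by (simp add: algebra_simps)
  qed
  moreover have "((\<lambda>t. b (V t) * P t) \<longlongrightarrow> 0) at_bot"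
  proof (rule tendsto_0_le[OF Pbot, where K = B])
    have "norm (b (V t) * P t) \<le> norm (P t) * B" for t
      using mult_left_mono[OF bounds(3)[of "V t"], of "\<bar>P t\<bar>"] by (simp add: abs_mult mult.commute)
    then show "eventually (\<lambda>t. norm (b (V t) * P t) \<le> norm (P t) * B) at_bot" by simp
  qed
  ultimately have "((\<lambda>t. b (V t) * P t - Y (V t) (P t)) \<longlongrightarrow> 0 - 0) at_bot"
    by (intro tendsto_diff)
  then have rf: "((\<lambda>t. r (V t) * f (V t)) \<longlongrightarrow> 0) at_bot" by (simp add: Y_def hP)
  have Vm: "(V \<longlongrightarrow> m) at_bot"
  proof (rule tendstoI)
    fix \<epsilon> :: real assume "\<epsilon> > 0"
    \<comment> \<open>The positions allowed at nonpositive times but away from \<open>m\<close>. The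
      energy level at time 0 excludes \<open>a\<close>, so \<open>f\<close> has no zero on this
      compact set and r f is bounded away from 0 there.\<close>
    define S where "S = {a..w} \<inter> F -` {..E V P 0} - ball m \<epsilon>"
    have "closed S" unfolding S_def
      using continuous_closed_preimage[OF contF, of "{a..w}" "{..E V P 0}"] by auto
    then have S: "compact S" by (auto simp: compact_eq_bounded_closed S_def intro: bounded_subset[of "{a..w}"])
    have inS: "V t \<in> S" if "t \<le> 0" "\<not> dist (V t) m < \<epsilon>" for t
      using that E_mono[OF s, of t 0] \<Phi>_nonneg[of "P t"] Vgt[of t] Vlt[of t]
      by (auto simp: S_def E_def dist_commute)
    have rfne: "\<bar>r v * f v\<bar> > 0" if "v \<in> S" for v
    proof -
      have "v \<noteq> a" using that Eless[of 0] by (auto simp: S_def)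
      moreover have "v \<noteq> m" using that \<open>\<epsilon> > 0\<close> by (auto simp: S_def)
      ultimately have "f v \<noteq> 0" using f_neg[of v] f_pos[of v] that
        by (auto simp: S_def) (smt (verit))
      then show ?thesis using r_pos[of v] by simp
    qed
    show "eventually (\<lambda>t. dist (V t) m < \<epsilon>) at_bot"
    proof (cases "S = {}")
      case True
      then show ?thesis using inS by (auto simp: eventually_at_bot_linorder)
    next
      case False
      obtain x where x: "x \<in> S" "\<And>y. y \<in> S \<Longrightarrow> \<bar>r x * f x\<bar> \<le> \<bar>r y * f y\<bar>"
      proof -
        have "continuous_on S (\<lambda>v. \<bar>r v * f v\<bar>)" using cont by (intro continuous_intros)
        from continuous_attains_inf[OF S False this] that show thesis by blast
      qed
      have "eventually (\<lambda>t. \<bar>r (V t) * f (V t)\<bar> < \<bar>r x * f x\<bar>) at_bot"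
        using tendstoD[OF rf rfne[OF x(1)]] by simp
      then show ?thesis using eventually_le_at_bot[of 0]
      proof eventually_elim
        case (elim t)
        then show ?case using inS[of t] x(2)[of "V t"] by force
      qed
    qed
  qed
  show ?thesis
  proof (rule that[of V P])
    show "(V has_real_derivative r (V t) * P t) (at t)"
      "(P has_real_derivative b (V t) * P t - r (V t) * f (V t)) (at t)" for t
      using solD(1,2)[OF s, of t] by (simp_all add: X_def Y_def hP)
  qed (use Vgt Vlt Vm Vl l in auto)
qed

end

subsection \<open>Spiralling into a focus\<close>

text \<open>The constant \<open>k\<close> is the determinant over the trace of the matrix of the
  form, a lower bound for its smaller eigenvalue. Completing the square after subtracting k (x^2 +
  y^2) leaves the discriminant k^2.\<close>

lemma definite_quadratic_form:
  fixes \<alpha> \<beta> :: real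
  assumes "\<beta>\<^sup>2 < 4 * \<alpha>"
  obtains k where "k > 0" "\<And>x y. \<alpha> * x\<^sup>2 - \<beta> * x * y + y\<^sup>2 \<ge> k * (x\<^sup>2 + y\<^sup>2)"
proof -
  have \<alpha>: "\<alpha> > 0" using assms zero_le_power2[of \<beta>] by linarith
  define k where "k = (\<alpha> - \<beta>\<^sup>2 / 4) / (1 + \<alpha>)"
  have k: "k > 0" "k < 1" using assms \<alpha> by (auto simp: k_def divide_simps) (smt (verit) zero_le_power2)
  have "k * (1 + \<alpha>) = \<alpha> - \<beta>\<^sup>2 / 4" using \<alpha> by (simp add: k_def)
  then have disc: "(\<alpha> - k) * (1 - k) - \<beta>\<^sup>2 / 4 = k\<^sup>2" by (simp add: algebra_simps power2_eq_square)
  have "\<alpha> * x\<^sup>2 - \<beta> * x * y + y\<^sup>2 \<ge> k * (x\<^sup>2 + y\<^sup>2)" for x y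
  proof -
    have "(1 - k) * (\<alpha> * x\<^sup>2 - \<beta> * x * y + y\<^sup>2 - k * (x\<^sup>2 + y\<^sup>2))
      = ((1 - k) * y - \<beta> * x / 2)\<^sup>2 + ((\<alpha> - k) * (1 - k) - \<beta>\<^sup>2 / 4) * x\<^sup>2"
      by (simp add: power2_eq_square field_simps)
    also have "\<dots> \<ge> 0" unfolding disc by simp
    finally have "\<alpha> * x\<^sup>2 - \<beta> * x * y + y\<^sup>2 - k * (x\<^sup>2 + y\<^sup>2) \<ge> 0"
      using k by (simp add: zero_le_mult_iff)
    then show ?thesis by simp
  qed
  then show ?thesis using that k by blast
qed

text \<open>A complex logarithm along the curve w = x + i y: if G' = w' / w, then w exp (- G) is
  constant, so w = exp (c + G). The angle is the imaginary part of the exponent, with derivative Im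
  (w' / w).\<close>

lemma polar_lift:
  fixes x y x' y' :: "real \<Rightarrow> real"
  assumes dx: "\<And>t. (x has_real_derivative x' t) (at t)" and dy: "\<And>t. (y has_real_derivative y' t) (at t)"
    and cont: "continuous_on UNIV x'" "continuous_on UNIV y'"
    and ne: "\<And>t. x t \<noteq> 0 \<or> y t \<noteq> 0"
  obtains \<theta> where
    "\<And>t. x t = sqrt ((x t)\<^sup>2 + (y t)\<^sup>2) * cos (\<theta> t)" "\<And>t. y t = sqrt ((x t)\<^sup>2 + (y t)\<^sup>2) * sin (\<theta> t)"
    "\<And>t. (\<theta> has_real_derivative (x t * y' t - y t * x' t) / ((x t)\<^sup>2 + (y t)\<^sup>2)) (at t)"
proof -
  define w where "w t = Complex (x t) (y t)" for t
  define w' where "w' t = Complex (x' t) (y' t)" for t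
  have w0: "w t \<noteq> 0" for t using ne[of t] by (auto simp: w_def complex_eq_iff)
  have dw: "(w has_vector_derivative w' t) (at t)" for t
    using dx[of t] dy[of t] unfolding w_def w'_def
    by (simp add: has_vector_derivative_complex_iff has_real_derivative_iff_has_vector_derivative)
  have "continuous_on UNIV x" "continuous_on UNIV y"
    by (intro continuous_at_imp_continuous_on ballI DERIV_isCont[OF dx] DERIV_isCont[OF dy])+
  then have contw: "continuous_on UNIV w" "continuous_on UNIV w'"
    unfolding w_def w'_def Complex_eq using cont by (auto intro!: continuous_intros)
  have "continuous_on UNIV (\<lambda>t. w' t / w t)" using contw w0 by (intro continuous_intros) auto
  then have "\<exists>G. \<forall>t::real. -\<infinity> < t \<longrightarrow> t < \<infinity> \<longrightarrow> (G has_vector_derivative w' t / w t) (at t)"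
    by (intro einterval_antiderivative) (auto simp: continuous_on_eq_continuous_at)
  then obtain G where G: "\<And>t. (G has_vector_derivative w' t / w t) (at t)" by auto
  have "((\<lambda>t. w t * exp (- G t)) has_vector_derivative 0) (at t within UNIV)" for t
  proof -
    have "((\<lambda>t. exp (- G t)) has_vector_derivative - (w' t / w t) * exp (- G t)) (at t)"
      using field_vector_diff_chain_at[of "\<lambda>t. - G t" "- (w' t / w t)" t exp "exp (- G t)"] G[of t]
      by (auto simp: o_def DERIV_exp intro!: derivative_intros)
    from has_vector_derivative_mult[OF dw[of t] this] show ?thesis using w0[of t] by simp
  qed
  then obtain C where C: "\<And>t. w t * exp (- G t) = C"
    using has_vector_derivative_zero_constant[of UNIV "\<lambda>t. w t * exp (- G t)"] by auto
  then have "C \<noteq> 0" using w0 by (metis exp_not_eq_zero mult_eq_0_iff)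
  then obtain c where c: "exp c = C" by (metis exp_Ln)
  have w: "w t = exp (c + G t)" for t
    using C[of t] c by (simp add: exp_add exp_minus field_simps)
  define \<theta> where "\<theta> t = Im (c + G t)" for t
  have n: "sqrt ((x t)\<^sup>2 + (y t)\<^sup>2) = exp (Re (c + G t))" for t
    using norm_exp_eq_Re[of "c + G t"] unfolding w[symmetric] by (simp add: w_def cmod_def)
  show ?thesis
  proof (rule that[of \<theta>])
    fix t
    show "x t = sqrt ((x t)\<^sup>2 + (y t)\<^sup>2) * cos (\<theta> t)"
      using w[of t] unfolding n by (simp add: w_def complex_eq_iff Re_exp \<theta>_def)
    show "y t = sqrt ((x t)\<^sup>2 + (y t)\<^sup>2) * sin (\<theta> t)"
      using w[of t] unfolding n by (simp add: w_def complex_eq_iff Im_exp \<theta>_def)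
    have "(\<theta> has_real_derivative Im (w' t / w t)) (at t)"
      using G[of t] unfolding \<theta>_def has_real_derivative_iff_has_vector_derivative
      by (auto simp: has_vector_derivative_complex_iff has_real_derivative_iff_has_vector_derivative
          intro!: derivative_eq_intros)
    also have "Im (w' t / w t) = (x t * y' t - y t * x' t) / ((x t)\<^sup>2 + (y t)\<^sup>2)"
      by (simp add: w_def w'_def Im_divide algebra_simps)
    finally show "(\<theta> has_real_derivative (x t * y' t - y t * x' t) / ((x t)\<^sup>2 + (y t)\<^sup>2)) (at t)" .
  qed
qed

text \<open>The angular velocity \<open>(x y' - y x') / (x\<^sup>2 + y\<^sup>2)\<close> is asymptotically minus a positive
  definite quadratic form on the unit circle.\<close>

lemma focus_spiral:
  fixes x y y' :: "real \<Rightarrow> real"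
  assumes dx: "\<And>t. (x has_real_derivative y t) (at t)" and dy: "\<And>t. (y has_real_derivative y' t) (at t)"
    and cont: "continuous_on UNIV y'" and ne: "\<And>t. x t \<noteq> 0 \<or> y t \<noteq> 0"
    and disc: "\<beta>\<^sup>2 < 4 * \<alpha>"
    and lin: "\<And>e. e > 0 \<Longrightarrow>
      eventually (\<lambda>t. \<bar>y' t - (\<beta> * y t - \<alpha> * x t)\<bar> \<le> e * sqrt ((x t)\<^sup>2 + (y t)\<^sup>2)) at_bot"
  obtains \<theta> where "continuous_on UNIV \<theta>"
    "\<And>t. x t = sqrt ((x t)\<^sup>2 + (y t)\<^sup>2) * cos (\<theta> t)" "\<And>t. y t = sqrt ((x t)\<^sup>2 + (y t)\<^sup>2) * sin (\<theta> t)"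
    "filterlim \<theta> at_top at_bot"
proof -
  have conty: "continuous_on UNIV y"
    using dy by (auto intro!: continuous_at_imp_continuous_on DERIV_isCont)
  obtain \<theta> where \<theta>: "\<And>t. x t = sqrt ((x t)\<^sup>2 + (y t)\<^sup>2) * cos (\<theta> t)"
    "\<And>t. y t = sqrt ((x t)\<^sup>2 + (y t)\<^sup>2) * sin (\<theta> t)"
    and d\<theta>: "\<And>t. (\<theta> has_real_derivative (x t * y' t - y t * y t) / ((x t)\<^sup>2 + (y t)\<^sup>2)) (at t)"
    using polar_lift[OF dx dy conty cont ne] by blast
  obtain k where k: "k > 0" "\<And>x y. \<alpha> * x\<^sup>2 - \<beta> * x * y + y\<^sup>2 \<ge> k * (x\<^sup>2 + y\<^sup>2)"
    using definite_quadratic_form[OF disc] by blast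
  obtain t0 where t0: "\<And>t. t \<le> t0 \<Longrightarrow>
      \<bar>y' t - (\<beta> * y t - \<alpha> * x t)\<bar> \<le> k / 2 * sqrt ((x t)\<^sup>2 + (y t)\<^sup>2)"
    using lin[of "k / 2"] k(1) by (auto simp: eventually_at_bot_linorder)
  \<comment> \<open>Half of the coercivity constant \<open>k\<close> absorbs the nonlinear
    remainder; the other half is the guaranteed angular speed.\<close>
  have rate: "(x t * y' t - y t * y t) / ((x t)\<^sup>2 + (y t)\<^sup>2) \<le> - (k / 2)" if "t \<le> t0" for t
  proof -
    let ?N = "(x t)\<^sup>2 + (y t)\<^sup>2"
    have N: "?N > 0" using ne[of t] by (auto simp: sum_power2_gt_zero_iff)
    have "x t * (y' t - (\<beta> * y t - \<alpha> * x t)) \<le> \<bar>x t\<bar> * \<bar>y' t - (\<beta> * y t - \<alpha> * x t)\<bar>"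
      by (metis abs_ge_self abs_mult)
    also have "\<dots> \<le> sqrt ?N * (k / 2 * sqrt ?N)"
      using t0[OF that] k(1) by (intro mult_mono) (auto simp: real_sqrt_sum_squares_ge1 real_le_rsqrt)
    also have "\<dots> = k / 2 * ?N" by simp
    finally have "x t * y' t - y t * y t \<le> - (k / 2) * ?N"
      using k(2)[of "x t" "y t"] by (simp add: power2_eq_square algebra_simps)
    then show ?thesis using N by (simp add: divide_le_eq)
  qed
  have grow: "\<theta> t \<ge> \<theta> t0 + k / 2 * (t0 - t)" if "t \<le> t0" for t
  proof -
    have "\<theta> t0 + k / 2 * t0 \<le> \<theta> t + k / 2 * t"
    proof (rule DERIV_nonpos_imp_nonincreasing[OF that, of "\<lambda>t. \<theta> t + k / 2 * t"])
      fix s assume "s \<le> t0"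
      then show "\<exists>y. ((\<lambda>t. \<theta> t + k / 2 * t) has_real_derivative y) (at s) \<and> y \<le> 0"
        using d\<theta>[of s] rate[of s]
        by (intro exI[of _ "(x s * y' s - y s * y s) / ((x s)\<^sup>2 + (y s)\<^sup>2) + k / 2"])
          (auto intro!: derivative_eq_intros)
    qed
    then show ?thesis by (simp add: algebra_simps diff_divide_distrib)
  qed
  have "filterlim \<theta> at_top at_bot"
  proof (rule filterlim_at_top_mono)
    show "filterlim (\<lambda>t. \<theta> t0 + k / 2 * (t0 - t)) at_top at_bot"
    proof (rule filterlim_tendsto_add_at_top[OF tendsto_const])
      have "filterlim (\<lambda>t. t0 + - t) at_top at_bot"
        by (intro filterlim_tendsto_add_at_top[OF tendsto_const] filterlim_uminus_at_top_at_bot)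
      then show "filterlim (\<lambda>t. k / 2 * (t0 - t)) at_top at_bot"
        using k(1) by (intro filterlim_tendsto_pos_mult_at_top[OF tendsto_const]) auto
    qed
    show "eventually (\<lambda>t. \<theta> t0 + k / 2 * (t0 - t) \<le> \<theta> t) at_bot"
      using grow by (auto simp: eventually_at_bot_linorder)
  qed
  moreover have "continuous_on UNIV \<theta>"
    using d\<theta> by (auto intro!: continuous_at_imp_continuous_on DERIV_isCont)
  ultimately show ?thesis using that \<theta> by blast
qed

section \<open>Vectors in the plane, companion matrices and uniform bounds\<close>

lemma vector_2_norm: "norm (vector [x, y] :: real^2) = sqrt (x\<^sup>2 + y\<^sup>2)"
  by (simp add: norm_vec_def L2_set_def UNIV_2)

lemma vector_2_axis: "(vector [x, y] :: real^2) = x *\<^sub>R axis 1 1 + y *\<^sub>R axis 2 1"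
  by (simp add: vec_eq_iff forall_2 axis_def)

lemma has_derivative_vector_2:
  fixes f g :: "'a::real_normed_vector \<Rightarrow> real"
  assumes "(f has_derivative f') F" "(g has_derivative g') F"
  shows "((\<lambda>x. vector [f x, g x] :: real^2) has_derivative (\<lambda>x. vector [f' x, g' x])) F"
  unfolding vector_2_axis using assms by (auto intro!: derivative_eq_intros)

text \<open>The first row forces every eigenvector to be a multiple of (1, l), so the eigenvalue
  condition is the characteristic equation l^2 - \<beta> l + \<alpha> = 0; \<open>disc\<close> makes
  its roots a non-real conjugate pair.\<close>

lemma complex_eigenvalues_companion:
  fixes A :: "real^2^2"
  assumes A: "A $ 1 $ 1 = 0" "A $ 1 $ 2 = 1" "A $ 2 $ 1 = - \<alpha>" "A $ 2 $ 2 = \<beta>"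
    and disc: "\<beta>\<^sup>2 < 4 * \<alpha>"
  shows "complex_eigenvalues A =
    {Complex (\<beta> / 2) (sqrt (4 * \<alpha> - \<beta>\<^sup>2) / 2), Complex (\<beta> / 2) (- (sqrt (4 * \<alpha> - \<beta>\<^sup>2) / 2))}"
proof -
  define \<omega> where "\<omega> = sqrt (4 * \<alpha> - \<beta>\<^sup>2) / 2"
  have \<omega>: "\<alpha> = (\<beta> / 2)\<^sup>2 + \<omega>\<^sup>2" using disc by (simp add: \<omega>_def power_divide diff_divide_distrib)
  have "l \<in> complex_eigenvalues A \<longleftrightarrow> l * l - of_real \<beta> * l + of_real \<alpha> = 0" for l :: complex
  proof
    assume "l \<in> complex_eigenvalues A"
    then obtain w :: "complex^2" where w: "w \<noteq> 0" "(\<chi> i j. complex_of_real (A $ i $ j)) *v w = l *s w"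
      by (auto simp: complex_eigenvalues_def)
    then have eq: "w $ 2 = l * w $ 1" "- \<alpha> * w $ 1 + \<beta> * w $ 2 = l * w $ 2"
      by (auto simp: vec_eq_iff forall_2 matrix_vector_mult_def sum_2 A)
    then have "w $ 1 \<noteq> 0" using w(1) by (auto simp: vec_eq_iff forall_2)
    moreover have "(l * l - of_real \<beta> * l + of_real \<alpha>) * w $ 1 = 0" using eq by (simp add: algebra_simps)
    ultimately show "l * l - of_real \<beta> * l + of_real \<alpha> = 0" by simp
  next
    assume l: "l * l - of_real \<beta> * l + of_real \<alpha> = 0"
    let ?w = "vector [1, l] :: complex^2"
    have "?w \<noteq> 0" by (simp add: vec_eq_iff forall_2)
    moreover have "(\<chi> i j. complex_of_real (A $ i $ j)) *v ?w = l *s ?w"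
      using l by (auto simp: vec_eq_iff forall_2 matrix_vector_mult_def sum_2 A algebra_simps)
    ultimately show "l \<in> complex_eigenvalues A" by (auto simp: complex_eigenvalues_def)
  qed
  moreover have "l * l - of_real \<beta> * l + of_real \<alpha> = (l - Complex (\<beta> / 2) \<omega>) * (l - Complex (\<beta> / 2) (- \<omega>))" for l :: complex
    by (simp add: complex_eq_iff \<omega> power2_eq_square field_simps)
  ultimately show ?thesis by (auto simp: \<omega>_def)
qed

lemma bounded_of_limits:
  fixes g :: "real \<Rightarrow> real"
  assumes cont: "continuous_on UNIV g" and lim: "(g \<longlongrightarrow> l) at_bot" "(g \<longlongrightarrow> l') at_top"
  obtains B where "\<And>t. \<bar>g t\<bar> \<le> B"
proof -
  obtain t0 where t0: "\<And>t. t \<le> t0 \<Longrightarrow> \<bar>g t - l\<bar> < 1"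
    using tendstoD[OF lim(1), of 1] by (auto simp: eventually_at_bot_linorder dist_real_def)
  obtain t1 where t1: "\<And>t. t \<ge> t1 \<Longrightarrow> \<bar>g t - l'\<bar> < 1"
    using tendstoD[OF lim(2), of 1] by (auto simp: eventually_at_top_linorder dist_real_def)
  have "bounded (g ` {t0..t1})"
    using cont by (intro compact_imp_bounded compact_continuous_image) (auto intro: continuous_on_subset)
  then obtain K where K: "\<And>t. t \<in> {t0..t1} \<Longrightarrow> \<bar>g t\<bar> \<le> K"
    unfolding bounded_iff by (metis imageI real_norm_def)
  have "\<bar>g t\<bar> \<le> max K (max (\<bar>l\<bar> + 1) (\<bar>l'\<bar> + 1))" for t
    using t0[of t] t1[of t] K[of t] by (cases "t \<le> t0"; cases "t \<ge> t1") auto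
  then show ?thesis using that by blast
qed

lemma C1_lipschitz_bounded:
  fixes g g' :: "real \<Rightarrow> real"
  assumes dg: "\<And>x. x \<in> {c..d} \<Longrightarrow> (g has_real_derivative g' x) (at x)" and "continuous_on {c..d} g'"
  obtains L where "L \<ge> 0" "\<And>x y. x \<in> {c..d} \<Longrightarrow> y \<in> {c..d} \<Longrightarrow> \<bar>g x - g y\<bar> \<le> L * \<bar>x - y\<bar>"
    "\<And>x. x \<in> {c..d} \<Longrightarrow> \<bar>g x\<bar> \<le> L"
proof -
  have "continuous_on {c..d} g"
    by (intro continuous_at_imp_continuous_on ballI DERIV_isCont[OF dg])
  then have "bounded (g ` {c..d})" "bounded (g' ` {c..d})"
    using assms(2) by (auto intro!: compact_imp_bounded compact_continuous_image)
  then obtain K1 K2 where K: "\<And>x. x \<in> {c..d} \<Longrightarrow> \<bar>g x\<bar> \<le> K1" "\<And>x. x \<in> {c..d} \<Longrightarrow> \<bar>g' x\<bar> \<le> K2"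
    unfolding bounded_iff by (metis imageI real_norm_def)
  define L where "L = max 0 (max K1 K2)"
  show ?thesis
  proof (rule that[of L])
    fix x y assume xy: "x \<in> {c..d}" "y \<in> {c..d}"
    have "norm (g x - g y) \<le> L * norm (x - y)"
    proof (rule field_differentiable_bound[of "{c..d}"])
      show "(g has_real_derivative g' z) (at z within {c..d})" if "z \<in> {c..d}" for z
        by (rule has_field_derivative_at_within[OF dg[OF that]])
      show "norm (g' z) \<le> L" if "z \<in> {c..d}" for z
        using K(2)[OF that] by (simp add: L_def)
    qed (use xy in auto)
    then show "\<bar>g x - g y\<bar> \<le> L * \<bar>x - y\<bar>" by simp
  next
    fix x assume "x \<in> {c..d}"
    then show "\<bar>g x\<bar> \<le> L" using K(1)[of x] by (simp add: L_def)
  qed (simp add: L_def)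
qed

subsection \<open>The profile equation of a compressive shock\<close>

text \<open>The shock conditions in the form used by the profile equation: velocities eliminated
  from the jump relations, and the Lax inequalities squared into f'(Vp) < 0 < f'(Vm) together with s
  < 0.\<close>

locale viscous_shock =
  fixes p \<mu> \<kappa> :: "real \<Rightarrow> real" and Vm Vp s :: real
  assumes smooth: "smooth_on {0<..} p" "smooth_on {0<..} \<mu>" "smooth_on {0<..} \<kappa>"
    and \<mu>_pos: "\<And>v. v > 0 \<Longrightarrow> \<mu> v > 0" and \<kappa>_pos: "\<And>v. v > 0 \<Longrightarrow> \<kappa> v > 0"
    and convex: "\<And>v. v > 0 \<Longrightarrow> deriv (deriv p) v > 0"
    and Vm_pos: "Vm > 0" and Vp_pos: "Vp > 0" and s_neg: "s < 0"
    and jump: "p Vp + s\<^sup>2 * Vp = p Vm + s\<^sup>2 * Vm"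
    and lax: "deriv p Vp + s\<^sup>2 < 0" "deriv p Vm + s\<^sup>2 > 0"
begin

definition f :: "real \<Rightarrow> real" where "f = reduced_flux p s Vm"
definition r :: "real \<Rightarrow> real" where "r v = 1 / sqrt (\<kappa> v)"
definition b :: "real \<Rightarrow> real" where "b v = - s * \<mu> v / (v * \<kappa> v)"

lemma smooth_deriv:
  assumes "v > 0"
  shows "(p has_real_derivative deriv p v) (at v)" "(deriv p has_real_derivative deriv (deriv p) v) (at v)"
    "(\<mu> has_real_derivative deriv \<mu> v) (at v)" "(deriv \<mu> has_real_derivative deriv (deriv \<mu>) v) (at v)"
    "(\<kappa> has_real_derivative deriv \<kappa> v) (at v)" "(deriv \<kappa> has_real_derivative deriv (deriv \<kappa>) v) (at v)"
  using smooth_on_DERIV[OF smooth(1), of v 0] smooth_on_DERIV[OF smooth(1), of v 1]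
    smooth_on_DERIV[OF smooth(2), of v 0] smooth_on_DERIV[OF smooth(2), of v 1]
    smooth_on_DERIV[OF smooth(3), of v 0] smooth_on_DERIV[OF smooth(3), of v 1] assms
  by simp_all

lemma df: "v > 0 \<Longrightarrow> (f has_real_derivative deriv p v + s\<^sup>2) (at v)"
  unfolding f_def reduced_flux_def[abs_def]
  by (auto intro!: derivative_eq_intros smooth_deriv)

lemma r_pos: "v > 0 \<Longrightarrow> r v > 0"
  using \<kappa>_pos by (simp add: r_def)

lemma b_pos: "v > 0 \<Longrightarrow> b v > 0"
  unfolding b_def using \<kappa>_pos[of v] \<mu>_pos[of v] s_neg by (intro divide_pos_pos mult_pos_pos) auto

lemma r_sq: "v > 0 \<Longrightarrow> r v * r v = 1 / \<kappa> v"
  using \<kappa>_pos[of v] by (simp add: r_def)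

lemma dr:
  assumes "v > 0"
  shows "(r has_real_derivative - deriv \<kappa> v / (2 * \<kappa> v) * r v) (at v)"
proof -
  have "(r has_real_derivative - (deriv \<kappa> v * (inverse (sqrt (\<kappa> v)) / 2) / (sqrt (\<kappa> v) * sqrt (\<kappa> v)))) (at v)"
    using \<kappa>_pos[OF assms] smooth_deriv(5)[OF assms] unfolding r_def
    by (auto intro!: derivative_eq_intros)
  then show ?thesis using \<kappa>_pos[OF assms] by (simp add: r_def field_simps)
qed

lemma db:
  assumes "v > 0"
  shows "(b has_real_derivative - s * ((deriv \<mu> v * (v * \<kappa> v) - \<mu> v * (\<kappa> v + v * deriv \<kappa> v)) /
    ((v * \<kappa> v) * (v * \<kappa> v)))) (at v)"
  unfolding b_def using \<kappa>_pos[OF assms] assms smooth_deriv(3,5)[OF assms]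
  by (auto intro!: derivative_eq_intros simp: field_simps)

lemma cont_coeff:
  assumes "S \<subseteq> {0<..}"
  shows "continuous_on S (deriv p)" "continuous_on S \<mu>" "continuous_on S (deriv \<mu>)"
    "continuous_on S \<kappa>" "continuous_on S (deriv \<kappa>)" "continuous_on S r" "continuous_on S f"
    "continuous_on S b"
proof -
  have *: "continuous_on S g" if "\<And>v. v > 0 \<Longrightarrow> (g has_real_derivative g' v) (at v)" for g g'
    using assms by (intro continuous_at_imp_continuous_on ballI DERIV_isCont[OF that]) auto
  show "continuous_on S (deriv p)" "continuous_on S \<mu>" "continuous_on S (deriv \<mu>)"
    "continuous_on S \<kappa>" "continuous_on S (deriv \<kappa>)" "continuous_on S r" "continuous_on S f"
    "continuous_on S b"
    by (rule *[OF smooth_deriv(2)] *[OF smooth_deriv(3)] *[OF smooth_deriv(4)] *[OF smooth_deriv(5)]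
        *[OF smooth_deriv(6)] *[OF dr] *[OF df] *[OF db]; assumption)+
qed

text \<open>On compact intervals of positive states the coefficients are C^1. A single constant
  serves as Lipschitz constant and as bound, so it can fill both parameters \<open>B\<close> and
  \<open>L\<close> of \<open>cutoff_system\<close>.\<close>

lemma coeff_lipschitz:
  assumes "0 < c"
  obtains L where "L \<ge> 0"
    "\<And>x y. x \<in> {c..d} \<Longrightarrow> y \<in> {c..d} \<Longrightarrow> \<bar>r x - r y\<bar> \<le> L * \<bar>x - y\<bar>"
    "\<And>x y. x \<in> {c..d} \<Longrightarrow> y \<in> {c..d} \<Longrightarrow> \<bar>f x - f y\<bar> \<le> L * \<bar>x - y\<bar>"
    "\<And>x y. x \<in> {c..d} \<Longrightarrow> y \<in> {c..d} \<Longrightarrow> \<bar>b x - b y\<bar> \<le> L * \<bar>x - y\<bar>"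
    "\<And>x. x \<in> {c..d} \<Longrightarrow> \<bar>r x\<bar> \<le> L" "\<And>x. x \<in> {c..d} \<Longrightarrow> \<bar>f x\<bar> \<le> L" "\<And>x. x \<in> {c..d} \<Longrightarrow> \<bar>b x\<bar> \<le> L"
proof -
  have pos: "x > 0" if "x \<in> {c..d}" for x using assms that by auto
  have sub: "{c..d} \<subseteq> {0<..}" using assms by auto
  have nz: "\<kappa> x \<noteq> 0" "x * \<kappa> x \<noteq> 0" if "x \<in> {c..d}" for x using \<kappa>_pos[of x] assms that by auto
  have "continuous_on {c..d} (\<lambda>v. - deriv \<kappa> v / (2 * \<kappa> v) * r v)"
    using cont_coeff[OF sub] nz by (intro continuous_intros) auto
  from C1_lipschitz_bounded[OF dr this] pos obtain L1 where L1: "L1 \<ge> 0"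
    "\<And>x y. x \<in> {c..d} \<Longrightarrow> y \<in> {c..d} \<Longrightarrow> \<bar>r x - r y\<bar> \<le> L1 * \<bar>x - y\<bar>"
    "\<And>x. x \<in> {c..d} \<Longrightarrow> \<bar>r x\<bar> \<le> L1" by blast
  have "continuous_on {c..d} (\<lambda>v. deriv p v + s\<^sup>2)"
    using cont_coeff[OF sub] by (intro continuous_intros)
  from C1_lipschitz_bounded[OF df this] pos obtain L2 where L2: "L2 \<ge> 0"
    "\<And>x y. x \<in> {c..d} \<Longrightarrow> y \<in> {c..d} \<Longrightarrow> \<bar>f x - f y\<bar> \<le> L2 * \<bar>x - y\<bar>"
    "\<And>x. x \<in> {c..d} \<Longrightarrow> \<bar>f x\<bar> \<le> L2" by blast
  have "continuous_on {c..d} (\<lambda>v. - s * ((deriv \<mu> v * (v * \<kappa> v) - \<mu> v * (\<kappa> v + v * deriv \<kappa> v)) /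
    ((v * \<kappa> v) * (v * \<kappa> v))))"
    using cont_coeff[OF sub] nz by (intro continuous_intros) auto
  from C1_lipschitz_bounded[OF db this] pos obtain L3 where L3: "L3 \<ge> 0"
    "\<And>x y. x \<in> {c..d} \<Longrightarrow> y \<in> {c..d} \<Longrightarrow> \<bar>b x - b y\<bar> \<le> L3 * \<bar>x - y\<bar>"
    "\<And>x. x \<in> {c..d} \<Longrightarrow> \<bar>b x\<bar> \<le> L3" by blast
  have le: "L1 * \<bar>u\<bar> \<le> (L1 + L2 + L3) * \<bar>u\<bar>" "L2 * \<bar>u\<bar> \<le> (L1 + L2 + L3) * \<bar>u\<bar>"
    "L3 * \<bar>u\<bar> \<le> (L1 + L2 + L3) * \<bar>u\<bar>" for u :: real
    using L1(1) L2(1) L3(1) by (auto intro!: mult_right_mono)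
  show ?thesis
  proof (rule that[of "L1 + L2 + L3"])
    fix x y assume xy: "x \<in> {c..d}" "y \<in> {c..d}"
    show "\<bar>r x - r y\<bar> \<le> (L1 + L2 + L3) * \<bar>x - y\<bar>"
      by (rule order_trans[OF L1(2)[OF xy] le(1)])
    show "\<bar>f x - f y\<bar> \<le> (L1 + L2 + L3) * \<bar>x - y\<bar>"
      by (rule order_trans[OF L2(2)[OF xy] le(2)])
    show "\<bar>b x - b y\<bar> \<le> (L1 + L2 + L3) * \<bar>x - y\<bar>"
      by (rule order_trans[OF L3(2)[OF xy] le(3)])
  next
    fix x assume "x \<in> {c..d}"
    then show "\<bar>r x\<bar> \<le> L1 + L2 + L3" "\<bar>f x\<bar> \<le> L1 + L2 + L3" "\<bar>b x\<bar> \<le> L1 + L2 + L3"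
      using L1(1) L2(1) L3(1) L1(3)[of x] L2(3)[of x] L3(3)[of x] by linarith+
  qed (use L1(1) L2(1) L3(1) in simp)
qed

section \<open>Convexity of the flux and the potential well\<close>

lemma f_zero: "f Vp = 0" "f Vm = 0"
  using jump by (simp_all add: f_def reduced_flux_def)

lemma dp_less:
  assumes "0 < u" "u < v"
  shows "deriv p u < deriv p v"
proof (rule DERIV_pos_imp_increasing[OF assms(2)])
  show "\<exists>y. (deriv p has_real_derivative y) (at x) \<and> 0 < y" if "u \<le> x" for x
    using smooth_deriv(2)[of x] convex[of x] assms that by (intro exI[of _ "deriv (deriv p) x"]) auto
qed

lemma Vp_less_Vm: "Vp < Vm"
  using dp_less[of Vm Vp] lax Vm_pos by (cases Vp Vm rule: linorder_cases) auto

text \<open>Strict convexity between two zeros: if f v \<ge> 0, the mean value theorem gives a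
  nonnegative slope left of v and a nonpositive one right of v, although the slope strictly
  increases.\<close>

lemma f_neg:
  assumes "Vp < v" "v < Vm"
  shows "f v < 0"
proof (rule ccontr)
  assume n: "\<not> f v < 0"
  obtain x where x: "Vp < x" "x < v" "f v - f Vp = (v - Vp) * (deriv p x + s\<^sup>2)"
    using MVT2[of Vp v f "\<lambda>x. deriv p x + s\<^sup>2"] df assms Vp_pos by force
  obtain y where y: "v < y" "y < Vm" "f Vm - f v = (Vm - v) * (deriv p y + s\<^sup>2)"
    using MVT2[of v Vm f "\<lambda>x. deriv p x + s\<^sup>2"] df assms Vp_pos by force
  have "deriv p x + s\<^sup>2 \<ge> 0"
    using x n f_zero assms by (smt (verit) mult_pos_neg)
  moreover have "deriv p y + s\<^sup>2 \<le> 0"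
    using y n f_zero assms by (smt (verit) mult_pos_pos)
  ultimately show False using dp_less[of x y] x y Vp_pos by linarith
qed

text \<open>A convex graph lies above its tangent at \<open>Vm\<close>, whose slope is
  positive.\<close>

lemma f_lower:
  assumes "Vm < v"
  shows "f v \<ge> (v - Vm) * (deriv p Vm + s\<^sup>2)"
proof -
  obtain x where x: "Vm < x" "x < v" "f v - f Vm = (v - Vm) * (deriv p x + s\<^sup>2)"
    using MVT2[of Vm v f "\<lambda>x. deriv p x + s\<^sup>2"] df assms Vm_pos by force
  then show ?thesis using f_zero dp_less[of Vm x] Vm_pos by (simp add: mult_left_mono)
qed

lemma f_pos: "Vm < v \<Longrightarrow> f v > 0"
  using f_lower[of v] lax by (smt (verit) mult_pos_pos)

definition F :: "real \<Rightarrow> real" where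
  "F = (SOME F. \<forall>v>0. (F has_real_derivative f v) (at v))"

lemma dF: "v > 0 \<Longrightarrow> (F has_real_derivative f v) (at v)"
proof -
  have "\<exists>F. \<forall>x::real. 0 < ereal x \<longrightarrow> ereal x < \<infinity> \<longrightarrow> (F has_vector_derivative f x) (at x)"
    using DERIV_isCont[OF df] by (intro einterval_antiderivative) (auto simp: zero_ereal_def)
  then have "\<exists>F. \<forall>v>0. (F has_real_derivative f v) (at v)"
    by (simp add: has_real_derivative_iff_has_vector_derivative zero_ereal_def)
  then have "\<forall>v>0. (F has_real_derivative f v) (at v)" unfolding F_def by (rule someI_ex)
  then show "v > 0 \<Longrightarrow> (F has_real_derivative f v) (at v)" by blast
qed

text \<open>Beyond Vm + 1 the force \<open>f\<close> is at least k = f'(Vm), so the potential grows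
  at least linearly; \<open>w\<close> leaves enough length to make up the difference to
  \<open>K\<close>. This closes the well on the right.\<close>

lemma F_unbounded: "\<exists>w>Vm. F w \<ge> K"
proof -
  define k where "k = deriv p Vm + s\<^sup>2"
  define w where "w = Vm + 2 + \<bar>K - F (Vm + 1)\<bar> / k"
  have k: "k > 0" using lax by (simp add: k_def)
  have w: "Vm + 1 < w" using k by (simp add: w_def add_pos_nonneg)
  obtain x where x: "Vm + 1 < x" "x < w" "F w - F (Vm + 1) = (w - (Vm + 1)) * f x"
    using MVT2[OF w, of F f] dF Vm_pos by force
  have "k \<le> (x - Vm) * k" using x k by simp
  also have "\<dots> \<le> f x" using f_lower[of x] x by (simp add: k_def)
  finally have "(w - (Vm + 1)) * k \<le> (w - (Vm + 1)) * f x" using w by (intro mult_left_mono) auto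
  moreover have "(w - (Vm + 1)) * k = k + \<bar>K - F (Vm + 1)\<bar>" using k by (simp add: w_def field_simps)
  ultimately have "F w \<ge> K" using x k by linarith
  then show ?thesis using w by (intro exI[of _ w]) auto
qed

lemma heteroclinic_exists:
  obtains V P where "\<And>t. (V has_real_derivative r (V t) * P t) (at t)"
    "\<And>t. (P has_real_derivative b (V t) * P t - r (V t) * f (V t)) (at t)"
    "\<And>t. Vp < V t" "(V \<longlongrightarrow> Vm) at_bot" "(V \<longlongrightarrow> Vp) at_top"
proof -
  obtain w where w: "w > Vm" "F w \<ge> F Vp" using F_unbounded by blast
  \<comment> \<open>The clamp is 1-Lipschitz with values in [Vp, w], so composition with it turns
    bounds on this interval into bounds on the whole line.\<close>
  define cl where "cl v = max Vp (min w v)" for v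
  have cl: "cl v \<in> {Vp..w}" "\<bar>cl v - cl v'\<bar> \<le> \<bar>v - v'\<bar>" "cl v > 0" for v v'
    using Vp_less_Vm w Vp_pos by (auto simp: cl_def)
  have cl_id: "cl v = v" if "v \<in> {Vp..w}" for v using that by (auto simp: cl_def)
  obtain L where L: "L \<ge> 0"
    "\<And>x y. x \<in> {Vp..w} \<Longrightarrow> y \<in> {Vp..w} \<Longrightarrow> \<bar>r x - r y\<bar> \<le> L * \<bar>x - y\<bar>"
    "\<And>x y. x \<in> {Vp..w} \<Longrightarrow> y \<in> {Vp..w} \<Longrightarrow> \<bar>f x - f y\<bar> \<le> L * \<bar>x - y\<bar>"
    "\<And>x y. x \<in> {Vp..w} \<Longrightarrow> y \<in> {Vp..w} \<Longrightarrow> \<bar>b x - b y\<bar> \<le> L * \<bar>x - y\<bar>"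
    "\<And>x. x \<in> {Vp..w} \<Longrightarrow> \<bar>r x\<bar> \<le> L" "\<And>x. x \<in> {Vp..w} \<Longrightarrow> \<bar>f x\<bar> \<le> L" "\<And>x. x \<in> {Vp..w} \<Longrightarrow> \<bar>b x\<bar> \<le> L"
    using coeff_lipschitz[OF Vp_pos, of w] by blast
  have lip: "\<bar>g (cl v) - g (cl v')\<bar> \<le> L * \<bar>v - v'\<bar>"
    if "\<And>x y. x \<in> {Vp..w} \<Longrightarrow> y \<in> {Vp..w} \<Longrightarrow> \<bar>g x - g y\<bar> \<le> L * \<bar>x - y\<bar>" for g v v'
    using that[OF cl(1) cl(1), of v v'] mult_left_mono[OF cl(2)[of v v'] L(1)] by linarith
  have "continuous_on UNIV (\<lambda>v. f (cl v))"
    by (rule lipschitz_on_continuous_on[of L], rule lipschitz_onI) (use lip[OF L(3)] L(1) in \<open>auto simp: dist_real_def\<close>)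
  then obtain G where G: "\<And>v. (G has_real_derivative f (cl v)) (at v)" using antiderivative_UNIV by blast
  \<comment> \<open>The cutoff force has a potential on the whole line. On [Vp, w] it differs from
    \<open>F\<close> by a constant, so the barrier at \<open>w\<close> carries over.\<close>
  have "((\<lambda>v. G v - F v) has_real_derivative 0) (at v within {Vp..w})" if "v \<in> {Vp..w}" for v
  proof -
    have "((\<lambda>v. G v - F v) has_real_derivative f (cl v) - f v) (at v)"
      using that Vp_pos by (intro DERIV_diff G dF) auto
    then show ?thesis using cl_id[OF that] by (simp add: has_field_derivative_at_within)
  qed
  then obtain k where k: "\<And>v. v \<in> {Vp..w} \<Longrightarrow> G v - F v = k"
    using has_field_derivative_zero_constant[of "{Vp..w}" "\<lambda>v. G v - F v"] by auto
  \<comment> \<open>With D the absolute potential difference, (1 + 2 D)^2 / 2 > D, so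
    \<open>M\<close> dominates the depth of the well.\<close>
  define M where "M = 1 + 2 * \<bar>G Vp - G Vm\<bar>"
  have "continuous_on UNIV (\<lambda>p. max (- M) (min M p))" by (intro continuous_intros)
  then obtain H where H: "\<And>p. (H has_real_derivative max (- M) (min M p)) (at p)"
    using antiderivative_UNIV by blast
  interpret cutoff_system "\<lambda>v. r (cl v)" "\<lambda>v. f (cl v)" "\<lambda>v. b (cl v)" G "\<lambda>p. H p - H 0" Vp Vm w M L L
  proof
    show "f (cl v) < 0" if "Vp < v" "v < Vm" for v using f_neg[OF that] that w by (simp add: cl_id)
    show "f (cl v) > 0" if "Vm < v" for v using f_pos[of "cl v"] Vp_less_Vm w that by (auto simp: cl_def)
    show "G Vp \<le> G w" using k[of Vp] k[of w] w Vp_less_Vm by auto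
    have "D < (1 + 2 * D)\<^sup>2 / 2" if "D \<ge> 0" for D :: real
    proof -
      have "(1 + 2 * D)\<^sup>2 / 2 - D = 1 / 2 + D + 2 * (D * D)"
        by (simp add: power2_eq_square field_simps)
      then show ?thesis using that zero_le_square[of D] by linarith
    qed
    from this[of "\<bar>G Vp - G Vm\<bar>"] show "G Vp - G Vm < M\<^sup>2 / 2" unfolding M_def by linarith
    show "((\<lambda>p. H p - H 0) has_real_derivative max (- M) (min M p)) (at p)" for p
      using H[of p] by (auto intro!: derivative_eq_intros)
    show "f (cl Vp) = 0" "f (cl Vm) = 0" using f_zero Vp_less_Vm w by (simp_all add: cl_id)
    show "0 < M" unfolding M_def by (intro add_pos_nonneg mult_nonneg_nonneg) auto
    show "\<bar>r (cl v)\<bar> \<le> L" "\<bar>f (cl v)\<bar> \<le> L" "\<bar>b (cl v)\<bar> \<le> L" for v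
      by (intro L(5-7) cl(1))+
    show "\<bar>r (cl v) - r (cl v')\<bar> \<le> L * \<bar>v - v'\<bar>" "\<bar>f (cl v) - f (cl v')\<bar> \<le> L * \<bar>v - v'\<bar>"
      "\<bar>b (cl v) - b (cl v')\<bar> \<le> L * \<bar>v - v'\<bar>" for v v'
      by (rule lip[OF L(2)] lip[OF L(3)] lip[OF L(4)]; assumption)+
  qed (use Vp_less_Vm w(1) L(1) in \<open>simp_all add: cl G r_pos b_pos\<close>)
  obtain V P where VP: "\<And>t. (V has_real_derivative r (cl (V t)) * P t) (at t)"
    "\<And>t. (P has_real_derivative b (cl (V t)) * P t - r (cl (V t)) * f (cl (V t))) (at t)"
    "\<And>t. Vp < V t" "\<And>t. V t < w" "(V \<longlongrightarrow> Vm) at_bot" "(V \<longlongrightarrow> Vp) at_top"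
    using heteroclinic_orbit by blast
  have "cl (V t) = V t" for t using VP(3,4) by (simp add: cl_id less_imp_le)
  then show ?thesis using that[of V P] VP by simp
qed

text \<open>The parameter \<open>c\<close> is the constant of integration of the momentum equation.\<close>

definition orbit :: "real \<Rightarrow> (real \<Rightarrow> real) \<Rightarrow> (real \<Rightarrow> real) \<Rightarrow> bool" where
  "orbit c V P \<longleftrightarrow> (\<forall>t. V t > 0 \<and> (V has_real_derivative r (V t) * P t) (at t) \<and>
     (P has_real_derivative b (V t) * P t + r (V t) * (c - f (V t))) (at t))"

lemma orbitD:
  assumes "orbit c V P"
  shows "V t > 0" "(V has_real_derivative r (V t) * P t) (at t)"
    "(P has_real_derivative b (V t) * P t + r (V t) * (c - f (V t))) (at t)"
    "isCont V t" "isCont P t"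
  using assms DERIV_isCont unfolding orbit_def by blast+

text \<open>A constant of integration \<open>c\<close> replaces the force \<open>f\<close> by
  \<open>f - c\<close>, hence the potential by F - c v; dissipation is unaffected.\<close>

lemma orbit_energy_mono:
  assumes "orbit c V P" "t \<le> u"
  shows "(P t)\<^sup>2 / 2 + (F (V t) - c * V t) \<le> (P u)\<^sup>2 / 2 + (F (V u) - c * V u)"
proof (rule DERIV_nonneg_imp_nondecreasing[OF assms(2), of "\<lambda>t. (P t)\<^sup>2 / 2 + (F (V t) - c * V t)"])
  fix x
  have "((\<lambda>t. F (V t)) has_real_derivative f (V x) * (r (V x) * P x)) (at x)"
    by (rule DERIV_chain2[OF dF]) (use orbitD[OF assms(1)] in auto)
  then have "((\<lambda>t. (P t)\<^sup>2 / 2 + (F (V t) - c * V t)) has_real_derivative b (V x) * (P x)\<^sup>2) (at x)"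
    using orbitD(2,3)[OF assms(1), of x]
    by (auto intro!: derivative_eq_intros simp: field_simps power2_eq_square)
  then show "\<exists>y. ((\<lambda>t. (P t)\<^sup>2 / 2 + (F (V t) - c * V t)) has_real_derivative y) (at x) \<and> 0 \<le> y"
    using b_pos[OF orbitD(1)[OF assms(1)], of x]
    by (intro exI[of _ "b (V x) * (P x)\<^sup>2"]) auto
qed

text \<open>P^2 is \<kappa> times the squared velocity, and \<open>\<kappa>\<close> is bounded near
  the limit \<open>l\<close>. This is the last hypothesis of
  \<open>kinetic_energy_tendsto_0\<close>.\<close>

lemma small_velocity_small_energy:
  assumes V: "\<And>t. V t > 0" "(V \<longlongrightarrow> l) at_top" and l: "l > 0" and e: "e > 0"
  shows "\<exists>d>0. eventually (\<lambda>t. \<bar>r (V t) * P t\<bar> < d \<longrightarrow> \<bar>(P t)\<^sup>2 / 2\<bar> < e) at_top"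
proof -
  define k where "k = \<kappa> l + 1"
  have k: "k > 0" using \<kappa>_pos[OF l] by (simp add: k_def)
  have "((\<lambda>t. \<kappa> (V t)) \<longlongrightarrow> \<kappa> l) at_top"
    using DERIV_isCont[OF smooth_deriv(5)[OF l]] V(2) by (rule isCont_tendsto_compose)
  then have "eventually (\<lambda>t. \<kappa> (V t) < k) at_top"
    by (rule order_tendstoD) (simp add: k_def)
  then have "eventually (\<lambda>t. \<bar>r (V t) * P t\<bar> < sqrt (e / k) \<longrightarrow> \<bar>(P t)\<^sup>2 / 2\<bar> < e) at_top"
  proof eventually_elim
    case (elim t)
    show ?case
    proof
      assume "\<bar>r (V t) * P t\<bar> < sqrt (e / k)"
      then have "\<bar>r (V t) * P t\<bar>\<^sup>2 < (sqrt (e / k))\<^sup>2" by (intro power_strict_mono) auto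
      then have "(r (V t) * P t)\<^sup>2 < e / k" using e k by simp
      then have "(P t)\<^sup>2 / \<kappa> (V t) < e / k"
        using r_sq[OF V(1)[of t]] by (simp add: power2_eq_square algebra_simps)
      then have "(P t)\<^sup>2 < e / k * \<kappa> (V t)" using \<kappa>_pos[OF V(1)[of t]] by (simp add: divide_less_eq)
      also have "\<dots> \<le> e / k * k" using elim e k by (intro mult_left_mono) auto
      finally show "\<bar>(P t)\<^sup>2 / 2\<bar> < e" using k e by simp
    qed
  qed
  then show ?thesis using e k by (intro exI[of _ "sqrt (e / k)"]) auto
qed

lemma tendsto_0_of_square:
  assumes "((\<lambda>t::real. (P t)\<^sup>2 / 2) \<longlongrightarrow> (0::real)) G"
  shows "(P \<longlongrightarrow> 0) G"
proof -
  have "((\<lambda>t. sqrt (2 * ((P t)\<^sup>2 / 2))) \<longlongrightarrow> sqrt (2 * 0)) G"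
    using assms by (intro tendsto_intros)
  then show ?thesis by (simp add: tendsto_rabs_zero_iff)
qed

text \<open>Once P tends to 0, P' tends to r l (c - f l), which must vanish because P converges. So
  convergence of V alone determines the constant of integration.\<close>

lemma orbit_at_top:
  assumes "orbit c V P" and lim: "(V \<longlongrightarrow> l) at_top" and l: "l > 0"
  shows "(P \<longlongrightarrow> 0) at_top" "c = f l"
proof -
  note o = orbitD[OF assms(1)]
  have "((\<lambda>t. (P t)\<^sup>2 / 2) \<longlongrightarrow> 0) at_top"
  proof (rule kinetic_energy_tendsto_0[OF o(2) lim])
    show "isCont (\<lambda>v. F v - c * v) l" using DERIV_isCont[OF dF[OF l]] by (intro continuous_intros)
    show "mono (\<lambda>t. (P t)\<^sup>2 / 2 + (F (V t) - c * V t)) \<or> antimono (\<lambda>t. (P t)\<^sup>2 / 2 + (F (V t) - c * V t))"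
      using orbit_energy_mono[OF assms(1)] by (intro disjI1 monoI)
  qed (rule small_velocity_small_energy[OF o(1) lim l])
  then show P: "(P \<longlongrightarrow> 0) at_top" by (rule tendsto_0_of_square)
  have "((\<lambda>t. b (V t) * P t + r (V t) * (c - f (V t))) \<longlongrightarrow> b l * 0 + r l * (c - f l)) at_top"
    by (intro tendsto_intros P isCont_tendsto_compose[OF _ lim] DERIV_isCont[OF db[OF l]]
        DERIV_isCont[OF dr[OF l]] DERIV_isCont[OF df[OF l]])
  from derivative_limit_eq_0[OF o(3) P this] show "c = f l" using r_pos[OF l] by simp
qed

text \<open>The time-reversed orbit has nonincreasing energy; this is the second alternative in
  \<open>kinetic_energy_tendsto_0\<close>.\<close>

lemma orbit_at_bot:
  assumes "orbit c V P" and lim: "(V \<longlongrightarrow> l) at_bot" and l: "l > 0"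
  shows "(P \<longlongrightarrow> 0) at_bot"
proof -
  note o = orbitD[OF assms(1)]
  have lim': "((\<lambda>t. V (- t)) \<longlongrightarrow> l) at_top" using lim by (simp add: filterlim_at_bot_mirror)
  have dV: "((\<lambda>t. V (- t)) has_real_derivative - (r (V (- t)) * P (- t))) (at t)" for t
  proof -
    have "(uminus has_real_derivative - 1) (at t)" by (auto intro!: derivative_eq_intros)
    from DERIV_chain2[OF o(2) this] show ?thesis by simp
  qed
  have "((\<lambda>t. (P (- t))\<^sup>2 / 2) \<longlongrightarrow> 0) at_top"
  proof (rule kinetic_energy_tendsto_0[OF dV lim'])
    show "isCont (\<lambda>v. F v - c * v) l" using DERIV_isCont[OF dF[OF l]] by (intro continuous_intros)
    show "mono (\<lambda>t. (P (- t))\<^sup>2 / 2 + (F (V (- t)) - c * V (- t))) \<or>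
        antimono (\<lambda>t. (P (- t))\<^sup>2 / 2 + (F (V (- t)) - c * V (- t)))"
      using orbit_energy_mono[OF assms(1)] by (intro disjI2 antimonoI) auto
    show "\<exists>d>0. eventually (\<lambda>t. \<bar>- (r (V (- t)) * P (- t))\<bar> < d \<longrightarrow> \<bar>(P (- t))\<^sup>2 / 2\<bar> < e) at_top"
      if "e > 0" for e
      using small_velocity_small_energy[of "\<lambda>t. V (- t)" l e "\<lambda>t. P (- t)", OF o(1) lim' l that] by simp
  qed
  then have "((\<lambda>t. P (- t)) \<longlongrightarrow> 0) at_top" by (rule tendsto_0_of_square)
  then show ?thesis by (simp add: filterlim_at_bot_mirror)
qed

section \<open>Uniqueness of bounded orbits and the behaviour of connections\<close>

definition bounded_orbit :: "(real \<Rightarrow> real) \<Rightarrow> (real \<Rightarrow> real) \<Rightarrow> bool" where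
  "bounded_orbit V P \<longleftrightarrow> orbit 0 V P \<and> (\<exists>c>0. \<exists>K. \<forall>t. c \<le> V t \<and> V t \<le> K \<and> \<bar>P t\<bar> \<le> K)"

definition connection :: "(real \<Rightarrow> real) \<Rightarrow> (real \<Rightarrow> real) \<Rightarrow> bool" where
  "connection V P \<longleftrightarrow> orbit 0 V P \<and> (V \<longlongrightarrow> Vm) at_bot \<and> (V \<longlongrightarrow> Vp) at_top"

text \<open>Both orbits lie in a common box away from v = 0, where the coefficients are Lipschitz;
  this is all that Gronwall asks for.\<close>

lemma bounded_orbits_agree:
  assumes "bounded_orbit V P" "bounded_orbit V' P'" "V t0 = V' t0" "P t0 = P' t0"
  shows "V t = V' t \<and> P t = P' t"
proof -
  obtain c1 K1 where 1: "c1 > 0" "\<And>t. c1 \<le> V t \<and> V t \<le> K1 \<and> \<bar>P t\<bar> \<le> K1"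
    using assms(1) unfolding bounded_orbit_def by blast
  obtain c2 K2 where 2: "c2 > 0" "\<And>t. c2 \<le> V' t \<and> V' t \<le> K2 \<and> \<bar>P' t\<bar> \<le> K2"
    using assms(2) unfolding bounded_orbit_def by blast
  define c K where "c = min c1 c2" and "K = max K1 K2"
  have c: "c > 0" using 1(1) 2(1) by (simp add: c_def)
  have in_box: "V t \<in> {c..K}" "V' t \<in> {c..K}" "\<bar>P t\<bar> \<le> K" "\<bar>P' t\<bar> \<le> K" for t
    using 1(2)[of t] 2(2)[of t] by (auto simp: c_def K_def)
  then have K: "K \<ge> 0" using abs_ge_zero order_trans by blast
  obtain L where L: "L \<ge> 0"
    "\<And>x y. x \<in> {c..K} \<Longrightarrow> y \<in> {c..K} \<Longrightarrow> \<bar>r x - r y\<bar> \<le> L * \<bar>x - y\<bar>"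
    "\<And>x y. x \<in> {c..K} \<Longrightarrow> y \<in> {c..K} \<Longrightarrow> \<bar>f x - f y\<bar> \<le> L * \<bar>x - y\<bar>"
    "\<And>x y. x \<in> {c..K} \<Longrightarrow> y \<in> {c..K} \<Longrightarrow> \<bar>b x - b y\<bar> \<le> L * \<bar>x - y\<bar>"
    "\<And>x. x \<in> {c..K} \<Longrightarrow> \<bar>r x\<bar> \<le> L" "\<And>x. x \<in> {c..K} \<Longrightarrow> \<bar>f x\<bar> \<le> L" "\<And>x. x \<in> {c..K} \<Longrightarrow> \<bar>b x\<bar> \<le> L"
    using coeff_lipschitz[OF c, of K] by blast
  \<comment> \<open>\<open>L * K\<close> and \<open>L\<close> bound a coefficient times the
    momentum, \<open>2 * L * L\<close> bounds the product of \<open>r\<close> and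
    \<open>f\<close>.\<close>
  define N where "N = L * K + L + 2 * L * L"
  have N: "L * K + 2 * L * L \<le> N" "L \<le> N" "N \<ge> 0" using L(1) K by (auto simp: N_def)
  have est: "\<bar>x\<bar> \<le> N * (\<bar>u\<bar> + \<bar>v\<bar>)"
    if "\<bar>x\<bar> \<le> (L * K + 2 * L * L) * \<bar>u\<bar> + L * \<bar>v\<bar>" for x u v :: real
    using that mult_right_mono[OF N(1), of "\<bar>u\<bar>"] mult_right_mono[OF N(2), of "\<bar>v\<bar>"]
    by (simp add: distrib_left)
  note o = assms(1,2)[unfolded bounded_orbit_def, THEN conjunct1]
  show ?thesis
  proof (rule planar_unique[OF orbitD(2,3)[OF o(1)] orbitD(2,3)[OF o(2)] _ _ N(3) assms(3,4)])
    fix u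
    have 1: "\<bar>r (V u) * P u - r (V' u) * P' u\<bar> \<le> L * \<bar>V u - V' u\<bar> * K + L * \<bar>P u - P' u\<bar>"
      "\<bar>b (V u) * P u - b (V' u) * P' u\<bar> \<le> L * \<bar>V u - V' u\<bar> * K + L * \<bar>P u - P' u\<bar>"
      by (rule abs_mult_diff_le; use L in_box in simp)+
    have 2: "\<bar>r (V u) * f (V u) - r (V' u) * f (V' u)\<bar> \<le> L * \<bar>V u - V' u\<bar> * L + L * (L * \<bar>V u - V' u\<bar>)"
      by (rule abs_mult_diff_le; use L in_box in simp)
    have 3: "0 \<le> 2 * L * L * \<bar>V u - V' u\<bar>" using L(1) by simp
    show "\<bar>r (V u) * P u - r (V' u) * P' u\<bar> \<le> N * (\<bar>V u - V' u\<bar> + \<bar>P u - P' u\<bar>)"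
      using 1(1) 3 by (intro est) (simp add: algebra_simps)
    have "b (V u) * P u + r (V u) * (0 - f (V u)) - (b (V' u) * P' u + r (V' u) * (0 - f (V' u)))
      = (b (V u) * P u - b (V' u) * P' u) - (r (V u) * f (V u) - r (V' u) * f (V' u))"
      by (simp add: algebra_simps)
    then show "\<bar>b (V u) * P u + r (V u) * (0 - f (V u)) - (b (V' u) * P' u + r (V' u) * (0 - f (V' u)))\<bar>
        \<le> N * (\<bar>V u - V' u\<bar> + \<bar>P u - P' u\<bar>)"
      using 1(2) 2 by (intro est) (simp add: algebra_simps abs_le_iff)
  qed
qed

lemma connectionD:
  assumes "connection V P"
  shows "orbit 0 V P" "(V \<longlongrightarrow> Vm) at_bot" "(V \<longlongrightarrow> Vp) at_top"
    "(P \<longlongrightarrow> 0) at_bot" "(P \<longlongrightarrow> 0) at_top"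
  using assms orbit_at_bot[OF _ _ Vm_pos] orbit_at_top(1)[OF _ _ Vp_pos] unfolding connection_def by blast+

lemma connection_bounded:
  assumes "connection V P"
  shows "bounded_orbit V P"
proof -
  note o = orbitD[OF connectionD(1)[OF assms]] and l = connectionD(2-5)[OF assms]
  have cont: "continuous_on UNIV V" "continuous_on UNIV P"
    using o(4,5) by (auto simp: continuous_on_eq_continuous_at)
  obtain K1 where K1: "\<And>t. \<bar>V t\<bar> \<le> K1" using bounded_of_limits[OF cont(1) l(1,2)] by blast
  obtain K2 where K2: "\<And>t. \<bar>P t\<bar> \<le> K2" using bounded_of_limits[OF cont(2) l(3,4)] by blast
  \<comment> \<open>A bound for 1 / V is a positive lower bound for V; it exists because both limits
    of V are positive.\<close>
  have "continuous_on UNIV (\<lambda>t. inverse (V t))" using cont(1) o(1) by (intro continuous_intros) (auto simp: less_imp_neq[symmetric])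
  moreover have "((\<lambda>t. inverse (V t)) \<longlongrightarrow> inverse Vm) at_bot" "((\<lambda>t. inverse (V t)) \<longlongrightarrow> inverse Vp) at_top"
    using l(1,2) Vm_pos Vp_pos by (auto intro!: tendsto_inverse)
  ultimately obtain K3 where K3: "\<And>t. \<bar>inverse (V t)\<bar> \<le> K3" using bounded_of_limits by blast
  have "inverse (V 0) > 0" using o(1)[of 0] by simp
  then have "K3 > 0" using K3[of 0] by linarith
  have "inverse K3 \<le> V t" for t
    using K3[of t] o(1)[of t] \<open>K3 > 0\<close> by (simp add: field_simps)
  moreover have "V t \<le> max K1 K2" "\<bar>P t\<bar> \<le> max K1 K2" for t using K1[of t] K2[of t] by auto
  ultimately show ?thesis using connectionD(1)[OF assms] \<open>K3 > 0\<close> unfolding bounded_orbit_def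
    by (intro conjI exI[of _ "inverse K3"] exI[of _ "max K1 K2"]) auto
qed

lemma equilibrium_orbit:
  assumes "v > 0" "f v = 0"
  shows "bounded_orbit (\<lambda>_. v) (\<lambda>_. 0)"
  using assms unfolding bounded_orbit_def orbit_def
  by (auto intro!: exI[of _ v])

text \<open>By uniqueness such an orbit would be constant and its two limits would coincide.\<close>

lemma connection_not_equilibrium:
  assumes "connection V P" "v > 0" "f v = 0"
  shows "\<not> (V t = v \<and> P t = 0)"
proof
  assume "V t = v \<and> P t = 0"
  then have "V = (\<lambda>_. v)"
    using bounded_orbits_agree[OF connection_bounded[OF assms(1)] equilibrium_orbit[OF assms(2,3)], of t]
    by blast
  then have "v = Vm" "v = Vp"
    using connectionD(2,3)[OF assms(1)] by (simp_all add: tendsto_const_iff)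
  then show False using Vp_less_Vm by simp
qed

text \<open>The energy never exceeds its limit \<open>F Vp\<close>. Where V equals \<open>Vp\<close>
  this leaves no kinetic energy, so the orbit would sit at the equilibrium.\<close>

lemma connection_gt:
  assumes "connection V P"
  shows "V t > Vp"
proof (rule ccontr)
  assume n: "\<not> V t > Vp"
  note o = orbitD[OF connectionD(1)[OF assms]]
  obtain u where u: "u \<le> t" "V u > Vp"
    using order_tendstoD(1)[OF connectionD(2)[OF assms] Vp_less_Vm]
    unfolding eventually_at_bot_linorder by (metis linorder_le_cases order_refl)
  obtain x where x: "V x = Vp"
    using IVT2'[of V t Vp u] n u o(4) by (auto intro!: continuous_at_imp_continuous_on)
  have "((\<lambda>t. (P t)\<^sup>2 / 2 + (F (V t) - 0 * V t)) \<longlongrightarrow> 0\<^sup>2 / 2 + (F Vp - 0 * Vp)) at_top"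
    using DERIV_isCont[OF dF[OF Vp_pos]]
    by (intro tendsto_intros connectionD[OF assms] isCont_tendsto_compose[of _ F]) auto
  then have "(P x)\<^sup>2 / 2 + (F (V x) - 0 * V x) \<le> 0\<^sup>2 / 2 + (F Vp - 0 * Vp)"
    by (rule tendsto_lowerbound)
      (auto simp: eventually_at_top_linorder intro!: exI[of _ x] orbit_energy_mono[OF connectionD(1)[OF assms], simplified])
  then have "P x = 0" using x by (simp add: power2_less_eq_zero_iff)
  then show False using connection_not_equilibrium[OF assms Vp_pos f_zero(1), of x] x by simp
qed

text \<open>If P were nonnegative at a late time, the force - r f, positive left of
  \<open>Vm\<close>, would keep it so; V would then not decrease and could not come down to
  \<open>Vp\<close>.\<close>

lemma connection_tail:
  assumes "connection V P"
  obtains T where "\<And>t. t \<ge> T \<Longrightarrow> P t < 0" "\<And>t. t \<ge> T \<Longrightarrow> V t < Vm"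
proof -
  note o = orbitD[OF connectionD(1)[OF assms]]
  obtain T where T: "\<And>t. t \<ge> T \<Longrightarrow> V t < Vm"
    using order_tendstoD(2)[OF connectionD(3)[OF assms] Vp_less_Vm]
    unfolding eventually_at_top_linorder by blast
  have "P t1 < 0" if t1: "t1 \<ge> T" for t1
  proof (rule ccontr)
    assume n: "\<not> P t1 < 0"
    have "continuous_on UNIV (\<lambda>t. b (V t))"
      using o(1,4) by (intro continuous_on_compose2[OF cont_coeff(8)[of "{0<..}"]])
        (auto intro: continuous_at_imp_continuous_on)
    then have P: "P t \<ge> 0" if "t \<ge> t1" for t
    proof (rule affine_growth_nonneg[OF o(3), rotated])
      show "P t1 \<ge> 0" using n by simp
      fix u assume "t1 \<le> u"
      then show "0 \<le> r (V u) * (0 - f (V u))"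
        using f_neg[OF connection_gt[OF assms] T[of u]] t1 r_pos[OF o(1), of u] by (simp add: mult_nonneg_nonpos)
    qed (use that in auto)
    have "V t1 \<le> V t" if "t \<ge> t1" for t
    proof (rule DERIV_nonneg_imp_nondecreasing[OF that, where f = V])
      fix x assume "t1 \<le> x"
      then show "\<exists>y. (V has_real_derivative y) (at x) \<and> 0 \<le> y"
        using o(2)[of x] P[of x] r_pos[OF o(1), of x] by (intro exI[of _ "r (V x) * P x"]) auto
    qed
    then have "V t1 \<le> Vp"
      by (intro tendsto_lowerbound[OF connectionD(3)[OF assms]]) (auto simp: eventually_at_top_linorder)
    then show False using connection_gt[OF assms, of t1] by simp
  qed
  then show ?thesis using that T by blast
qed

lemma orbit_shift:
  assumes "orbit c V P"
  shows "orbit c (\<lambda>t. V (t + k)) (\<lambda>t. P (t + k))"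
  using orbitD[OF assms] unfolding orbit_def by (auto simp: DERIV_shift[symmetric])

lemma connection_reaches:
  assumes "connection V P" "Vp < v" "v \<le> V T"
  obtains t where "t \<ge> T" "V t = v"
proof -
  obtain u where u: "u \<ge> T" "V u < v"
    using order_tendstoD(2)[OF connectionD(3)[OF assms(1)] assms(2)]
    unfolding eventually_at_top_linorder by (metis linorder_le_cases order_refl)
  have "continuous_on {T..u} V"
    using orbitD(4)[OF connectionD(1)[OF assms(1)]] by (auto intro: continuous_at_imp_continuous_on)
  then show ?thesis using IVT2'[of V u v T] u assms(3) that by auto
qed

text \<open>Both tails sweep all levels just above \<open>Vp\<close>, so they share one.
  \<open>stable_branch_unique\<close> equates the momenta there, and uniqueness of the initial value
  problem does the rest after a shift.\<close>

lemma connection_unique: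
  assumes c: "connection V P" and c': "connection V' P'"
  obtains k where "\<And>y. V' y = V (y + k)"
proof -
  note o = orbitD[OF connectionD(1)[OF c]] and o' = orbitD[OF connectionD(1)[OF c']]
  obtain T where T: "\<And>t. t \<ge> T \<Longrightarrow> P t < 0" "\<And>t. t \<ge> T \<Longrightarrow> V t < Vm" using connection_tail[OF c] by blast
  obtain T' where T': "\<And>t. t \<ge> T' \<Longrightarrow> P' t < 0" "\<And>t. t \<ge> T' \<Longrightarrow> V' t < Vm" using connection_tail[OF c'] by blast
  \<comment> \<open>The extra 1 puts the common level strictly below the start of each tail, where
    the graphs are differentiable.\<close>
  have "\<exists>t\<ge>T + 1. \<exists>t'\<ge>T' + 1. V t = V' t'"
  proof (cases "V (T + 1) \<le> V' (T' + 1)")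
    case True
    obtain t' where "t' \<ge> T' + 1" "V' t' = V (T + 1)"
      using connection_reaches[OF c' connection_gt[OF c] True] .
    then show ?thesis by (intro exI[of _ "T + 1"]) auto
  next
    case False
    then have "V' (T' + 1) \<le> V (T + 1)" by simp
    from connection_reaches[OF c connection_gt[OF c'] this]
    obtain t where "t \<ge> T + 1" "V t = V' (T' + 1)" .
    then show ?thesis by (intro exI[of _ t]) auto
  qed
  then obtain t t' where t: "t \<ge> T + 1" "t' \<ge> T' + 1" "V t = V' t'" by blast
  have dec: "V u < V T" if "u > T" for u
  proof (rule DERIV_neg_imp_decreasing[OF that, where f = V])
    fix x assume "T \<le> x"
    then show "\<exists>y. (V has_real_derivative y) (at x) \<and> y < 0"
      using o(2)[of x] T(1)[of x] r_pos[OF o(1), of x] by (intro exI[of _ "r (V x) * P x"]) (auto simp: mult_pos_neg)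
  qed
  have dec': "V' u < V' T'" if "u > T'" for u
  proof (rule DERIV_neg_imp_decreasing[OF that, where f = V'])
    fix x assume "T' \<le> x"
    then show "\<exists>y. (V' has_real_derivative y) (at x) \<and> y < 0"
      using o'(2)[of x] T'(1)[of x] r_pos[OF o'(1), of x] by (intro exI[of _ "r (V' x) * P' x"]) (auto simp: mult_pos_neg)
  qed
  have "P t = P' t'"
  proof (rule stable_branch_unique[where r = r and b = b and f = f and a = Vp and V = V and V' = V' and T = T and T' = T'
        and P = P and P' = P' and t = t and t' = t'])
    show "(P has_real_derivative b (V t) * P t - r (V t) * f (V t)) (at t)"
      "(P' has_real_derivative b (V' t) * P' t - r (V' t) * f (V' t)) (at t)" for t
      using o(3)[of t] o'(3)[of t] by (simp_all add: algebra_simps)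
    show "V t < V T" using dec[of t] t by simp
  qed (use t T T' dec dec' r_pos b_pos Vp_pos o(2) o'(2) connection_gt[OF c] connection_gt[OF c']
      connectionD[OF c] connectionD[OF c'] in \<open>auto simp: less_imp_le\<close>)
  have b1: "bounded_orbit (\<lambda>y. V (y + (t - t'))) (\<lambda>y. P (y + (t - t')))"
    using connection_bounded[OF c] orbit_shift unfolding bounded_orbit_def by blast
  have "V' y = V (y + (t - t'))" for y
    using bounded_orbits_agree[OF connection_bounded[OF c'] b1, of t' y] t \<open>P t = P' t'\<close> by simp
  then show ?thesis by (rule that)
qed

section \<open>Passage between orbits and traveling profiles\<close>

definition profile_accel :: "real \<Rightarrow> real \<Rightarrow> real" where
  "profile_accel v q = - (1 / \<kappa> v) * (f v + s * (\<mu> v / v) * q + 1/2 * deriv \<kappa> v * q\<^sup>2)"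

lemma profile_field_eq: "profile_field p \<mu> \<kappa> s Vm x = vector [x $ 2, profile_accel (x $ 1) (x $ 2)]"
  by (simp add: profile_field_def profile_accel_def f_def Let_def)

text \<open>Back from momentum to velocity: the derivative of r = 1 / sqrt \<kappa> along the orbit
  restores the quadratic term.\<close>

lemma orbit_velocity:
  assumes "orbit 0 V P"
  shows "((\<lambda>t. r (V t) * P t) has_real_derivative profile_accel (V t) (r (V t) * P t)) (at t)"
proof -
  note o = orbitD[OF assms]
  have "((\<lambda>t. r (V t)) has_real_derivative (- deriv \<kappa> (V t) / (2 * \<kappa> (V t)) * r (V t)) * (r (V t) * P t)) (at t)"
    by (rule DERIV_chain2[OF dr[OF o(1)] o(2)])
  from DERIV_mult[OF this o(3)]
  have "((\<lambda>t. r (V t) * P t) has_real_derivative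
      (- deriv \<kappa> (V t) / (2 * \<kappa> (V t)) * r (V t)) * (r (V t) * P t) * P t +
      (b (V t) * P t + r (V t) * (0 - f (V t))) * r (V t)) (at t)" .
  also have "(- deriv \<kappa> (V t) / (2 * \<kappa> (V t)) * r (V t)) * (r (V t) * P t) * P t +
      (b (V t) * P t + r (V t) * (0 - f (V t))) * r (V t) =
      - (deriv \<kappa> (V t) / (2 * \<kappa> (V t))) * (r (V t) * P t)\<^sup>2 + b (V t) * (r (V t) * P t)
      - (r (V t) * r (V t)) * f (V t)"
    by (simp add: power2_eq_square algebra_simps)
  also have "\<dots> = profile_accel (V t) (r (V t) * P t)"
    unfolding r_sq[OF o(1)] profile_accel_def b_def
    using \<kappa>_pos[OF o(1), of t] o(1)[of t] by (simp add: field_simps)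
  finally show ?thesis .
qed

text \<open>Bootstrap for the pair (V, Q): both derivatives are expressions in V and Q, so each
  order of differentiability gives the next.\<close>

lemma orbit_smooth:
  assumes "orbit 0 V P"
  shows "smooth_on UNIV V"
proof -
  note o = orbitD[OF assms]
  define Q where "Q t = r (V t) * P t" for t
  have dV: "(V has_real_derivative Q t) (at t)" for t using o(2) by (simp add: Q_def)
  have dQ: "(Q has_real_derivative profile_accel (V t) (Q t)) (at t)" for t
    using orbit_velocity[OF assms, of t] by (simp add: Q_def[abs_def])
  have "times_differentiable_on n UNIV V \<and> times_differentiable_on n UNIV Q" for n
  proof (induction n)
    case (Suc n)
    have comp: "times_differentiable_on n UNIV (\<lambda>t. g (V t))" if "times_differentiable_on n {0<..} g" for g
      using that Suc.IH o(1) by (intro times_differentiable_on_compose[of UNIV n "{0<..}" g V]) auto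
    have sm: "times_differentiable_on k {0<..} p" "times_differentiable_on k {0<..} \<mu>"
      "times_differentiable_on k {0<..} \<kappa>" for k
      using smooth by (auto simp: smooth_on_iff)
    have c: "times_differentiable_on n UNIV (\<lambda>_. c)" for c by (simp add: times_differentiable_on_const)
    have nz: "\<kappa> (V t) \<noteq> 0" "V t \<noteq> 0" for t using \<kappa>_pos[OF o(1), of t] o(1)[of t] by auto
    note t = Suc.IH[THEN conjunct1] Suc.IH[THEN conjunct2] comp[OF sm(1)] comp[OF sm(2)]
      comp[OF times_differentiable_on_deriv[OF sm(3)]]
      times_differentiable_on_inverse[OF open_UNIV comp[OF sm(3)] nz(1)]
      times_differentiable_on_inverse[OF open_UNIV Suc.IH[THEN conjunct1] nz(2)]
    note add = times_differentiable_on_add[OF open_UNIV] and mult = times_differentiable_on_mult[OF open_UNIV]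
    \<comment> \<open>The acceleration is written with sums, products and inverses only, so that the
      closure rules apply literally.\<close>
    have "times_differentiable_on n UNIV (\<lambda>t. (- 1) * (inverse (\<kappa> (V t)) *
      (((p (V t) + (s\<^sup>2 * V t + (- (s\<^sup>2 * Vm + p Vm)))) + (s * (\<mu> (V t) * inverse (V t))) * Q t) +
       ((1/2) * deriv \<kappa> (V t)) * (Q t * Q t))))"
      by (intro add mult c t)
    also have "(\<lambda>t. (- 1) * (inverse (\<kappa> (V t)) *
      (((p (V t) + (s\<^sup>2 * V t + (- (s\<^sup>2 * Vm + p Vm)))) + (s * (\<mu> (V t) * inverse (V t))) * Q t) +
       ((1/2) * deriv \<kappa> (V t)) * (Q t * Q t)))) = (\<lambda>t. profile_accel (V t) (Q t))"
    proof
      fix t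
      have "p (V t) + (s\<^sup>2 * V t + (- (s\<^sup>2 * Vm + p Vm))) = f (V t)"
        by (simp add: f_def reduced_flux_def)
      then show "(- 1) * (inverse (\<kappa> (V t)) *
        (((p (V t) + (s\<^sup>2 * V t + (- (s\<^sup>2 * Vm + p Vm)))) + (s * (\<mu> (V t) * inverse (V t))) * Q t) +
         ((1/2) * deriv \<kappa> (V t)) * (Q t * Q t))) = profile_accel (V t) (Q t)"
        by (simp only: profile_accel_def power2_eq_square divide_inverse)
    qed
    finally have "times_differentiable_on (Suc n) UNIV Q"
      by (rule times_differentiable_on_SucI[OF open_UNIV dQ])
    moreover have "times_differentiable_on (Suc n) UNIV V"
      using Suc.IH by (intro times_differentiable_on_SucI[OF open_UNIV dV]) auto
    ultimately show ?case by simp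
  qed simp
  then show ?thesis by (simp add: smooth_on_iff)
qed

lemma traveling_profile_of_connection:
  assumes c: "connection V P" and U: "\<And>y. U y = Up + s * Vp - s * V y" and RH: "s * (Vp - Vm) = Um - Up"
  shows "traveling_profile p \<mu> \<kappa> Vm Um Vp Up s V U"
proof -
  note o = orbitD[OF connectionD(1)[OF c]]
  have smV: "smooth_on UNIV V" by (rule orbit_smooth[OF connectionD(1)[OF c]])
  have Ueq: "U = (\<lambda>y. (Up + s * Vp) + (- s) * V y)" using U by (auto simp: algebra_simps)
  have smU: "smooth_on UNIV U"
    unfolding Ueq smooth_on_iff using smV
    by (intro allI times_differentiable_on_add times_differentiable_on_mult times_differentiable_on_const open_UNIV)
      (simp add: smooth_on_iff)
  define Q where "Q t = r (V t) * P t" for t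
  have dV: "(V has_real_derivative Q t) (at t)" for t using o(2) by (simp add: Q_def)
  have dQ: "(Q has_real_derivative profile_accel (V t) (Q t)) (at t)" for t
    using orbit_velocity[OF connectionD(1)[OF c], of t] by (simp add: Q_def[abs_def])
  have dU: "(U has_real_derivative - s * Q t) (at t)" for t
    unfolding Ueq using dV[of t] by (auto intro!: derivative_eq_intros)
  have eqs: "deriv V = Q" "deriv U = (\<lambda>t. - s * Q t)" "deriv Q = (\<lambda>t. profile_accel (V t) (Q t))"
    using DERIV_imp_deriv[OF dV] DERIV_imp_deriv[OF dU] DERIV_imp_deriv[OF dQ] by auto
  define A where "A t = \<mu> (V t) / V t * (- s * Q t)" for t
  \<comment> \<open>The momentum equation integrated once, with constant 0; \<open>A\<close> is the
    viscous stress.\<close>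
  have B: "\<kappa> (V t) * profile_accel (V t) (Q t) + 1/2 * deriv \<kappa> (V t) * (Q t)\<^sup>2 = A t - f (V t)" for t
    using \<kappa>_pos[OF o(1), of t] o(1)[of t] by (simp add: profile_accel_def A_def field_simps)
  have dp: "((\<lambda>z. p (V z)) has_real_derivative deriv p (V y) * Q y) (at y)" for y
    by (rule DERIV_chain2[OF smooth_deriv(1)[OF o(1)] dV])
  have df': "((\<lambda>z. f (V z)) has_real_derivative (deriv p (V y) + s\<^sup>2) * Q y) (at y)" for y
    by (rule DERIV_chain2[OF df[OF o(1)] dV])
  \<comment> \<open>\<open>deriv\<close> obeys the difference rule only for differentiable terms, so
    the viscous stress must first be shown differentiable.\<close>
  have "\<exists>A'. (A has_real_derivative A') (at y)" for y
  proof -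
    have "((\<lambda>z. \<mu> (V z)) has_real_derivative deriv \<mu> (V y) * Q y) (at y)"
      by (rule DERIV_chain2[OF smooth_deriv(3)[OF o(1)] dV])
    then show ?thesis unfolding A_def using dV[of y] dQ[of y] o(1)[of y]
      by (intro exI) (rule DERIV_mult DERIV_divide DERIV_cmult | assumption | simp)+
  qed
  then obtain A' where dA: "\<And>y. (A has_real_derivative A' y) (at y)" by metis
  have "- s * (- s * Q y) + deriv (\<lambda>z. p (V z)) y = deriv A y - deriv (\<lambda>z. A z - f (V z)) y" for y
    unfolding DERIV_imp_deriv[OF dp] DERIV_imp_deriv[OF dA] DERIV_imp_deriv[OF DERIV_diff[OF dA df']]
    by (simp add: power2_eq_square algebra_simps)
  then have third: "\<forall>y. - s * deriv U y + deriv (\<lambda>z. p (V z)) y =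
      deriv (\<lambda>z. \<mu> (V z) / V z * deriv U z) y
      - deriv (\<lambda>z. \<kappa> (V z) * deriv (deriv V) z + 1/2 * deriv \<kappa> (V z) * (deriv V z)\<^sup>2) y"
    unfolding eqs B by (simp add: A_def[abs_def])
  have "(U \<longlongrightarrow> (Up + s * Vp) + (- s) * Vm) at_bot" "(U \<longlongrightarrow> (Up + s * Vp) + (- s) * Vp) at_top"
    unfolding Ueq by (intro tendsto_intros connectionD[OF c])+
  moreover have "(Up + s * Vp) + (- s) * Vm = Um" using RH by (simp add: algebra_simps)
  ultimately have "(U \<longlongrightarrow> Um) at_bot" "(U \<longlongrightarrow> Up) at_top" by simp_all
  then show ?thesis unfolding traveling_profile_def
    using smV smU o(1) third connectionD(2,3)[OF c] by (auto simp: eqs)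
qed

text \<open>Each equation integrates to a constant, and both constants are determined at +infinity:
  the first from the limits of U and V, the second by \<open>orbit_at_top\<close>, which requires no
  decay of the derivatives of V.\<close>

lemma connection_of_traveling_profile:
  assumes tp: "traveling_profile p \<mu> \<kappa> Vm Um Vp Up s V U"
  shows "connection V (\<lambda>y. sqrt (\<kappa> (V y)) * deriv V y)" "U y = Up + s * Vp - s * V y"
proof -
  have smV: "smooth_on UNIV V" and smU: "smooth_on UNIV U" and pos: "\<And>y. V y > 0"
    and e1: "\<And>y. - s * deriv V y - deriv U y = 0"
    and e2: "\<And>y. - s * deriv U y + deriv (\<lambda>z. p (V z)) y = deriv (\<lambda>z. \<mu> (V z) / V z * deriv U z) y
      - deriv (\<lambda>z. \<kappa> (V z) * deriv (deriv V) z + 1/2 * deriv \<kappa> (V z) * (deriv V z)\<^sup>2) y"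
    and lim: "(V \<longlongrightarrow> Vm) at_bot" "(V \<longlongrightarrow> Vp) at_top" "(U \<longlongrightarrow> Up) at_top"
    using tp unfolding traveling_profile_def by auto
  define Q where "Q = deriv V"
  define Q' where "Q' = deriv Q"
  have dV: "(V has_real_derivative Q t) (at t)" and dQ: "(Q has_real_derivative Q' t) (at t)"
    and dQ': "(Q' has_real_derivative deriv Q' t) (at t)" for t
    using smooth_on_DERIV[OF smV, of t 0] smooth_on_DERIV[OF smV, of t 1] smooth_on_DERIV[OF smV, of t 2]
    by (simp_all add: Q_def Q'_def numeral_2_eq_2)
  have dU: "(U has_real_derivative deriv U t) (at t)" for t
    using smooth_on_DERIV[OF smU, of t 0] by simp
  have derU: "deriv U t = - s * Q t" for t using e1[of t] by (simp add: Q_def)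
  have "((\<lambda>y. U y + s * V y) has_real_derivative 0) (at t)" for t
    using dU[of t] dV[of t] derU[of t] by (auto intro!: derivative_eq_intros)
  then obtain k where k: "\<And>y. U y + s * V y = k"
    using DERIV_isconst_all[of "\<lambda>y. U y + s * V y"] by metis
  have "((\<lambda>y. U y + s * V y) \<longlongrightarrow> Up + s * Vp) at_top" using lim by (intro tendsto_intros)
  then have "k = Up + s * Vp" unfolding k by (simp add: tendsto_const_iff)
  then show "U y = Up + s * Vp - s * V y" using k[of y] by simp
  define A where "A t = \<mu> (V t) / V t * (- s * Q t)" for t
  define B where "B t = \<kappa> (V t) * Q' t + 1/2 * deriv \<kappa> (V t) * (Q t)\<^sup>2" for t
  have dp: "((\<lambda>z. p (V z)) has_real_derivative deriv p (V y) * Q y) (at y)" for y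
    by (rule DERIV_chain2[OF smooth_deriv(1)[OF pos] dV])
  have d\<mu>: "((\<lambda>z. \<mu> (V z)) has_real_derivative deriv \<mu> (V y) * Q y) (at y)" for y
    by (rule DERIV_chain2[OF smooth_deriv(3)[OF pos] dV])
  have d\<kappa>: "((\<lambda>z. \<kappa> (V z)) has_real_derivative deriv \<kappa> (V y) * Q y) (at y)" for y
    by (rule DERIV_chain2[OF smooth_deriv(5)[OF pos] dV])
  have d\<kappa>': "((\<lambda>z. deriv \<kappa> (V z)) has_real_derivative deriv (deriv \<kappa>) (V y) * Q y) (at y)" for y
    by (rule DERIV_chain2[OF smooth_deriv(6)[OF pos] dV])
  have df': "((\<lambda>z. f (V z)) has_real_derivative (deriv p (V y) + s\<^sup>2) * Q y) (at y)" for y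
    by (rule DERIV_chain2[OF df[OF pos] dV])
  have "\<exists>A'. (A has_real_derivative A') (at y)" for y
    unfolding A_def using dV[of y] dQ[of y] pos[of y] d\<mu>[of y]
    by (intro exI) (rule DERIV_mult DERIV_divide DERIV_cmult | assumption | simp)+
  then obtain A' where dA: "\<And>y. (A has_real_derivative A' y) (at y)" by metis
  \<comment> \<open>Differentiating the capillary term uses the third derivative of V, available
    from smoothness.\<close>
  have "\<exists>B'. (B has_real_derivative B') (at y)" for y
    unfolding B_def power2_eq_square using dQ[of y] dQ'[of y] d\<kappa>[of y] d\<kappa>'[of y]
    by (intro exI) (rule DERIV_add DERIV_mult DERIV_cmult | assumption)+
  then obtain B' where dB: "\<And>y. (B has_real_derivative B' y) (at y)" by metis
  have "- s * (- s * Q y) + deriv p (V y) * Q y = A' y - B' y" for y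
    using e2[of y] unfolding derU Q_def[symmetric] Q'_def[symmetric] A_def[symmetric] B_def[symmetric]
    by (simp add: DERIV_imp_deriv[OF dp] DERIV_imp_deriv[OF dA] DERIV_imp_deriv[OF dB])
  then have "((\<lambda>y. B y - A y + f (V y)) has_real_derivative 0) (at y)" for y
    using DERIV_add[OF DERIV_diff[OF dB dA] df', of y] by (simp add: power2_eq_square algebra_simps)
  then obtain c where c: "\<And>y. B y - A y + f (V y) = c"
    using DERIV_isconst_all[of "\<lambda>y. B y - A y + f (V y)"] by metis
  have "orbit c V (\<lambda>y. sqrt (\<kappa> (V y)) * Q y)"
    unfolding orbit_def
  proof (intro allI conjI)
    fix t
    have \<kappa>: "\<kappa> (V t) > 0" "sqrt (\<kappa> (V t)) > 0" using \<kappa>_pos[OF pos] by auto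
    show "V t > 0" by (rule pos)
    show "(V has_real_derivative r (V t) * (sqrt (\<kappa> (V t)) * Q t)) (at t)"
      using dV[of t] \<kappa> by (simp add: r_def)
    have "((\<lambda>y. sqrt (\<kappa> (V y)) * Q y) has_real_derivative
        (inverse (sqrt (\<kappa> (V t))) / 2 * (deriv \<kappa> (V t) * Q t)) * Q t + Q' t * sqrt (\<kappa> (V t))) (at t)"
      by (rule DERIV_mult[OF DERIV_chain2[OF DERIV_real_sqrt[OF \<kappa>(1)] d\<kappa>] dQ])
    also have "(inverse (sqrt (\<kappa> (V t))) / 2 * (deriv \<kappa> (V t) * Q t)) * Q t + Q' t * sqrt (\<kappa> (V t))
      = r (V t) * B t"
    proof -
      have y: "Q' t * sqrt (\<kappa> (V t)) = r (V t) * (\<kappa> (V t) * Q' t)"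
        using real_sqrt_mult_self[of "\<kappa> (V t)"] \<kappa> by (simp add: r_def field_simps)
      have x: "(inverse (sqrt (\<kappa> (V t))) / 2 * (deriv \<kappa> (V t) * Q t)) * Q t
        = r (V t) * (1/2 * deriv \<kappa> (V t) * (Q t)\<^sup>2)"
        by (simp add: r_def power2_eq_square field_simps)
      show ?thesis unfolding x y B_def distrib_left by (rule add.commute)
    qed
    also have "B t = A t + (c - f (V t))" using c[of t] by simp
    also have "r (V t) * (A t + (c - f (V t))) = r (V t) * A t + r (V t) * (c - f (V t))"
      by (rule distrib_left)
    also have "r (V t) * A t = b (V t) * (sqrt (\<kappa> (V t)) * Q t)"
    proof -
      have "b (V t) * (sqrt (\<kappa> (V t)) * Q t) = A t * (sqrt (\<kappa> (V t)) / \<kappa> (V t))"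
        by (simp add: b_def A_def)
      also have "sqrt (\<kappa> (V t)) / \<kappa> (V t) = r (V t)"
        using real_sqrt_mult_self[of "\<kappa> (V t)"] \<kappa> by (simp add: r_def field_simps)
      finally show ?thesis by simp
    qed
    finally show "((\<lambda>y. sqrt (\<kappa> (V y)) * Q y) has_real_derivative
      b (V t) * (sqrt (\<kappa> (V t)) * Q t) + r (V t) * (c - f (V t))) (at t)" .
  qed
  moreover from orbit_at_top(2)[OF this lim(2) Vp_pos] have "c = 0" using f_zero by simp
  ultimately show "connection V (\<lambda>y. sqrt (\<kappa> (V y)) * deriv V y)"
    using lim by (simp add: connection_def Q_def)
qed

section \<open>Linearisation at the left state and oscillation\<close>

lemma profile_field_derivative:
  defines "\<alpha> \<equiv> (deriv p Vm + s\<^sup>2) / \<kappa> Vm"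
  shows "(profile_field p \<mu> \<kappa> s Vm has_derivative (\<lambda>h. vector [h $ 2, b Vm * h $ 2 - \<alpha> * h $ 1]))
    (at (vector [Vm, 0]))"
proof -
  define z :: "real^2" where "z = vector [Vm, 0]"
  have z: "z $ 1 = Vm" "z $ 2 = 0" by (simp_all add: z_def)
  have \<kappa>: "\<kappa> Vm > 0" by (rule \<kappa>_pos[OF Vm_pos])
  have d1: "((\<lambda>x::real^2. x $ 1) has_derivative (\<lambda>h. h $ 1)) (at z)"
    and d2: "((\<lambda>x::real^2. x $ 2) has_derivative (\<lambda>h. h $ 2)) (at z)"
    by (intro bounded_linear_imp_has_derivative bounded_linear_vec_nth)+
  have "((\<lambda>v. - (1 / \<kappa> v)) has_real_derivative deriv \<kappa> Vm / (\<kappa> Vm)\<^sup>2) (at Vm)"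
    using smooth_deriv(5)[OF Vm_pos] \<kappa> by (auto intro!: derivative_eq_intros simp: power2_eq_square)
  \<comment> \<open>The value of \<open>k'\<close>, like those of \<open>m'\<close> and
    \<open>w'\<close> below, can stay unknown: each is multiplied by an expression that vanishes at
    the equilibrium.\<close>
  then obtain k' where k': "((\<lambda>v. - (1 / \<kappa> v)) has_real_derivative k') (at (z $ 1))" unfolding z by blast
  have "((\<lambda>v. \<mu> v / v) has_real_derivative (deriv \<mu> Vm * Vm - \<mu> Vm * 1) / (Vm * Vm)) (at Vm)"
    using Vm_pos by (intro DERIV_divide smooth_deriv(3) DERIV_ident) auto
  from DERIV_cmult[OF this, of s]
  obtain m' where m': "((\<lambda>v. s * (\<mu> v / v)) has_real_derivative m') (at (z $ 1))" unfolding z by blast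
  obtain w' where w': "((\<lambda>v. 1/2 * deriv \<kappa> v) has_real_derivative w') (at (z $ 1))"
    unfolding z using DERIV_cmult[OF smooth_deriv(6)[OF Vm_pos], of "1/2"] by blast
  have f': "(f has_real_derivative deriv p Vm + s\<^sup>2) (at (z $ 1))" unfolding z by (rule df[OF Vm_pos])
  have "((\<lambda>x. - (1 / \<kappa> (x $ 1)) *
      (f (x $ 1) + s * (\<mu> (x $ 1) / x $ 1) * x $ 2 + 1/2 * deriv \<kappa> (x $ 1) * (x $ 2 * x $ 2)))
    has_derivative (\<lambda>h. - (1 / \<kappa> (z $ 1)) *
      (h $ 1 * (deriv p Vm + s\<^sup>2) + (s * (\<mu> (z $ 1) / z $ 1) * h $ 2 + h $ 1 * m' * z $ 2) +
       (1/2 * deriv \<kappa> (z $ 1) * (z $ 2 * h $ 2 + h $ 2 * z $ 2) + h $ 1 * w' * (z $ 2 * z $ 2))) +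
      h $ 1 * k' * (f (z $ 1) + s * (\<mu> (z $ 1) / z $ 1) * z $ 2 + 1/2 * deriv \<kappa> (z $ 1) * (z $ 2 * z $ 2)))) (at z)"
    by (intro has_derivative_mult has_derivative_add DERIV_compose_FDERIV[OF k' d1]
        DERIV_compose_FDERIV[OF m' d1] DERIV_compose_FDERIV[OF w' d1] DERIV_compose_FDERIV[OF f' d1] d1 d2)
  also have "(\<lambda>h::real^2. - (1 / \<kappa> (z $ 1)) *
      (h $ 1 * (deriv p Vm + s\<^sup>2) + (s * (\<mu> (z $ 1) / z $ 1) * h $ 2 + h $ 1 * m' * z $ 2) +
       (1/2 * deriv \<kappa> (z $ 1) * (z $ 2 * h $ 2 + h $ 2 * z $ 2) + h $ 1 * w' * (z $ 2 * z $ 2))) +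
      h $ 1 * k' * (f (z $ 1) + s * (\<mu> (z $ 1) / z $ 1) * z $ 2 + 1/2 * deriv \<kappa> (z $ 1) * (z $ 2 * z $ 2)))
    = (\<lambda>h. b Vm * h $ 2 - \<alpha> * h $ 1)"
    using \<kappa> Vm_pos by (simp add: z f_zero b_def \<alpha>_def field_simps fun_eq_iff)
  finally have "((\<lambda>x. profile_accel (x $ 1) (x $ 2)) has_derivative (\<lambda>h. b Vm * h $ 2 - \<alpha> * h $ 1)) (at z)"
    by (simp add: profile_accel_def power2_eq_square)
  from has_derivative_vector_2[OF d2 this] show ?thesis
    unfolding z_def profile_field_eq[abs_def] .
qed

text \<open>The Jacobian is a companion matrix. Its eigenvalues have real part b / 2 > 0, and
  \<open>disc\<close> makes them non-real.\<close>

lemma profile_field_focus: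
  assumes disc: "(b Vm)\<^sup>2 < 4 * ((deriv p Vm + s\<^sup>2) / \<kappa> Vm)"
  shows "focus (profile_field p \<mu> \<kappa> s Vm) (vector [Vm, 0])"
proof -
  let ?F = "profile_field p \<mu> \<kappa> s Vm" and ?z = "vector [Vm, 0] :: real^2"
  define \<alpha> where "\<alpha> = (deriv p Vm + s\<^sup>2) / \<kappa> Vm"
  have D: "(?F has_derivative (\<lambda>h. vector [h $ 2, b Vm * h $ 2 - \<alpha> * h $ 1])) (at ?z)"
    using profile_field_derivative by (simp add: \<alpha>_def)
  define J where "J = jacobian ?F (at ?z)"
  have "J = matrix (\<lambda>h. vector [h $ 2, b Vm * h $ 2 - \<alpha> * h $ 1])"
    unfolding J_def jacobian_def using frechet_derivative_at[OF D] by simp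
  then have "J $ 1 $ 1 = 0" "J $ 1 $ 2 = 1" "J $ 2 $ 1 = - \<alpha>" "J $ 2 $ 2 = b Vm"
    by (simp_all add: matrix_def axis_def)
  from complex_eigenvalues_companion[OF this] disc
  have "complex_eigenvalues J = {Complex (b Vm / 2) (sqrt (4 * \<alpha> - (b Vm)\<^sup>2) / 2),
      Complex (b Vm / 2) (- (sqrt (4 * \<alpha> - (b Vm)\<^sup>2) / 2))}"
    by (simp add: \<alpha>_def)
  moreover have "?F ?z = 0"
    by (simp add: profile_field_eq profile_accel_def f_zero vec_eq_iff forall_2)
  moreover have "b Vm / 2 \<noteq> 0" "sqrt (4 * \<alpha> - (b Vm)\<^sup>2) / 2 \<noteq> 0"
    using b_pos[OF Vm_pos] disc by (auto simp: \<alpha>_def)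
  ultimately show ?thesis using D unfolding focus_def J_def differentiable_def by blast
qed

lemma connection_oscillating:
  assumes c: "connection V P" and disc: "(b Vm)\<^sup>2 < 4 * ((deriv p Vm + s\<^sup>2) / \<kappa> Vm)"
  shows "oscillating p \<mu> \<kappa> s Vm V"
proof -
  note o = orbitD[OF connectionD(1)[OF c]]
  define \<alpha> where "\<alpha> = (deriv p Vm + s\<^sup>2) / \<kappa> Vm"
  define z :: "real^2" where "z = vector [Vm, 0]"
  define Q where "Q t = r (V t) * P t" for t
  define y' where "y' t = profile_accel (V t) (Q t)" for t
  have dV: "(V has_real_derivative Q t) (at t)" for t using o(2) by (simp add: Q_def)
  have dQ: "(Q has_real_derivative y' t) (at t)" for t
    using orbit_velocity[OF connectionD(1)[OF c], of t] by (simp add: Q_def[abs_def] y'_def)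
  have Q: "deriv V = Q" "deriv Q = y'" using DERIV_imp_deriv[OF dV] DERIV_imp_deriv[OF dQ] by auto
  have dx: "((\<lambda>t. V t - Vm) has_real_derivative Q t) (at t)" for t
    using dV[of t] by (auto intro!: derivative_eq_intros)
  have "(y' has_real_derivative deriv y' t) (at t)" for t
    using smooth_on_DERIV[OF orbit_smooth[OF connectionD(1)[OF c]], of t 2] by (simp add: Q numeral_2_eq_2)
  then have cont: "continuous_on UNIV y'" by (intro continuous_at_imp_continuous_on ballI DERIV_isCont)
  have ne: "V t - Vm \<noteq> 0 \<or> Q t \<noteq> 0" for t
    using connection_not_equilibrium[OF c Vm_pos f_zero(2), of t] r_pos[OF o(1), of t] by (auto simp: Q_def)
  have Qlim: "(Q \<longlongrightarrow> r Vm * 0) at_bot"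
    unfolding Q_def[abs_def]
    by (intro tendsto_mult connectionD(4)[OF c] isCont_tendsto_compose[OF DERIV_isCont[OF dr[OF Vm_pos]] connectionD(2)[OF c]])
  have diff: "vector [V t, Q t] - z = vector [V t - Vm, Q t]" for t
    by (simp add: z_def vec_eq_iff forall_2)
  have nrm: "norm (vector [V t, Q t] - z) = sqrt ((V t - Vm)\<^sup>2 + (Q t)\<^sup>2)" for t
    unfolding diff by (rule vector_2_norm)
  have "((\<lambda>t. sqrt ((V t - Vm)\<^sup>2 + (Q t)\<^sup>2)) \<longlongrightarrow> sqrt ((Vm - Vm)\<^sup>2 + (r Vm * 0)\<^sup>2)) at_bot"
    by (intro tendsto_intros connectionD[OF c] Qlim)
  then have lim0: "((\<lambda>t. norm (vector [V t, Q t] - z)) \<longlongrightarrow> 0) at_bot" by (simp add: nrm)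
  have lim: "((\<lambda>t. vector [V t, Q t]) \<longlongrightarrow> z) at_bot"
    by (rule LIM_zero_cancel[OF tendsto_norm_zero_cancel[OF lim0]])
  \<comment> \<open>The second component of the remainder in the derivative of the profile field at
    the equilibrium, evaluated along the orbit.\<close>
  have lin: "eventually (\<lambda>t. \<bar>y' t - (b Vm * Q t - \<alpha> * (V t - Vm))\<bar> \<le> e * sqrt ((V t - Vm)\<^sup>2 + (Q t)\<^sup>2)) at_bot"
    if e: "e > 0" for e
  proof -
    let ?F = "profile_field p \<mu> \<kappa> s Vm"
    have "(?F has_derivative (\<lambda>h. vector [h $ 2, b Vm * h $ 2 - \<alpha> * h $ 1])) (at z)"
      using profile_field_derivative by (simp add: \<alpha>_def z_def)
    then obtain d where d: "d > 0" "\<And>y. norm (y - z) < d \<Longrightarrow>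
        norm (?F y - ?F z - vector [(y - z) $ 2, b Vm * (y - z) $ 2 - \<alpha> * (y - z) $ 1]) \<le> e * norm (y - z)"
      using e unfolding has_derivative_at_alt by blast
    have "eventually (\<lambda>t. norm (vector [V t, Q t] - z) < d) at_bot"
      using order_tendstoD(2)[OF lim0 d(1)] .
    then show ?thesis
    proof eventually_elim
      case (elim t)
      let ?E = "?F (vector [V t, Q t]) - ?F z - vector [(vector [V t, Q t] - z) $ 2,
        b Vm * (vector [V t, Q t] - z) $ 2 - \<alpha> * (vector [V t, Q t] - z) $ 1]"
      have "?E $ 2 = y' t - (b Vm * Q t - \<alpha> * (V t - Vm))"
        by (simp add: profile_field_eq z_def y'_def) (simp add: profile_accel_def f_zero)
      then have "\<bar>y' t - (b Vm * Q t - \<alpha> * (V t - Vm))\<bar> \<le> norm ?E"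
        using component_le_norm_cart[of ?E 2] by simp
      also have "\<dots> \<le> e * norm (vector [V t, Q t] - z)" by (rule d(2)[OF elim])
      finally show ?case by (simp add: nrm)
    qed
  qed
  obtain \<theta> where \<theta>: "continuous_on UNIV \<theta>"
    "\<And>t. V t - Vm = sqrt ((V t - Vm)\<^sup>2 + (Q t)\<^sup>2) * cos (\<theta> t)"
    "\<And>t. Q t = sqrt ((V t - Vm)\<^sup>2 + (Q t)\<^sup>2) * sin (\<theta> t)"
    "filterlim \<theta> at_top at_bot"
    using focus_spiral[OF dx dQ cont ne, of "b Vm" \<alpha>] disc lin unfolding \<alpha>_def by blast
  have "spirals_at_bot (\<lambda>y. vector [V y, deriv V y]) z"
    unfolding spirals_at_bot_def Q
  proof (intro conjI exI[of _ 0] exI[of _ \<theta>] allI impI)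
    fix t :: real
    show "vector [V t, Q t] \<noteq> z" using ne[of t] by (auto simp: z_def vec_eq_iff forall_2)
    show "vector [V t, Q t] - z = norm (vector [V t, Q t] - z) *\<^sub>R vector [cos (\<theta> t), sin (\<theta> t)]"
      unfolding nrm unfolding diff using \<theta>(2,3)[of t] by (simp add: vec_eq_iff forall_2)
  qed (use \<theta> lim filterlim_at_top_imp_at_infinity in \<open>auto intro: continuous_on_subset\<close>)
  moreover have "\<not> mono V"
  proof
    assume "mono V"
    then have "V 0 \<le> Vp"
      by (intro tendsto_lowerbound[OF connectionD(3)[OF c]]) (auto simp: eventually_at_top_linorder mono_def)
    then show False using connection_gt[OF c, of 0] by simp
  qed
  moreover have "\<not> antimono V"
  proof
    assume anti: "antimono V"
    have le: "V t \<le> Vm" for t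
      using anti by (intro tendsto_lowerbound[OF connectionD(2)[OF c]])
        (auto simp: eventually_at_bot_linorder antimono_def)
    \<comment> \<open>At multiples of 2 \<pi> the displacement points towards V > Vm. The unbounded
      angle passes through one, while a nonincreasing V would stay below its limit at
      -infinity.\<close>
    obtain n where n: "\<theta> 0 \<le> 2 * real n * pi"
      using reals_Archimedean3[of "2 * pi"] pi_gt_zero by (metis less_imp_le mult.assoc mult.commute mult_pos_pos zero_less_numeral)
    obtain t0 where t0: "t0 \<le> 0" "2 * real n * pi \<le> \<theta> t0"
      using \<theta>(4) unfolding filterlim_at_top eventually_at_bot_linorder by (metis linorder_le_cases order_refl)
    obtain t where "\<theta> t = 2 * real n * pi"
      using IVT2'[of \<theta> 0 "2 * real n * pi" t0] n t0 \<theta>(1) continuous_on_subset by blast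
    then have "V t - Vm = sqrt ((V t - Vm)\<^sup>2 + (Q t)\<^sup>2)" using \<theta>(2)[of t] by (simp add: cos_2npi)
    moreover have "(V t - Vm)\<^sup>2 + (Q t)\<^sup>2 > 0" using ne[of t] by (simp add: sum_power2_gt_zero_iff)
    ultimately show False using le[of t] by (smt (verit) real_sqrt_gt_zero)
  qed
  ultimately show ?thesis using profile_field_focus[OF disc] by (simp add: oscillating_def z_def)
qed

end

section \<open>From the hypotheses of the theorem to those of the profile analysis\<close>

lemma viscous_shock_intro:
  assumes "smooth_on {0<..} p" "smooth_on {0<..} \<mu>" "smooth_on {0<..} \<kappa>"
    and "\<And>v. v > 0 \<Longrightarrow> \<mu> v > 0" "\<And>v. v > 0 \<Longrightarrow> \<kappa> v > 0"
    and p': "\<And>v. v > 0 \<Longrightarrow> deriv p v < 0" and "\<And>v. v > 0 \<Longrightarrow> deriv (deriv p) v > 0"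
    and V: "Vm > 0" "Vp > 0" and shock: "compressive_1_shock p Vm Um Vp Up s"
  shows "viscous_shock p \<mu> \<kappa> Vm Vp s"
proof
  have RH: "s * (Vp - Vm) = Um - Up" "s * (Up - Um) = p Vp - p Vm"
    and lax: "- sqrt (- deriv p Vp) < s" "s < - sqrt (- deriv p Vm)"
    using shock by (auto simp: compressive_1_shock_def char_speed1_def)
  have "sqrt (- deriv p Vm) \<ge> 0" using p'[OF V(1)] by simp
  then show s: "s < 0" using lax(2) by linarith
  \<comment> \<open>Inserting the first jump relation into the second eliminates the
    velocities.\<close>
  have "p Vp - p Vm = s * - (s * (Vp - Vm))" using RH by (metis minus_diff_eq)
  then show "p Vp + s\<^sup>2 * Vp = p Vm + s\<^sup>2 * Vm" by (simp add: power2_eq_square algebra_simps)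
  have "(- s)\<^sup>2 < (sqrt (- deriv p Vp))\<^sup>2" using lax(1) s by (intro power_strict_mono) auto
  then show "deriv p Vp + s\<^sup>2 < 0" using p'[OF V(2)] by simp
  have "(sqrt (- deriv p Vm))\<^sup>2 < (- s)\<^sup>2" using lax(2) p'[OF V(1)] by (intro power_strict_mono) auto
  then show "deriv p Vm + s\<^sup>2 > 0" using p'[OF V(1)] by simp
qed (use assms in auto)

text \<open>Since b(Vm) = \<eta>(Vm) \<bar>s\<bar> / (Vm sqrt \<kappa>(Vm)), the bound on \<eta>
  says that the characteristic polynomial at (Vm, 0) has negative discriminant.\<close>

lemma (in viscous_shock) discriminant_of_eta:
  assumes "eta \<mu> \<kappa> Vm < 2 * Vm * sqrt (deriv (reduced_flux p s Vm) Vm) / \<bar>s\<bar>"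
  shows "(b Vm)\<^sup>2 < 4 * ((deriv p Vm + s\<^sup>2) / \<kappa> Vm)"
proof -
  have f': "deriv (reduced_flux p s Vm) Vm = deriv p Vm + s\<^sup>2"
    using DERIV_imp_deriv[OF df[OF Vm_pos]] by (simp add: f_def)
  have \<kappa>: "\<kappa> Vm > 0" "sqrt (\<kappa> Vm) > 0" and \<mu>: "\<mu> Vm > 0"
    using \<kappa>_pos[OF Vm_pos] \<mu>_pos[OF Vm_pos] by auto
  have "b Vm = (\<mu> Vm / sqrt (\<kappa> Vm)) * (- s) / (Vm * sqrt (\<kappa> Vm))"
    using \<kappa> real_sqrt_mult_self[of "\<kappa> Vm"] by (simp add: b_def field_simps)
  also have "\<dots> < (2 * Vm * sqrt (deriv p Vm + s\<^sup>2) / (- s)) * (- s) / (Vm * sqrt (\<kappa> Vm))"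
    using assms s_neg \<kappa> Vm_pos unfolding f' eta_def
    by (intro divide_strict_right_mono mult_strict_right_mono) auto
  also have "\<dots> = 2 * sqrt (deriv p Vm + s\<^sup>2) / sqrt (\<kappa> Vm)"
    using s_neg Vm_pos by simp
  finally have "(b Vm)\<^sup>2 < (2 * sqrt (deriv p Vm + s\<^sup>2) / sqrt (\<kappa> Vm))\<^sup>2"
    using b_pos[OF Vm_pos] by (intro power_strict_mono) auto
  then show ?thesis using lax(2) \<kappa> by (simp add: power_divide power_mult_distrib)
qed

theorem theorem4:
  fixes p \<mu> \<kappa> :: "real \<Rightarrow> real" and Vm Um Vp Up s :: real
  assumes "smooth_on {0<..} p" and "smooth_on {0<..} \<mu>" and "smooth_on {0<..} \<kappa>"
    and "\<And>v. v > 0 \<Longrightarrow> \<mu> v > 0"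
    and "\<And>v. v > 0 \<Longrightarrow> \<kappa> v > 0"
    and "\<And>v. v > 0 \<Longrightarrow> deriv p v < 0"
    and "\<And>v. v > 0 \<Longrightarrow> deriv (deriv p) v > 0"
    and "Vm > 0" and "Vp > 0"
    and "compressive_1_shock p Vm Um Vp Up s"
  shows "(\<exists>V U. traveling_profile p \<mu> \<kappa> Vm Um Vp Up s V U \<and>
            (\<forall>V' U'. traveling_profile p \<mu> \<kappa> Vm Um Vp Up s V' U' \<longrightarrow>
               (\<exists>c. \<forall>y. V' y = V (y + c) \<and> U' y = U (y + c)))) \<and>
         (0 < eta \<mu> \<kappa> Vm \<and>
          eta \<mu> \<kappa> Vm < 2 * Vm * sqrt (deriv (reduced_flux p s Vm) Vm) / \<bar>s\<bar> \<longrightarrow>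
            (\<forall>V U. traveling_profile p \<mu> \<kappa> Vm Um Vp Up s V U \<longrightarrow>
               oscillating p \<mu> \<kappa> s Vm V))"
proof -
  interpret viscous_shock p \<mu> \<kappa> Vm Vp s by (rule viscous_shock_intro[OF assms])
  have RH: "s * (Vp - Vm) = Um - Up" using assms(10) by (simp add: compressive_1_shock_def)
  obtain V P where VP: "\<And>t. (V has_real_derivative r (V t) * P t) (at t)"
    "\<And>t. (P has_real_derivative b (V t) * P t - r (V t) * f (V t)) (at t)"
    "\<And>t. Vp < V t" "(V \<longlongrightarrow> Vm) at_bot" "(V \<longlongrightarrow> Vp) at_top"
    using heteroclinic_exists by blast
  have "V t > 0" for t using VP(3)[of t] assms(9) by linarith
  then have c: "connection V P" using VP by (simp add: connection_def orbit_def)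
  \<comment> \<open>U + s V is constant along a profile; the right state gives its value.\<close>
  define U where "U y = Up + s * Vp - s * V y" for y
  have "traveling_profile p \<mu> \<kappa> Vm Um Vp Up s V U"
    using c U_def RH by (rule traveling_profile_of_connection)
  moreover have "\<exists>k. \<forall>y. V' y = V (y + k) \<and> U' y = U (y + k)"
    if tp: "traveling_profile p \<mu> \<kappa> Vm Um Vp Up s V' U'" for V' U'
  proof -
    obtain k where "\<And>y. V' y = V (y + k)"
      using connection_unique[OF c connection_of_traveling_profile(1)[OF tp]] by blast
    then show ?thesis using connection_of_traveling_profile(2)[OF tp] by (auto simp: U_def)
  qed
  moreover have "oscillating p \<mu> \<kappa> s Vm V'"
    if "eta \<mu> \<kappa> Vm < 2 * Vm * sqrt (deriv (reduced_flux p s Vm) Vm) / \<bar>s\<bar>"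
      and "traveling_profile p \<mu> \<kappa> Vm Um Vp Up s V' U'" for V' U'
    using connection_oscillating[OF connection_of_traveling_profile(1)[OF that(2)] discriminant_of_eta[OF that(1)]] .
  ultimately show ?thesis by blast
qed

end
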